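(* Let $a>0$ and $n\in\mathbb{N}$ be given. The set $\{\varphi^{\sharp n}:\varphi\in L^2([0,a))\}$ is gap-rich in $L^2([0,na))$.
   Context: $\mathbb{N}=\{1,2,\ldots\}$. All $L^2$ spaces consist of real-valued functions. For $\varphi\in L^2([0,a))$, $\varphi^{\sharp n}\in L^2([0,na))$ is the concatenation of $n$ copies of $\varphi$: $\varphi^{\sharp n}(x)=\varphi(x-ia)$ for $x\in[ia,(i+1)a)$, $0\le i\le n-1$. Let $c>0$ and let $Y\subseteq L^2([0,c))$ be perfect (closed without isolated points), with metric $d$ induced by the $L^2$ norm. Words over $Y$: $Y^\star=\bigcup_{p\ge1}Y^p$. For $\boldsymbol{x}\in Y^p$, $\boldsymbol{x}^{\sharp\mathbb{Z}}\in Y^{\mathbb{Z}}$ is the $p$-periodic sequence coinciding with $\boldsymbol{x}$ on $\{1,\ldots,p\}$. For words $\boldsymbol{x},\boldsymbol{y}\in Y^\star$ of possibly different lengths, $d(\boldsymbol{x},\boldsymbol{y}):=\sup_{j\in\mathbb{Z}}d\big((\boldsymbol{x}^{\sharp\mathbb{Z}})_j,(\boldsymbol{y}^{\sharp\mathbb{Z}})_j\big)$. For a periodic sequence $\boldsymbol{y}=(y_j)_{j\in\mathbb{Z}}\in Y^{\mathbb{Z}}$, $\boldsymbol{y}^\natural:\mathbb{R}\to\mathbb{R}$ is given by $\boldsymbol{y}^\natural(x)=y_j(x-jc)$ for $x\in[jc,(j+1)c)$, $j\in\mathbb{Z}$, and $L_{\boldsymbol{y}}=-\partial_x^2+\boldsymbol{y}^\natural$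 is the associated self-adjoint Schr\"odinger operator in $L^2(\mathbb{R})$. For a word $\boldsymbol{x}\in Y^\star$, $L_{\boldsymbol{x}}:=L_{\boldsymbol{x}^{\sharp\mathbb{Z}}}$. $\operatorname{spec}$ denotes the spectrum. $Y$ is gap-rich with exceptional set $S\subseteq\mathbb{R}$ if $S$ is discrete and for every $E\in\mathbb{R}\setminus S$, $\boldsymbol{x}\in Y^\star$ and $\varepsilon>0$ there exists $\boldsymbol{y}\in Y^\star$ with $d(\boldsymbol{x},\boldsymbol{y})<\varepsilon$ and $E\notin\operatorname{spec}(L_{\boldsymbol{y}})$. $Y$ is gap-rich if it is gap-rich with some exceptional set. *)

theory Defs
  imports "HOL-Analysis.Analysis"
begin

section \<open>The real Hilbert space of square-integrable functions on the line\<close>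

definition sq_integrable :: "(real \<Rightarrow> real) \<Rightarrow> bool" where
  "sq_integrable f \<longleftrightarrow> f \<in> borel_measurable lborel \<and> integrable lborel (\<lambda>x. (f x)\<^sup>2)"

definition l2_eq :: "(real \<Rightarrow> real) \<Rightarrow> (real \<Rightarrow> real) \<Rightarrow> bool" where
  "l2_eq f g \<longleftrightarrow> sq_integrable f \<and> sq_integrable g \<and> (AE x in lborel. f x = g x)"

lemma sq_integrable_measurable [measurable_dest]:
  "sq_integrable f \<Longrightarrow> f \<in> borel_measurable borel"
  by (simp add: sq_integrable_def)

lemma sq_integrable_prod:
  assumes "sq_integrable f" "sq_integrable g"
  shows "integrable lborel (\<lambda>x. f x * g x)"
proof (rule Bochner_Integration.integrable_bound)
  show "integrable lborel (\<lambda>x. (f x)\<^sup>2 + (g x)\<^sup>2)"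
    using assms by (auto simp: sq_integrable_def)
  have [measurable]: "f \<in> borel_measurable borel" "g \<in> borel_measurable borel"
    using assms by (auto simp: sq_integrable_def)
  show "(\<lambda>x. f x * g x) \<in> borel_measurable lborel" by measurable
  have "\<bar>f x * g x\<bar> \<le> (f x)\<^sup>2 + (g x)\<^sup>2" for x
  proof -
    have "0 \<le> (f x - g x)\<^sup>2" "0 \<le> (f x + g x)\<^sup>2" "0 \<le> (f x)\<^sup>2" "0 \<le> (g x)\<^sup>2" by auto
    then show ?thesis by (simp add: power2_sum power2_diff abs_le_iff)
  qed
  then show "AE x in lborel. norm (f x * g x) \<le> norm ((f x)\<^sup>2 + (g x)\<^sup>2)" by simp
qed

lemma sq_integrable_zero [simp]: "sq_integrable (\<lambda>x. 0)"
  by (simp add: sq_integrable_def)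

lemma sq_integrable_scale: "sq_integrable f \<Longrightarrow> sq_integrable (\<lambda>x. r * f x)"
  by (auto simp: sq_integrable_def power_mult_distrib)

lemma sq_integrable_add:
  assumes "sq_integrable f" "sq_integrable g"
  shows "sq_integrable (\<lambda>x. f x + g x)"
proof -
  have "integrable lborel (\<lambda>x. (f x)\<^sup>2 + (g x)\<^sup>2 + 2 * (f x * g x))"
    using assms sq_integrable_prod[OF assms] by (auto simp: sq_integrable_def)
  then show ?thesis
    using assms by (auto simp: sq_integrable_def power2_sum mult.assoc)
qed

lemma sq_integrable_sum:
  "(\<And>i. i \<in> I \<Longrightarrow> sq_integrable (f i)) \<Longrightarrow> sq_integrable (\<lambda>x. \<Sum>i\<in>I. f i x)"
  by (induction I rule: infinite_finite_induct) (auto intro: sq_integrable_add)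

lemma sq_integrable_shift:
  assumes "sq_integrable f"
  shows "sq_integrable (\<lambda>x. f (x - t))"
  using assms lborel_integrable_real_affine[of "\<lambda>x. (f x)\<^sup>2" 1 "- t"]
  by (auto simp: sq_integrable_def)

lemma sq_integrable_indicator:
  assumes "sq_integrable f" "A \<in> sets borel"
  shows "sq_integrable (\<lambda>x. indicator A x * f x)"
proof -
  have "integrable lborel (\<lambda>x. indicator A x *\<^sub>R (f x)\<^sup>2)"
    using assms by (intro integrable_mult_indicator) (auto simp: sq_integrable_def)
  moreover have "indicator A x *\<^sub>R (f x)\<^sup>2 = (indicator A x * f x)\<^sup>2" for x
    by (simp add: indicator_def)
  ultimately show ?thesis
    using assms by (auto simp: sq_integrable_def)
qed

lemma AE_lborel_shift:
  assumes "AE x in lborel. P x"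
  shows "AE x in lborel. P (x - t :: real)"
proof -
  have "AE x in distr lborel borel ((+) (- t)). P x"
    using assms by (subst lborel_distr_plus)
  then have "AE x in lborel. P (- t + x)"
    by (rule AE_distrD[rotated]) simp
  then show ?thesis by simp
qed

quotient_type l2 = "real \<Rightarrow> real" / partial: l2_eq
proof (rule part_equivpI)
  show "\<exists>f. l2_eq f f" by (intro exI[of _ "\<lambda>x. 0"]) (simp add: l2_eq_def)
  show "symp l2_eq" by (auto simp: symp_def l2_eq_def elim: AE_mp)
  show "transp l2_eq"
  proof (rule transpI)
    fix f g h assume "l2_eq f g" "l2_eq g h"
    then show "l2_eq f h" by (auto simp: l2_eq_def elim: AE_mp)
  qed
qed

instantiation l2 :: real_vector
begin

lift_definition zero_l2 :: l2 is "\<lambda>x. 0" by (simp add: l2_eq_def)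

lift_definition plus_l2 :: "l2 \<Rightarrow> l2 \<Rightarrow> l2" is "\<lambda>f g x. f x + g x"
  by (auto simp: l2_eq_def intro: sq_integrable_add)

lift_definition scaleR_l2 :: "real \<Rightarrow> l2 \<Rightarrow> l2" is "\<lambda>r f x. r * f x"
  by (auto simp: l2_eq_def intro: sq_integrable_scale)

definition uminus_l2 :: "l2 \<Rightarrow> l2" where "uminus_l2 f = (-1) *\<^sub>R f"

definition minus_l2 :: "l2 \<Rightarrow> l2 \<Rightarrow> l2" where "minus_l2 f g = f + - g"

instance
proof
  fix f g h :: l2 and r s :: real
  show "f + g + h = f + (g + h)"
    by transfer (auto simp: l2_eq_def add.assoc intro!: sq_integrable_add)
  show "f + g = g + f"
    by transfer (auto simp: l2_eq_def add.commute intro!: sq_integrable_add)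
  show "0 + f = f"
    by transfer (auto simp: l2_eq_def)
  show "- f + f = 0"
    unfolding uminus_l2_def by transfer (auto simp: l2_eq_def)
  show "f - g = f + - g"
    by (simp add: minus_l2_def)
  show "r *\<^sub>R (f + g) = r *\<^sub>R f + r *\<^sub>R g"
    by transfer (auto simp: l2_eq_def distrib_left intro!: sq_integrable_add sq_integrable_scale)
  show "(r + s) *\<^sub>R f = r *\<^sub>R f + s *\<^sub>R f"
    by transfer (auto simp: l2_eq_def distrib_right intro!: sq_integrable_add sq_integrable_scale)
  show "r *\<^sub>R s *\<^sub>R f = (r * s) *\<^sub>R f"
    by transfer (auto simp: l2_eq_def mult.assoc intro!: sq_integrable_scale)
  show "1 *\<^sub>R f = f"
    by transfer (auto simp: l2_eq_def)
qed

end

instantiation l2 :: real_inner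
begin

lift_definition inner_l2 :: "l2 \<Rightarrow> l2 \<Rightarrow> real" is "\<lambda>f g. \<integral>x. f x * g x \<partial>lborel"
  by (rule integral_cong_AE) (auto simp: l2_eq_def sq_integrable_def)

definition norm_l2 :: "l2 \<Rightarrow> real" where "norm_l2 f = sqrt (inner f f)"

definition sgn_l2 :: "l2 \<Rightarrow> l2" where "sgn_l2 f = inverse (norm f) *\<^sub>R f"

definition dist_l2 :: "l2 \<Rightarrow> l2 \<Rightarrow> real" where "dist_l2 f g = norm (f - g)"

definition uniformity_l2 :: "(l2 \<times> l2) filter" where
  "uniformity_l2 = (INF e\<in>{0<..}. principal {(f, g). dist f g < e})"

definition open_l2 :: "l2 set \<Rightarrow> bool" where
  "open_l2 U \<longleftrightarrow> (\<forall>f\<in>U. \<forall>\<^sub>F (f', g) in uniformity. f' = f \<longrightarrow> g \<in> U)"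

instance
proof
  fix f g h :: l2 and r :: real
  show "sgn f = f /\<^sub>R norm f" by (simp add: sgn_l2_def)
  show "dist f g = norm (f - g)" by (simp add: dist_l2_def)
  show "uniformity = (INF e\<in>{0<..}. principal {(f, g :: l2). dist f g < e})"
    by (simp add: uniformity_l2_def)
  show "open U = (\<forall>f\<in>U. \<forall>\<^sub>F (f', g) in uniformity. f' = f \<longrightarrow> g \<in> U)" for U :: "l2 set"
    by (simp add: open_l2_def)
  show "inner f g = inner g f"
    by transfer (simp add: mult.commute)
  show "inner (f + g) h = inner f h + inner g h"
    by transfer (auto simp: l2_eq_def distrib_right sq_integrable_prod
        intro!: Bochner_Integration.integral_add)
  show "inner (r *\<^sub>R f) g = r * inner f g"
    by transfer (simp add: mult.assoc)
  show "0 \<le> inner f f"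
    by transfer (simp add: integral_nonneg_AE)
  show "inner f f = 0 \<longleftrightarrow> f = 0"
  proof (transfer)
    fix f assume "l2_eq f f"
    then have f: "sq_integrable f" by (simp add: l2_eq_def)
    have "(\<integral>x. f x * f x \<partial>lborel) = 0 \<longleftrightarrow> (AE x in lborel. f x * f x = 0)"
      by (rule integral_nonneg_eq_0_iff_AE) (auto intro: sq_integrable_prod f)
    then show "(\<integral>x. f x * f x \<partial>lborel) = 0 \<longleftrightarrow> l2_eq f (\<lambda>x. 0)"
      using f by (simp add: l2_eq_def)
  qed
  show "norm f = sqrt (inner f f)" by (simp add: norm_l2_def)
qed

end

text \<open>
  Since \<^term>\<open>rep_l2\<close> picks some representative of a class, it is only meaningful up to null sets.
\<close>

lemma rep_l2_sq_integrable: "sq_integrable (rep_l2 f)"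
  using Quotient3_rep_reflp[OF Quotient3_l2, of f] by (simp add: l2_eq_def)

lemma rep_abs_l2: "sq_integrable f \<Longrightarrow> AE x in lborel. rep_l2 (abs_l2 f) x = f x"
  using rep_abs_rsp_left[OF Quotient3_l2, of f f] by (simp add: l2_eq_def)

lemma l2_eq_iff: "f = g \<longleftrightarrow> (AE x in lborel. rep_l2 f x = rep_l2 g x)"
  using Quotient3_rel_rep[OF Quotient3_l2, of f g]
  by (simp add: l2_eq_def rep_l2_sq_integrable)

lemma norm_l2_eq: "norm (f :: l2) = sqrt (\<integral>x. (rep_l2 f x)\<^sup>2 \<partial>lborel)"
  by (simp add: norm_eq_sqrt_inner inner_l2_def power2_eq_square)

text \<open>
  Functions on a subset are identified with their extension by zero; this embeds
  \<open>L\<^sup>2(A)\<close> isometrically as a closed subspace, so that distances, closedness and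
  limit points of subsets of \<open>L\<^sup>2(A)\<close> are those of the ambient type.
\<close>

definition L2_on :: "real set \<Rightarrow> l2 set" where
  "L2_on A = {f. AE x in lborel. x \<notin> A \<longrightarrow> rep_l2 f x = 0}"

lift_definition concat_copies :: "real \<Rightarrow> nat \<Rightarrow> l2 \<Rightarrow> l2" is
  "\<lambda>a n f x. \<Sum>i<n. indicator {real i * a ..< (real i + 1) * a} x * f (x - real i * a)"
proof -
  fix a :: real and n :: nat and f g :: "real \<Rightarrow> real"
  assume fg: "l2_eq f g"
  have "AE x in lborel. f (x - t) = g (x - t)" for t
    using fg AE_lborel_shift[of "\<lambda>x. f x = g x" t] by (simp add: l2_eq_def)
  then have "AE x in lborel. \<forall>i\<in>{..<n}. f (x - real i * a) = g (x - real i * a)"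
    by (intro AE_finite_allI) auto
  then have "AE x in lborel.
      (\<Sum>i<n. indicator {real i * a ..< (real i + 1) * a} x * f (x - real i * a)) =
      (\<Sum>i<n. indicator {real i * a ..< (real i + 1) * a} x * g (x - real i * a))"
    by eventually_elim simp
  moreover have "sq_integrable
      (\<lambda>x. \<Sum>i<n. indicator {real i * a ..< (real i + 1) * a} x * h (x - real i * a))"
    if "sq_integrable h" for h
    using that by (intro sq_integrable_sum sq_integrable_indicator sq_integrable_shift) auto
  ultimately show "?thesis a n f g"
    using fg by (simp only: l2_eq_def)
qed


section \<open>Schroedinger operators and their spectrum\<close>

text \<open>
  Local absolute continuity of \<open>v\<close> with a.e. derivative \<open>w\<close>, in the form of the fundamental
  theorem of calculus for Lebesgue integrals.
\<close>

definition ac_deriv :: "(real \<Rightarrow> real) \<Rightarrow> (real \<Rightarrow> real) \<Rightarrow> bool" where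
  "ac_deriv v w \<longleftrightarrow> (\<forall>s t. s \<le> t \<longrightarrow>
     set_integrable lborel {s..t} w \<and> v t - v s = (LINT x:{s..t}|lborel. w x))"

text \<open>
  An unbounded operator in \<open>L\<^sup>2(\<real>)\<close> is given by its graph. The operator
  \<open>-\<partial>\<^sub>x\<^sup>2 + V\<close> is taken on its natural (maximal) domain: all \<open>u \<in> L\<^sup>2(\<real>)\<close> such that
  \<open>u\<close> and \<open>u'\<close> are locally absolutely continuous and \<open>-u'' + V u \<in> L\<^sup>2(\<real>)\<close>. For \<open>V\<close> uniformly
  locally square-integrable, in particular for the periodic \<open>V\<close> below, this is
  the self-adjoint realisation, with domain the Sobolev space \<open>H\<^sup>2(\<real>)\<close>.
\<close>

definition schroedinger :: "(real \<Rightarrow> real) \<Rightarrow> (l2 \<times> l2) set" where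
  "schroedinger V = {(f, g). \<exists>u v w. ac_deriv u v \<and> ac_deriv v w \<and>
     (AE x in lborel. rep_l2 f x = u x) \<and>
     (AE x in lborel. rep_l2 g x = - w x + V x * u x)}"

text \<open>
  A real number \<open>E\<close> is in the resolvent set iff \<open>A - E\<close> is a bijection from the domain of \<open>A\<close>
  onto the whole space with bounded inverse \<open>R\<close>. The spectrum of a self-adjoint operator is
  contained in \<open>\<real>\<close>, so only real \<open>E\<close> are considered.
\<close>

definition resolvent_set :: "('a::real_normed_vector \<times> 'a) set \<Rightarrow> real set" where
  "resolvent_set A =
     {E. \<exists>R. bounded_linear R \<and> (\<forall>f g. (f, g) \<in> A \<longleftrightarrow> R (g - E *\<^sub>R f) = f)}"

definition spec :: "('a::real_normed_vector \<times> 'a) set \<Rightarrow> real set" where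
  "spec A = - resolvent_set A"


section \<open>Words and gap-richness\<close>

definition words :: "'a set \<Rightarrow> 'a list set" where
  "words Y = {xs. xs \<noteq> [] \<and> set xs \<subseteq> Y}"

text \<open>Letters of a word are numbered from \<open>1\<close>, list positions from \<open>0\<close>.\<close>

definition periodize :: "'a list \<Rightarrow> int \<Rightarrow> 'a" where
  "periodize xs j = xs ! nat ((j - 1) mod int (length xs))"

definition word_dist :: "'a::metric_space list \<Rightarrow> 'a list \<Rightarrow> real" where
  "word_dist xs ys = (SUP j. dist (periodize xs j) (periodize ys j))"

text \<open>The function \<open>y\<^sup>\<natural>\<close>, up to a null set, for letters supported on \<open>[0, c)\<close>.\<close>

definition natural :: "real \<Rightarrow> (int \<Rightarrow> l2) \<Rightarrow> real \<Rightarrow> real" where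
  "natural c y x = rep_l2 (y \<lfloor>x / c\<rfloor>) (x - real_of_int \<lfloor>x / c\<rfloor> * c)"

definition schroedinger_word :: "real \<Rightarrow> l2 list \<Rightarrow> (l2 \<times> l2) set" where
  "schroedinger_word c xs = schroedinger (natural c (periodize xs))"

definition perfect_set :: "'a::topological_space set \<Rightarrow> bool" where
  "perfect_set Y \<longleftrightarrow> closed Y \<and> (\<forall>y\<in>Y. \<not> y isolated_in Y)"

definition gap_rich_except :: "real \<Rightarrow> l2 set \<Rightarrow> real set \<Rightarrow> bool" where
  "gap_rich_except c Y S \<longleftrightarrow>
     c > 0 \<and> Y \<subseteq> L2_on {0..<c} \<and> perfect_set Y \<and> discrete S \<and>
     (\<forall>E. E \<notin> S \<longrightarrow> (\<forall>x\<in>words Y. \<forall>\<epsilon>>0.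
        \<exists>y\<in>words Y. word_dist x y < \<epsilon> \<and> E \<notin> spec (schroedinger_word c y)))"

definition gap_rich :: "real \<Rightarrow> l2 set \<Rightarrow> bool" where
  "gap_rich c Y \<longleftrightarrow> (\<exists>S. gap_rich_except c Y S)"

end

theory Submission
  imports Defs "HOL-Complex_Analysis.Conformal_Mappings"
begin

text \<open>
  The exceptional set can be taken empty. Step functions on a uniform grid are dense, so the letters
  of the given word may be assumed to be step functions; on a cell of length \<open>h\<close> where the potential
  minus the energy equals \<open>q\<close>, the transfer matrix is \<open>exp (h [[0, 1], [q, 0]])\<close>. The transfer matrix
  of the word is then \<open>P A\<^sup>n\<close> in \<open>SL(2, \<real>)\<close>, with \<open>A\<close> that of one copy of the first letter. Its
  dependence on \<open>q\<close> being analytic, arbitrarily small changes of the first two cells yield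
  matrices \<open>P A\<^sub>1\<^sup>n\<close> and \<open>P A\<^sub>2\<^sup>n\<close> that do not commute. The semigroup generated by two
  noncommuting elements of \<open>SL(2, \<real>)\<close> contains a hyperbolic element: if both generators are
  elliptic, the trace of their commutator exceeds \<open>2\<close> and inverses are limits of positive powers; if
  one is parabolic, multiply the other one by its powers. Such an element is the monodromy of a long
  word all of whose letters are close to those of the given one. Hyperbolicity gives two Floquet
  solutions decaying at \<open>+\<infinity>\<close> and \<open>-\<infinity>\<close>, and the Green kernel built from them is a
  bounded inverse.
\<close>

section \<open>Hyperbolic elements in semigroups of unimodular matrices\<close>

text \<open>A letter cannot be altered freely: it consists of n copies of one function, so a change
  of one cell recurs n times and enters only through the n-th power of A. By Cayley-Hamilton this
  power is a combination of A and the identity, the coefficient at A being a polynomial in the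
  trace. Away from its finitely many zeros, a linear functional that vanishes on the identity is
  nonzero on the power as soon as it is nonzero on A. Noncommutation is thereby reduced to
  conditions of the form \<open>trace (C ** A) \<noteq> \<kappa>\<close>. Two cells are varied
  rather than one because the diagonal entries of a cell matrix are equal: its trace against a
  multiple of diag(1, -1) vanishes for every potential. The first cell moves C off this line, then
  the second one changes the trace. Only the first letter is altered, so both generators share P.
  Long words are harmless because the distance of words compares periodic extensions: a
  concatenation of perturbed versions of a word is as close to it as the worst of these
  versions.\<close>

fun mprod :: "(real^2^2) list \<Rightarrow> real^2^2" where
  "mprod [] = mat 1"
| "mprod (A # As) = mprod As ** A"

text \<open>The order is reversed because the head of a list is the rightmost factor: lists run in
  the direction of increasing x, and the transfer matrix of the leftmost cell acts first.\<close>

lemma mprod_append: "mprod (As @ Bs) = mprod Bs ** mprod As"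
  by (induction As) (auto simp: matrix_mul_assoc)

lemma det_mprod: "(\<And>A. A \<in> set As \<Longrightarrow> det A = 1) \<Longrightarrow> det (mprod As) = 1"
  by (induction As) (auto simp: det_mul)

lemmas mat2_simps = matrix_matrix_mult_def sum_2 vec_eq_iff forall_2 trace_def det_2 mat_def

text \<open>Chebyshev polynomials of the second kind in the variable of the trace:
  \<open>cheb n\<close> at t is U_{n-1}(t/2).\<close>

fun cheb :: "nat \<Rightarrow> real poly" where
  "cheb 0 = 0"
| "cheb (Suc 0) = 1"
| "cheb (Suc (Suc n)) = [:0, 1:] * cheb (Suc n) - cheb n"

lemma matrix_sub_distrib2: "(A - B) ** (C :: real^2^2) = A ** C - B ** C"
  by (simp add: mat2_simps) (auto simp: algebra_simps)

lemma scaleR_matrix_mult: "(c *\<^sub>R A) ** (B :: real^2^2) = c *\<^sub>R (A ** B)"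
  by (simp add: matrix_matrix_mult_def vec_eq_iff sum_distrib_left mult.assoc)

text \<open>Cayley-Hamilton for determinant 1, in the form
  \<open>A ** A = trace A *\<^sub>R A - mat 1\<close>, turns multiplication by A into the recursion
  of \<open>cheb\<close>.\<close>

lemma mprod_replicate:
  assumes "det A = 1"
  shows "mprod (replicate (Suc n) A) =
    poly (cheb (Suc n)) (trace A) *\<^sub>R A - poly (cheb n) (trace A) *\<^sub>R mat 1"
proof (induction n)
  case 0
  show ?case by simp
next
  case (Suc n)
  have "A$2$2 * A$1$1 = 1 + A$1$2 * A$2$1"
    using assms by (simp add: det_2 algebra_simps)
  have CH: "A ** A = trace A *\<^sub>R A - mat 1"
    using assms by (simp add: mat2_simps) (auto simp: algebra_simps)
  have "mprod (replicate (Suc (Suc n)) A) = mprod (replicate (Suc n) A) ** A"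
    by simp
  also have "\<dots> = poly (cheb (Suc n)) (trace A) *\<^sub>R (A ** A) - poly (cheb n) (trace A) *\<^sub>R A"
    unfolding Suc by (simp only: matrix_sub_distrib2 scaleR_matrix_mult matrix_mul_lid)
  also have "\<dots> = poly (cheb (Suc (Suc n))) (trace A) *\<^sub>R A
      - poly (cheb (Suc n)) (trace A) *\<^sub>R mat 1"
    unfolding CH by (simp add: algebra_simps)
  finally show ?case .
qed

text \<open>At the traces 2 and -2 of parabolic matrices the coefficients grow linearly in the
  exponent; this growth produces the hyperbolic element in the parabolic case.\<close>

lemma cheb_2: "poly (cheb n) 2 = real n"
  by (induction n rule: cheb.induct) (auto simp: algebra_simps)

lemma cheb_m2: "poly (cheb n) (-2) = - ((-1) ^ n * real n)"
  by (induction n rule: cheb.induct) (auto simp: algebra_simps)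

lemma cheb_cos: "poly (cheb n) (2 * cos t) * sin t = sin (real n * t)"
proof (induction n rule: cheb.induct)
  case (3 n)
  have "sin (real (Suc (Suc n)) * t) = sin (real (Suc n) * t + t)"
    by (simp add: algebra_simps)
  moreover have "sin (real n * t) = sin (real (Suc n) * t - t)"
    by (simp add: algebra_simps)
  ultimately have "sin (real (Suc (Suc n)) * t) = 2 * cos t * sin (real (Suc n) * t) - sin (real n * t)"
    by (simp only: sin_add sin_diff) (simp add: algebra_simps)
  then show ?case
    unfolding 3[symmetric] by (simp add: algebra_simps)
qed auto

lemma finite_cheb_roots: "n \<ge> 1 \<Longrightarrow> finite {t. poly (cheb n) t = 0}"
  using cheb_2[of n] by (intro poly_roots_finite) auto

lemma linear_unbounded:
  fixes x y c :: real
  assumes "y \<noteq> 0"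
  obtains k :: nat where "\<bar>x + real k * y\<bar> > c"
proof -
  obtain k :: nat where k: "real k > (c + \<bar>x\<bar>) / \<bar>y\<bar>"
    using reals_Archimedean2 by blast
  then have "real k * \<bar>y\<bar> > c + \<bar>x\<bar>"
    using assms by (simp add: field_simps)
  then have "\<bar>x + real k * y\<bar> > c"
    using abs_triangle_ineq2_sym[of "x + real k * y" x] abs_mult[of "real k" y] by linarith
  then show ?thesis using that by blast
qed

section \<open>Unimodular matrices and the Lorentzian geometry of their traceless parts\<close>

lemma trace_scaleR2: "trace (c *\<^sub>R A :: real^2^2) = c * trace A"
  by (simp add: trace_def sum_distrib_left)

lemma trace2: "trace (A :: real^2^2) = A$1$1 + A$2$2"
  by (simp add: trace_def sum_2)

lemma matrix_mult2: "((A :: real^2^2) ** B)$i$j = A$i$1 * B$1$j + A$i$2 * B$2$j"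
  by (simp add: matrix_matrix_mult_def sum_2)

text \<open>The matrix \<open>trace A *\<^sub>R mat 1 - A\<close> is the adjugate, hence the inverse
  when the determinant is 1. This form is linear in A and stays polynomial in the entries.\<close>

lemma adjugate2:
  fixes A :: "real^2^2"
  shows "(trace A *\<^sub>R mat 1 - A)$1$1 = A$2$2" "(trace A *\<^sub>R mat 1 - A)$1$2 = - A$1$2"
    "(trace A *\<^sub>R mat 1 - A)$2$1 = - A$2$1" "(trace A *\<^sub>R mat 1 - A)$2$2 = A$1$1"
  by (simp_all add: trace_def sum_2 mat_def)

text \<open>The last hypothesis says that the traceless parts of A and B are orthogonal for the
  Lorentzian form \<open>det\<close>. That of A is a null vector, that of B is timelike or null; two
  such vectors are orthogonal only if they are linearly dependent, and then A and B commute.\<close>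

lemma parabolic_commute:
  fixes A B :: "real^2^2"
  assumes "det A = 1" "det B = 1" "(trace A)\<^sup>2 = 4" "\<bar>trace B\<bar> \<le> 2"
    and "2 * trace (A ** B) = trace A * trace B"
  shows "A ** B = B ** A"
proof -
  define p where "p = A$1$1 - A$2$2"
  define q where "q = 2 * A$1$2"
  define r where "r = 2 * A$2$1"
  define d where "d = B$1$1 - B$2$2"
  define b where "b = B$1$2"
  define c where "c = B$2$1"
  have N: "p\<^sup>2 + q * r = 0"
    using assms(1,3) unfolding p_def q_def r_def
    by (simp add: det_2 trace_def sum_2 power2_eq_square algebra_simps)
  have T: "p * d + q * c + r * b = 0" 
    using assms(5) unfolding p_def q_def r_def d_def b_def c_def
    by (simp add: mat2_simps algebra_simps)
  have "(trace B)\<^sup>2 \<le> 2\<^sup>2"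
    using assms(4) by (intro abs_le_square_iff[THEN iffD1]) auto
  then have D: "d\<^sup>2 + 4 * (b * c) \<le> 0"
    using assms(2) unfolding d_def b_def c_def
    by (simp add: det_2 trace_def sum_2 power2_eq_square algebra_simps)
  have qr: "q * r = - p\<^sup>2" and pd: "p * d = - (q * c + r * b)"
    using N T by linarith+
  \<comment> \<open>The three quantities squared here and below are, up to constant factors, the
    entries of the commutator. Each square equals a square times
    \<open>d\<^sup>2 + 4 * (b * c)\<close>, which is nonpositive, so each entry vanishes.\<close>
  have "(q * c - r * b)\<^sup>2 = (- (q * c + r * b))\<^sup>2 - 4 * (q * r) * (b * c)"
    by (simp add: power2_eq_square algebra_simps)
  then have "(q * c - r * b)\<^sup>2 = p\<^sup>2 * (d\<^sup>2 + 4 * (b * c))"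
    unfolding qr pd[symmetric] by (simp add: power2_eq_square algebra_simps)
  then have 1: "q * c = r * b"
    using D by (smt (verit) mult_nonneg_nonpos zero_le_power2 zero_eq_power2)
  have "(2 * p * b - q * d)\<^sup>2 = 4 * p\<^sup>2 * b\<^sup>2 - 4 * b * q * (p * d) + q\<^sup>2 * d\<^sup>2"
    by (simp add: power2_eq_square algebra_simps)
  also have "\<dots> = 4 * p\<^sup>2 * b\<^sup>2 + 4 * q\<^sup>2 * (b * c) + 4 * b\<^sup>2 * (q * r) + q\<^sup>2 * d\<^sup>2"
    unfolding pd by (simp add: power2_eq_square algebra_simps)
  finally have "(2 * p * b - q * d)\<^sup>2 = q\<^sup>2 * (d\<^sup>2 + 4 * (b * c))"
    unfolding qr by (simp add: algebra_simps)
  then have 2: "2 * p * b = q * d"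
    using D by (smt (verit) mult_nonneg_nonpos zero_le_power2 zero_eq_power2)
  have "(2 * p * c - r * d)\<^sup>2 = 4 * p\<^sup>2 * c\<^sup>2 - 4 * c * r * (p * d) + r\<^sup>2 * d\<^sup>2"
    by (simp add: power2_eq_square algebra_simps)
  also have "\<dots> = 4 * p\<^sup>2 * c\<^sup>2 + 4 * r\<^sup>2 * (b * c) + 4 * c\<^sup>2 * (q * r) + r\<^sup>2 * d\<^sup>2"
    unfolding pd by (simp add: power2_eq_square algebra_simps)
  finally have "(2 * p * c - r * d)\<^sup>2 = r\<^sup>2 * (d\<^sup>2 + 4 * (b * c))"
    unfolding qr by (simp add: algebra_simps)
  then have 3: "2 * p * c = r * d"
    using D by (smt (verit) mult_nonneg_nonpos zero_le_power2 zero_eq_power2)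
  show ?thesis
    using 1 2 3 unfolding p_def q_def r_def d_def b_def c_def
    by (simp add: mat2_simps) (auto simp: algebra_simps)
qed

lemma elliptic_commutator:
  fixes A B :: "real^2^2"
  assumes "det A = 1" "det B = 1" "\<bar>trace A\<bar> < 2" "A ** B \<noteq> B ** A"
  shows "trace (A ** B ** (trace A *\<^sub>R mat 1 - A) ** (trace B *\<^sub>R mat 1 - B)) > 2"
proof -
  define p where "p = A$1$1 - A$2$2"
  define q where "q = 2 * A$1$2"
  define r where "r = 2 * A$2$1"
  define s where "s = B$1$1 - B$2$2"
  define t where "t = 2 * B$1$2"
  define u where "u = 2 * B$2$1"
  \<comment> \<open>\<open>X, Y, Z\<close> are, up to constant factors, the entries of the commutator of the traceless parts \<open>2 A - tr A\<close> and \<open>2 B - tr B\<close>.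
    It is orthogonal to the first of these for the Lorentzian form \<open>det\<close>, for which elliptic elements
    are timelike; hence it is spacelike.\<close>
  define X where "X = q * u - r * t"
  define Y where "Y = p * t - q * s"
  define Z where "Z = p * u - r * s"
  have tr4: "(trace A)\<^sup>2 < 2\<^sup>2"
    using assms(3) power2_strict_mono[of "trace A" 2] by simp
  have detA: "p\<^sup>2 + q * r < 0"
    using tr4 assms(1) unfolding p_def q_def r_def
    by (simp add: det_2 trace_def sum_2 power2_eq_square algebra_simps)
  have qr: "q * r < 0"
    using detA zero_le_power2[of p] by linarith
  define a b c d where abcd: "a = A$1$1" "b = A$1$2" "c = A$2$1" "d = A$2$2"
  define e f g h where efgh: "e = B$1$1" "f = B$1$2" "g = B$2$1" "h = B$2$2"
  have det_det: "(a * d - b * c) * (e * h - f * g) = 1"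
    using assms(1,2) by (simp add: det_2 abcd efgh)
  \<comment> \<open>Writing 2 as twice the product of the determinants makes this an identity of
    polynomials in eight free variables, valid without the determinant conditions.\<close>
  have poly: "((a * e + b * g) * d + (a * f + b * h) * - c) * h + ((a * e + b * g) * - b + (a * f + b * h) * a) * - g
      + (((c * e + d * g) * d + (c * f + d * h) * - c) * - f + ((c * e + d * g) * - b + (c * f + d * h) * a) * e)
      - 2 * ((a * d - b * c) * (e * h - f * g))
    = (b * g - c * f)\<^sup>2 - ((a - d) * f - b * (e - h)) * ((a - d) * g - c * (e - h))"
    for a b c d e f g h :: real
    by (simp only: power2_eq_square ring_distribs) (simp add: algebra_simps)
  define A' where "A' = trace A *\<^sub>R mat 1 - A"
  define B' where "B' = trace B *\<^sub>R mat 1 - B"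
  have "trace (A ** B ** A' ** B')
      - 2 * ((a * d - b * c) * (e * h - f * g)) = (X / 4)\<^sup>2 - (Y / 2) * (Z / 2)"
    apply (simp only: trace2 matrix_mult2)
    apply (simp only: A'_def B'_def adjugate2)
    apply (simp only: poly abcd[symmetric] efgh[symmetric])
    apply (simp only: X_def Y_def Z_def p_def q_def r_def s_def t_def u_def abcd[symmetric] efgh[symmetric])
    by (simp add: power2_eq_square left_diff_distrib right_diff_distrib) (simp add: algebra_simps diff_divide_distrib add_divide_distrib)
  then have E: "16 * (trace (A ** B ** A' ** B') - 2) = X\<^sup>2 - 4 * (Y * Z)"
    unfolding det_det by (simp add: power2_eq_square)
  have lin: "p * X = q * Z - r * Y"
    unfolding X_def Y_def Z_def by algebra
  \<comment> \<open>For an elliptic A both \<open>- (q * r)\<close> and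
    \<open>- (p\<^sup>2 + q * r)\<close> are positive. Orthogonality, in the form of
    \<open>lin\<close>, thus turns the indefinite form into a combination of two squares with
    positive coefficients.\<close>
  have main: "(X\<^sup>2 - 4 * (Y * Z)) * (- (q * r)) = (- (p\<^sup>2 + q * r)) * X\<^sup>2 + (q * Z + r * Y)\<^sup>2"
  proof -
    have "(X\<^sup>2 - 4 * (Y * Z)) * (- (q * r)) = - (q * r) * X\<^sup>2 - (q * Z - r * Y)\<^sup>2 + (q * Z + r * Y)\<^sup>2"
      by (simp add: power2_eq_square algebra_simps)
    then show ?thesis
      unfolding lin[symmetric] by (simp add: power2_eq_square algebra_simps)
  qed
  have "X \<noteq> 0 \<or> q * Z + r * Y \<noteq> 0"
  proof (rule ccontr)
    assume "\<not> ?thesis"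
    then have 0: "X = 0" "q * Z + r * Y = 0" by auto
    with lin have "q * Z = 0" "r * Y = 0" by auto
    with qr have "Z = 0" "Y = 0" by auto
    with \<open>X = 0\<close> have "A ** B = B ** A"
      unfolding X_def Y_def Z_def p_def q_def r_def s_def t_def u_def vec_eq_iff forall_2 matrix_mult2
      by (simp add: algebra_simps)
    with assms show False by simp
  qed
  then have "(- (p\<^sup>2 + q * r)) * X\<^sup>2 + (q * Z + r * Y)\<^sup>2 > 0"
  proof
    assume "X \<noteq> 0"
    then show ?thesis using detA by (intro add_pos_nonneg mult_pos_pos) auto
  next
    assume "q * Z + r * Y \<noteq> 0"
    then show ?thesis using detA by (intro add_nonneg_pos mult_nonneg_nonneg) auto
  qed
  then have pos: "(X\<^sup>2 - 4 * (Y * Z)) * (- (q * r)) > 0"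
    by (simp only: main)
  have "- (q * r) > 0"
    using qr by linarith
  from zero_less_mult_pos2[OF pos this] have "trace (A ** B ** A' ** B') > 2"
    unfolding E[symmetric] by simp
  then show ?thesis
    unfolding A'_def B'_def .
qed

text \<open>A is conjugate to a rotation by an angle t. Dirichlet approximation yields positive
  multiples of t arbitrarily close to multiples of 2 pi, so powers of A return arbitrarily close to
  the identity, and the powers with exponent one less approach the inverse.\<close>

lemma elliptic_inverse_limit:
  fixes A :: "real^2^2"
  assumes "det A = 1" "\<bar>trace A\<bar> < 2"
  obtains k :: "nat \<Rightarrow> nat"
    where "(\<lambda>N. mprod (replicate (Suc (k N)) A)) \<longlonglongrightarrow> trace A *\<^sub>R mat 1 - A"
proof -
  define t where "t = arccos (trace A / 2)"
  have cos_t: "2 * cos t = trace A"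
    unfolding t_def using assms(2) by (subst cos_arccos) auto
  have "\<bar>cos t\<bar> < 1"
    using cos_t assms(2) by linarith
  then have "(cos t)\<^sup>2 < 1"
    by (simp add: abs_square_less_1)
  then have sin_t: "sin t \<noteq> 0"
    using sin_cos_squared_add[of t] by (auto simp del: sin_cos_squared_add)
  have "\<exists>q::nat. \<exists>p::int. q > 0 \<and> \<bar>real q * (t / (2 * pi)) - of_int p\<bar> < 1 / real (Suc N)" for N
  proof -
    obtain p q :: int where "0 < q" "\<bar>of_int q * (t / (2 * pi)) - of_int p\<bar> < 1 / real (Suc N)"
      using Dirichlet_approx[of "Suc N" "t / (2 * pi)"] by blast
    then show ?thesis
      by (intro exI[of _ "nat q"] exI[of _ p]) auto
  qed
  then obtain q p where q: "\<And>N. q N > (0::nat)"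
    and qp: "\<And>N. \<bar>real (q N) * (t / (2 * pi)) - of_int (p N :: int)\<bar> < 1 / real (Suc N)"
    by metis
  define d where "d N = 4 * pi * (real (q N) * (t / (2 * pi)) - of_int (p N))" for N
  \<comment> \<open>The exponent \<open>Suc (k N)\<close> is 2 q - 1. Doubling q keeps it positive
    even when Dirichlet's theorem returns q = 1.\<close>
  define k where "k N = 2 * q N - 2" for N
  have "(\<lambda>N. real (q N) * (t / (2 * pi)) - of_int (p N)) \<longlonglongrightarrow> 0"
    by (rule tendsto_0_le[OF LIMSEQ_inverse_real_of_nat, where K=1])
       (use qp in \<open>auto intro!: always_eventually simp: inverse_eq_divide less_imp_le\<close>)
  then have d0: "d \<longlonglongrightarrow> 0"
    unfolding d_def by (auto intro: tendsto_eq_intros)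
  have dt: "real (2 * q N) * t = d N + 2 * pi * of_int (2 * p N)" for N
    unfolding d_def by (simp add: algebra_simps)
  have s1: "sin (real (Suc (k N)) * t) = sin (d N - t)" for N
  proof -
    have "real (Suc (k N)) * t = real (2 * q N) * t - t"
      using q[of N] unfolding k_def by (simp add: of_nat_diff algebra_simps)
    then have "real (Suc (k N)) * t = (d N - t) + 2 * pi * of_int (2 * p N)"
      using dt[of N] by simp
    then show ?thesis by (simp only: sin_add sin_int_2pin cos_int_2pin mult_1_right mult_zero_right add_0_right)
  qed
  have s2: "sin (real (k N) * t) = sin (d N - 2 * t)" for N
  proof -
    have "real (k N) * t = real (2 * q N) * t - 2 * t"
      using q[of N] unfolding k_def by (simp add: of_nat_diff algebra_simps)
    then have "real (k N) * t = (d N - 2 * t) + 2 * pi * of_int (2 * p N)"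
      using dt[of N] by simp
    then show ?thesis by (simp only: sin_add sin_int_2pin cos_int_2pin mult_1_right mult_zero_right add_0_right)
  qed
  have U: "poly (cheb m) (trace A) = sin (real m * t) / sin t" for m
    using cheb_cos[of m t] sin_t unfolding cos_t by (simp add: field_simps)
  have "(\<lambda>N. sin (d N - t) / sin t) \<longlonglongrightarrow> sin (0 - t) / sin t"
    by (intro tendsto_intros d0 sin_t)
  moreover have "(\<lambda>N. sin (d N - 2 * t) / sin t) \<longlonglongrightarrow> sin (0 - 2 * t) / sin t"
    by (intro tendsto_intros d0 sin_t)
  ultimately have "(\<lambda>N. (sin (d N - t) / sin t) *\<^sub>R A - (sin (d N - 2 * t) / sin t) *\<^sub>R mat 1)
     \<longlonglongrightarrow> (sin (0 - t) / sin t) *\<^sub>R A - (sin (0 - 2 * t) / sin t) *\<^sub>R mat 1"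
    by (intro tendsto_diff tendsto_scaleR tendsto_const)
  moreover have "(sin (0 - t) / sin t) *\<^sub>R A - (sin (0 - 2 * t) / sin t) *\<^sub>R mat 1
      = trace A *\<^sub>R mat 1 - A"
    using sin_t by (simp add: sin_double cos_t[symmetric])
  ultimately have "(\<lambda>N. mprod (replicate (Suc (k N)) A)) \<longlonglongrightarrow> trace A *\<^sub>R mat 1 - A"
    by (simp only: mprod_replicate[OF assms(1)] U s1 s2)
  then show ?thesis using that by blast
qed

lemma tendsto_trace_mult:
  fixes F G :: "nat \<Rightarrow> real^2^2"
  assumes "F \<longlonglongrightarrow> L" "G \<longlonglongrightarrow> K"
  shows "(\<lambda>N. trace (C ** F N ** G N)) \<longlonglongrightarrow> trace (C ** L ** K)"
  unfolding trace_def matrix_matrix_mult_def sum_2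
  using assms by (auto intro!: tendsto_intros)

theorem noncommuting_semigroup_hyperbolic:
  fixes A B :: "real^2^2"
  assumes "det A = 1" "det B = 1" "A ** B \<noteq> B ** A"
  obtains ws where "ws \<noteq> []" "set ws \<subseteq> {A, B}" "\<bar>trace (mprod ws)\<bar> > 2"
proof -
  note found = that
  have parabolic: thesis
    if h: "det C = 1" "det D = 1" "\<bar>trace C\<bar> = 2" "\<bar>trace D\<bar> \<le> 2" "C ** D \<noteq> D ** C" "{C, D} = {A, B}"
    for C D :: "real^2^2"
  proof -
    define e where "e = trace C / 2"
    have e: "e = 1 \<or> e = -1" "trace C = 2 * e"
      using h(3) unfolding e_def by linarith+
    \<comment> \<open>This is the rate at which the trace of \<open>C\<close> to the power k + 1
      times \<open>D\<close> grows with k; it vanishes only in the commuting case of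
      \<open>parabolic_commute\<close>.\<close>
    have y: "trace (C ** D) - e * trace D \<noteq> 0"
    proof
      assume "trace (C ** D) - e * trace D = 0"
      then have "2 * trace (C ** D) = trace C * trace D" using e(2) by simp
      moreover have "(trace C)\<^sup>2 = 4" using e by auto
      ultimately show False using parabolic_commute[of C D] h by blast
    qed
    obtain k where k: "\<bar>trace (C ** D) + real k * (trace (C ** D) - e * trace D)\<bar> > 2"
      using linear_unbounded[OF y] by blast
    have "trace (mprod (D # replicate (Suc k) C)) =
        poly (cheb (Suc k)) (trace C) * trace (C ** D) - poly (cheb k) (trace C) * trace D"
      by (simp only: mprod.simps mprod_replicate[OF h(1)])
         (simp add: matrix_sub_distrib2 trace_sub scaleR_matrix_mult trace_scaleR2)
    also have "\<dots> = e ^ k * (trace (C ** D) + real k * (trace (C ** D) - e * trace D))"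
      using e(1)
    proof
      assume "e = 1"
      then show ?thesis using e(2) by (simp add: cheb_2 algebra_simps)
    next
      assume "e = -1"
      then show ?thesis using e(2) by (simp add: cheb_m2 algebra_simps)
    qed
    also have "\<bar>\<dots>\<bar> = \<bar>trace (C ** D) + real k * (trace (C ** D) - e * trace D)\<bar>"
    proof -
      have "\<bar>e ^ k\<bar> = 1"
        using e(1) by (auto simp: power_abs)
      then show ?thesis by (simp only: abs_mult mult_1)
    qed
    finally have "\<bar>trace (mprod (D # replicate (Suc k) C))\<bar> > 2"
      using k by (simp only:)
    moreover have "set (D # replicate (Suc k) C) \<subseteq> {A, B}"
    proof -
      have "set (D # replicate (Suc k) C) \<subseteq> {C, D}" by auto
      then show ?thesis by (simp only: h(6))
    qed
    ultimately show thesis by (intro found[of "D # replicate (Suc k) C"]) simp_all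
  qed
  consider "\<bar>trace A\<bar> > 2" | "\<bar>trace B\<bar> > 2" | "\<bar>trace A\<bar> = 2" "\<bar>trace B\<bar> \<le> 2"
    | "\<bar>trace B\<bar> = 2" "\<bar>trace A\<bar> \<le> 2" | "\<bar>trace A\<bar> < 2" "\<bar>trace B\<bar> < 2"
    by linarith
  then show thesis
  proof cases
    case 1
    then show ?thesis using found[of "[A]"] by simp
  next
    case 2
    then show ?thesis using found[of "[B]"] by simp
  next
    case 3
    then show ?thesis by (intro parabolic[OF assms(1,2) 3 assms(3) refl])
  next
    case 4
    then show ?thesis by (intro parabolic[OF assms(2,1) 4 assms(3)[symmetric] insert_commute])
  next
    case 5
    obtain k l where
      k: "(\<lambda>N. mprod (replicate (Suc (k N)) A)) \<longlonglongrightarrow> trace A *\<^sub>R mat 1 - A" and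
      l: "(\<lambda>N. mprod (replicate (Suc (l N)) B)) \<longlonglongrightarrow> trace B *\<^sub>R mat 1 - B"
      using elliptic_inverse_limit 5 assms by metis
    \<comment> \<open>Its product approximates the commutator of A and B while using positive powers
      only.\<close>
    define w where "w N = replicate (Suc (l N)) B @ replicate (Suc (k N)) A @ [B, A]" for N
    have w: "mprod (w N) = A ** B ** mprod (replicate (Suc (k N)) A) ** mprod (replicate (Suc (l N)) B)" for N
      unfolding w_def by (simp only: mprod_append) (simp add: matrix_mul_assoc)
    have "(\<lambda>N. trace (mprod (w N))) \<longlonglongrightarrow>
        trace (A ** B ** (trace A *\<^sub>R mat 1 - A) ** (trace B *\<^sub>R mat 1 - B))"
      unfolding w by (rule tendsto_trace_mult[OF k l])
    moreover have "trace (A ** B ** (trace A *\<^sub>R mat 1 - A) ** (trace B *\<^sub>R mat 1 - B)) > 2"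
      using elliptic_commutator assms 5 by blast
    ultimately have "\<forall>\<^sub>F N in sequentially. trace (mprod (w N)) > 2"
      by (rule order_tendstoD)
    then obtain N where "trace (mprod (w N)) > 2"
      using eventually_sequentially by auto
    then show ?thesis
      by (intro found[of "w N"]) (auto simp: w_def)
  qed
qed


section \<open>Transfer matrices of constant potentials\<close>

definition mk2 :: "real \<Rightarrow> real \<Rightarrow> real \<Rightarrow> real \<Rightarrow> real^2^2" where
  "mk2 a b c d = (\<chi> i j. if i = 1 then (if j = 1 then a else b) else (if j = 1 then c else d))"

lemma mk2_nth [simp]:
  "mk2 a b c d $ 1 $ 1 = a" "mk2 a b c d $ 1 $ 2 = b"
  "mk2 a b c d $ 2 $ 1 = c" "mk2 a b c d $ 2 $ 2 = d"
  by (simp_all add: mk2_def)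

lemma mk2_cases: obtains a b c d where "A = mk2 a b c d"
proof
  show "A = mk2 (A$1$1) (A$1$2) (A$2$1) (A$2$2)"
    by (simp add: vec_eq_iff forall_2)
qed

lemma mk2_eq_iff [simp]: "mk2 a b c d = mk2 e f g h \<longleftrightarrow> a = e \<and> b = f \<and> c = g \<and> d = h"
  by (auto simp: vec_eq_iff forall_2)

lemma mk2_mult [simp]: "mk2 a b c d ** mk2 e f g h =
    mk2 (a * e + b * g) (a * f + b * h) (c * e + d * g) (c * f + d * h)"
  by (simp add: vec_eq_iff forall_2 matrix_mult2)

lemma mk2_scaleR [simp]: "u *\<^sub>R mk2 a b c d = mk2 (u * a) (u * b) (u * c) (u * d)"
  by (simp add: vec_eq_iff forall_2)

lemma mk2_add [simp]: "mk2 a b c d + mk2 e f g h = mk2 (a + e) (b + f) (c + g) (d + h)"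
  by (simp add: vec_eq_iff forall_2)

lemma trace_mk2 [simp]: "trace (mk2 a b c d) = a + d"
  by (simp add: trace2)

lemma det_mk2 [simp]: "det (mk2 a b c d) = a * d - b * c"
  by (simp add: det_2)

lemma mat_1_mk2: "mat 1 = mk2 1 0 0 1"
  by (simp add: vec_eq_iff forall_2 mat_def)

lemma zero_mk2: "0 = mk2 0 0 0 0"
  by (simp add: vec_eq_iff forall_2)

text \<open>Commuting means that the triples formed by the off-diagonal entries and the difference
  of the diagonal ones have vanishing cross product. For A this triple is nonzero, so that of B is a
  multiple of it. Commutation thus becomes membership in a linear span.\<close>

lemma commuting_nonscalar:
  fixes A B :: "real^2^2"
  assumes "A ** B = B ** A" "\<nexists>v. A = v *\<^sub>R mat 1"
  obtains u v where "B = u *\<^sub>R A + v *\<^sub>R mat 1"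
proof -
  obtain a b c d where A: "A = mk2 a b c d" using mk2_cases by blast
  obtain e f g h where B: "B = mk2 e f g h" using mk2_cases by blast
  have "mk2 (a * e + b * g) (a * f + b * h) (c * e + d * g) (c * f + d * h)
      = mk2 (e * a + f * c) (e * b + f * d) (g * a + h * c) (g * b + h * d)"
    using assms(1) unfolding A B mk2_mult .
  then have "a * e + b * g = e * a + f * c" "a * f + b * h = e * b + f * d"
      "c * e + d * g = g * a + h * c"
    unfolding mk2_eq_iff by blast+
  then have 1: "b * g = c * f" and "a * f - d * f = b * e - b * h" and "a * g - d * g = c * e - c * h"
    using mult.commute[of a e] mult.commute[of c f] mult.commute[of d f] mult.commute[of b e]
      mult.commute[of a g] mult.commute[of c h] by linarith+
  then have 2: "(a - d) * f = b * (e - h)" and 3: "(a - d) * g = c * (e - h)"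
    by (simp_all only: left_diff_distrib right_diff_distrib)
  have ns: "b \<noteq> 0 \<or> c \<noteq> 0 \<or> a - d \<noteq> 0"
    using assms(2) unfolding A mat_1_mk2 by auto
  have "\<exists>u. b * u = f \<and> c * u = g \<and> (a - d) * u = e - h"
  proof (cases "b = 0")
    case False
    then show ?thesis using 1 2 by (intro exI[of _ "f / b"]) (simp add: divide_eq_eq mult.commute)
  next
    case b: True
    show ?thesis
    proof (cases "c = 0")
      case False
      then show ?thesis using 1 3 by (intro exI[of _ "g / c"]) (simp add: divide_eq_eq mult.commute)
    next
      case True
      with ns b have "a - d \<noteq> 0" by simp
      moreover from this have "f = 0" "g = 0" using 2 3 b True by simp_all
      ultimately show ?thesis using b True by (intro exI[of _ "(e - h) / (a - d)"]) simp
    qed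
  qed
  then obtain u where u: "b * u = f" "c * u = g" "(a - d) * u = e - h" by blast
  have "h = u * d + (e - u * a)"
  proof -
    have "u * a - u * d = e - h"
      using u(3) by (simp add: left_diff_distrib mult.commute[of u])
    then show ?thesis by linarith
  qed
  then have "B = u *\<^sub>R A + (e - u * a) *\<^sub>R mat 1"
    using u(1,2) unfolding A B mat_1_mk2 by (simp add: mult.commute)
  then show thesis by (rule that)
qed

lemma trace_mult_linear:
  "trace (C ** (x *\<^sub>R A - y *\<^sub>R B)) = x * trace (C ** A) - y * trace (C ** (B :: real^2^2))"
  "trace (C ** (x *\<^sub>R A + y *\<^sub>R B)) = x * trace (C ** A) + y * trace (C ** (B :: real^2^2))"
  unfolding trace2 matrix_mult2 by (simp_all add: algebra_simps)

lemma mult_adjugate2: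
  fixes A :: "real^2^2"
  assumes "det A = 1"
  shows "A ** (trace A *\<^sub>R mat 1 - A) = mat 1" "(trace A *\<^sub>R mat 1 - A) ** A = mat 1"
proof -
  obtain a b c d where A: "A = mk2 a b c d" using mk2_cases by blast
  have adj: "trace A *\<^sub>R mat 1 - A = mk2 d (- b) (- c) a"
    unfolding vec_eq_iff forall_2 adjugate2 by (simp add: A)
  show "A ** (trace A *\<^sub>R mat 1 - A) = mat 1" "(trace A *\<^sub>R mat 1 - A) ** A = mat 1"
    unfolding adj using assms by (simp_all add: A mat_1_mk2 mult.commute)
qed

lemma matrix_mult_affine:
  "Q ** (u *\<^sub>R X + v *\<^sub>R mat 1) = u *\<^sub>R (Q ** X) + v *\<^sub>R (Q :: real^2^2)"
proof -
  obtain a b c d where Q: "Q = mk2 a b c d" using mk2_cases by blast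
  obtain e f g h where X: "X = mk2 e f g h" using mk2_cases by blast
  show ?thesis
    unfolding Q X mat_1_mk2 by (simp add: algebra_simps)
qed

text \<open>Three matrices cannot span a space of dimension 4; C is the transpose of a vector
  orthogonal to them, as the trace of a transpose times a matrix is the Euclidean inner
  product.\<close>

lemma exists_annihilator:
  fixes A B D :: "real^2^2"
  obtains C where "C \<noteq> 0" "trace (C ** A) = 0" "trace (C ** B) = 0" "trace (C ** D) = 0"
proof -
  have "dim {A, B, D} \<le> card {A, B, D}"
    by (rule dim_le_card) (auto intro: span_base)
  also have "\<dots> \<le> 3"
    by (simp add: card_insert_if)
  also have "3 < DIM(real^2^2)" by simp
  finally obtain Z where Z: "Z \<noteq> 0" "\<And>y. y \<in> span {A, B, D} \<Longrightarrow> orthogonal Z y"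
    using orthogonal_to_subspace_exists by blast
  have tr: "trace (transpose Z ** Y) = Z \<bullet> Y" for Y :: "real^2^2"
    by (simp add: trace2 matrix_mult2 inner_vec_def sum_2 transpose_def)
  have "transpose Z \<noteq> 0"
  proof
    assume "transpose Z = 0"
    then have "Z \<bullet> Z = 0" using tr[of Z] by (simp add: trace2)
    with Z(1) show False by simp
  qed
  moreover have "trace (transpose Z ** Y) = 0" if "Y \<in> {A, B, D}" for Y
    unfolding tr using Z(2)[OF span_base[OF that]] by (simp add: orthogonal_def)
  ultimately show thesis
    by (intro that[of "transpose Z"]) blast+
qed

text \<open>\<open>hypC q\<close> and \<open>hypS q\<close> are the solutions of u'' = q u with
  initial data (1, 0) and (0, 1) at 0; the case distinction follows the sign of q.\<close>

definition hypC :: "real \<Rightarrow> real \<Rightarrow> real" where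
  "hypC q x = (if q \<ge> 0 then cosh (sqrt q * x) else cos (sqrt (- q) * x))"

definition hypS :: "real \<Rightarrow> real \<Rightarrow> real" where
  "hypS q x = (if q = 0 then x else if q > 0 then sinh (sqrt q * x) / sqrt q
     else sin (sqrt (- q) * x) / sqrt (- q))"

lemma hypC_0 [simp]: "hypC q 0 = 1" and hypS_0 [simp]: "hypS q 0 = 0"
  by (auto simp: hypC_def hypS_def)

lemma sign_square_cases:
  fixes q :: real
  obtains "q = 0" | m where "m > 0" "q = m\<^sup>2" | m where "m > 0" "q = - m\<^sup>2"
proof -
  consider "q = 0" | "q > 0" | "q < 0" by linarith
  then show thesis
  proof cases
    case 2
    then show thesis by (intro that(2)[of "sqrt q"]) auto
  next
    case 3
    then show thesis by (intro that(3)[of "sqrt (- q)"]) auto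
  qed (rule that)
qed

lemma hyp_0: "hypC 0 x = 1" "hypS 0 x = x"
  and hyp_pos: "m > 0 \<Longrightarrow> hypC (m\<^sup>2) x = cosh (m * x)" "m > 0 \<Longrightarrow> hypS (m\<^sup>2) x = sinh (m * x) / m"
  and hyp_neg: "m > 0 \<Longrightarrow> hypC (- m\<^sup>2) x = cos (m * x)" "m > 0 \<Longrightarrow> hypS (- m\<^sup>2) x = sin (m * x) / m"
  by (auto simp: hypC_def hypS_def)

lemma hyp_pythagoras: "(hypC q x)\<^sup>2 - q * (hypS q x)\<^sup>2 = 1"
  by (cases q rule: sign_square_cases)
     (simp_all add: hyp_0 hyp_pos hyp_neg power_divide cosh_square_eq)

lemma hyp_derivs:
  "((\<lambda>x. hypC q x) has_real_derivative q * hypS q x) (at x)" (is ?C)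
  "((\<lambda>x. hypS q x) has_real_derivative hypC q x) (at x)" (is ?S)
proof -
  have "?C \<and> ?S"
  proof (cases q rule: sign_square_cases)
    case (2 m)
    show ?thesis
      unfolding 2 hyp_pos[OF 2(1)] using 2(1)
      by (auto intro!: derivative_eq_intros simp: power2_eq_square)
  next
    case (3 m)
    show ?thesis
      unfolding 3 hyp_neg[OF 3(1)] using 3(1)
      by (auto intro!: derivative_eq_intros simp: power2_eq_square)
  qed (simp add: hyp_0)
  then show ?C ?S by auto
qed

lemma cosh_sinh_of_real_mult_ii:
  "cos (\<i> * of_real x) = complex_of_real (cosh x)" "sin (\<i> * of_real x) = \<i> * complex_of_real (sinh x)"
proof -
  have "cosh (complex_of_real x) = of_real (cosh x)" "sinh (complex_of_real x) = of_real (sinh x)"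
    by (simp_all add: cosh_field_def sinh_field_def exp_of_real flip: of_real_minus)
  then show "cos (\<i> * of_real x) = complex_of_real (cosh x)" "sin (\<i> * of_real x) = \<i> * complex_of_real (sinh x)"
    by (simp_all add: cosh_conv_cos sinh_conv_sin flip: \<open>cosh (complex_of_real x) = of_real (cosh x)\<close>
        \<open>sinh (complex_of_real x) = of_real (sinh x)\<close>)
qed

lemma csqrt_square_cases:
  assumes "m > 0"
  shows "csqrt (- of_real (m\<^sup>2)) = \<i> * of_real m" "csqrt (- of_real (- m\<^sup>2)) = of_real m"
  using assms by (auto intro!: csqrt_unique simp: power_mult_distrib)

text \<open>With w a complex square root of -q, one formula serves all signs of q. The second
  equation is multiplied by w to avoid the division at w = 0.\<close>

lemma hyp_complex:
  "complex_of_real (hypC q x) = cos (csqrt (- of_real q) * of_real x)" (is ?C)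
  "csqrt (- of_real q) * complex_of_real (hypS q x) = sin (csqrt (- of_real q) * of_real x)" (is ?S)
proof -
  have "?C \<and> ?S"
  proof (cases q rule: sign_square_cases)
    case 1
    then show ?thesis by (simp add: hyp_0)
  next
    case (2 m)
    then show ?thesis
      unfolding 2 csqrt_square_cases[OF 2(1)] hyp_pos[OF 2(1)]
      using cosh_sinh_of_real_mult_ii[of "m * x"] by (simp add: mult.assoc)
  next
    case (3 m)
    then show ?thesis
      unfolding 3 csqrt_square_cases[OF 3(1)] hyp_neg[OF 3(1)]
      using 3(1) by (simp add: cos_of_real sin_of_real flip: of_real_mult of_real_divide)
  qed
  then show ?C ?S by auto
qed

section \<open>Analytic dependence of traces on the potential in a cell\<close>

definition cell :: "real \<Rightarrow> real \<Rightarrow> real^2^2" where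
  "cell x q = mk2 (hypC q x) (hypS q x) (q * hypS q x) (hypC q x)"

lemma det_cell [simp]: "det (cell x q) = 1"
  using hyp_pythagoras[of q x] by (simp add: cell_def power2_eq_square algebra_simps)

text \<open>Infinitely many solutions r in a bounded interval would give an entire function whose
  zeros accumulate, hence one that vanishes identically. The excluded coefficients are those of a
  traceless diagonal matrix, for which the trace is constantly 0.\<close>

lemma finite_cell_level:
  fixes c1 c2 c3 c4 :: real
  assumes "h > 0" "\<not> (c1 + c4 = 0 \<and> c2 = 0 \<and> c3 = 0)"
  shows "finite {r \<in> {0..1}. trace (mk2 c1 c2 c3 c4 ** cell h (q + r)) = \<kappa>}" (is "finite ?Z")
proof (rule ccontr)
  assume inf: "infinite ?Z"
  \<comment> \<open>The trace condition multiplied by \<open>w\<close>, as an entire function of a square root \<open>w\<close> of \<open>- (q + r)\<close>.\<close>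
  define F :: "complex \<Rightarrow> complex" where "F w = of_real (c1 + c4) * w * cos (w * of_real h)
    - of_real c2 * w\<^sup>2 * sin (w * of_real h) + of_real c3 * sin (w * of_real h) - of_real \<kappa> * w" for w
  define k where "k r = csqrt (- of_real (q + r))" for r
  have k2: "(k r)\<^sup>2 = - of_real (q + r)" for r
    by (simp add: k_def)
  have F0: "F (k r) = 0" if "r \<in> ?Z" for r
  proof -
    have "c1 * hypC (q + r) h + c2 * ((q + r) * hypS (q + r) h) + c3 * hypS (q + r) h
        + c4 * hypC (q + r) h = \<kappa>"
      using that by (simp add: cell_def)
    then have "complex_of_real (c1 * hypC (q + r) h + c2 * ((q + r) * hypS (q + r) h)
        + c3 * hypS (q + r) h + c4 * hypC (q + r) h) = of_real \<kappa>"
      by (simp only:)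
    then have eq: "k r * (of_real (c1 + c4) * of_real (hypC (q + r) h) +
        of_real c2 * (of_real (q + r) * of_real (hypS (q + r) h)) + of_real c3 * of_real (hypS (q + r) h))
      = k r * of_real \<kappa>"
      by (simp add: algebra_simps)
    have "A * z * C - c2 * (- Q * (z * S)) + c3 * (z * S) - K * z = 0"
      if "z * (A * C + c2 * (Q * S) + c3 * S) = z * K" for A C S Q K z c2 c3 :: complex
      using that by (simp add: algebra_simps)
    from this[OF eq] have "of_real (c1 + c4) * k r * of_real (hypC (q + r) h)
        - of_real c2 * ((k r)\<^sup>2 * (k r * of_real (hypS (q + r) h)))
        + of_real c3 * (k r * of_real (hypS (q + r) h)) - of_real \<kappa> * k r = 0"
      unfolding k2 .
    then show ?thesis
      unfolding F_def k_def hyp_complex by (simp only: mult.assoc)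
  qed
  have "inj_on k ?Z"
  proof (rule inj_onI)
    fix r s assume "k r = k s"
    then have "(k r)\<^sup>2 = (k s)\<^sup>2" by (simp only:)
    then have "q + r = q + s"
      unfolding k2 by (simp only: neg_equal_iff_equal of_real_eq_iff)
    then show "r = s" by (simp only: add_left_cancel)
  qed
  then have "infinite (k ` ?Z)"
    using inf finite_imageD by blast
  moreover have "bounded (k ` ?Z)"
  proof (rule boundedI)
    fix z assume "z \<in> k ` ?Z"
    then obtain r where r: "z = k r" "0 \<le> r" "r \<le> 1" by auto
    have "norm z ^ 2 = \<bar>q + r\<bar>"
      unfolding r norm_power[symmetric] k2 norm_minus_cancel by (simp only: norm_of_real)
    also have "\<dots> \<le> \<bar>q\<bar> + 1" using r by linarith
    also have "\<dots> \<le> (\<bar>q\<bar> + 1)\<^sup>2" by (simp add: power2_eq_square algebra_simps)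
    finally show "norm z \<le> \<bar>q\<bar> + 1"
      by (rule power2_le_imp_le) simp
  qed
  ultimately obtain \<xi> where \<xi>: "\<xi> islimpt (k ` ?Z)"
    using bounded_infinite_imp_islimpt by blast
  have F: "F w = 0" for w
  proof (rule analytic_continuation[of F, OF _ open_UNIV connected_UNIV subset_UNIV UNIV_I \<xi> _ UNIV_I])
    show "F holomorphic_on UNIV"
      unfolding F_def by (intro holomorphic_intros)
    show "F z = 0" if "z \<in> k ` ?Z" for z
      using that F0 by blast
  qed
  have Freal: "(c1 + c4) * w * cos (w * h) - c2 * w\<^sup>2 * sin (w * h) + c3 * sin (w * h) - \<kappa> * w = 0" for w :: real
  proof -
    have "complex_of_real ((c1 + c4) * w * cos (w * h) - c2 * w\<^sup>2 * sin (w * h) + c3 * sin (w * h) - \<kappa> * w)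
        = F (of_real w)"
      unfolding F_def by (simp flip: cos_of_real sin_of_real)
    then show ?thesis unfolding F by (simp only: of_real_eq_0_iff)
  qed
  have cancel: "x = y" if "x * w = y * w" "w > 0" for x y w :: real
    using that by simp
  \<comment> \<open>At w h = pi and w h = 2 pi the sine vanishes while the cosine takes opposite
    values, which forces both \<open>c1 + c4\<close> and \<kappa> to be 0.\<close>
  have e1: "c1 + c4 = - \<kappa>"
  proof (rule cancel)
    define X where "X = (c1 + c4) * (pi / h)"
    have "pi / h * h = pi" using assms(1) by simp
    from Freal[of "pi / h", unfolded this, folded X_def] have "X = - \<kappa> * (pi / h)" by simp
    then show "(c1 + c4) * (pi / h) = - \<kappa> * (pi / h)" unfolding X_def .
  qed (use assms(1) in simp)
  have e2: "c1 + c4 = \<kappa>"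
  proof (rule cancel)
    define X where "X = (c1 + c4) * (2 * pi / h)"
    have "2 * pi / h * h = 2 * pi" using assms(1) by simp
    from Freal[of "2 * pi / h", unfolded this, folded X_def] have "X = \<kappa> * (2 * pi / h)" by simp
    then show "(c1 + c4) * (2 * pi / h) = \<kappa> * (2 * pi / h)" unfolding X_def .
  qed (use assms(1) in simp)
  have \<kappa>: "\<kappa> = 0" and s: "c1 + c4 = 0" using e1 e2 by auto
  \<comment> \<open>At w h = pi / 2 and w h = 3 pi / 2 the cosine vanishes. Both points give c3 as
    c2 times the square of w, for two different squares, so c2 and c3 vanish.\<close>
  have e3: "c3 = c2 * (pi / (2 * h))\<^sup>2"
    using Freal[of "pi / (2 * h)"] assms(1) \<kappa> s by simp
  have "sin (3 * pi / 2) = -1"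
    using sin_3over2_pi by simp
  then have e4: "c3 = c2 * (3 * pi / (2 * h))\<^sup>2"
    using Freal[of "3 * pi / (2 * h)"] assms(1) \<kappa> s by simp
  have eq: "(3 * pi / (2 * h))\<^sup>2 - (pi / (2 * h))\<^sup>2 = 8 * (pi / (2 * h))\<^sup>2"
    by (simp add: power2_eq_square field_simps)
  have "c2 * ((3 * pi / (2 * h))\<^sup>2 - (pi / (2 * h))\<^sup>2) = 0"
    using e3 e4 by (simp add: right_diff_distrib)
  then have "c2 * (8 * (pi / (2 * h))\<^sup>2) = 0"
    unfolding eq .
  then have "c2 = 0" using assms(1) by simp
  then show False using e3 s assms(2) by simp
qed

lemma finite_cell_level_matrix:
  assumes "h > 0" "\<nexists>e. C = mk2 e 0 0 (- e)"
  shows "finite {r \<in> {0..1}. trace (C ** cell h (q + r)) = \<kappa>}"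
proof -
  obtain a b c d where C: "C = mk2 a b c d" using mk2_cases by blast
  have "\<not> (a + d = 0 \<and> b = 0 \<and> c = 0)"
  proof
    assume "a + d = 0 \<and> b = 0 \<and> c = 0"
    then have "C = mk2 a 0 0 (- a)" unfolding C by simp
    with assms(2) show False by blast
  qed
  then show ?thesis
    unfolding C by (rule finite_cell_level[OF assms(1)])
qed

text \<open>Multiplying by a generic cell leaves the line of traceless diagonal matrices, the only
  direction that \<open>finite_cell_level\<close> cannot treat. Outside this line the trace of the
  product is already nonconstant; on it, an off-diagonal entry of the product has to be
  examined.\<close>

lemma finite_cell_degenerate:
  assumes "h > 0" "C \<noteq> 0"
  shows "finite {r \<in> {0..1}. \<exists>e. cell h (q + r) ** C = mk2 e 0 0 (- e)}"
proof (cases "\<exists>e. C = mk2 e 0 0 (- e)")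
  case False
  have "trace (C ** cell h (q + r)) = 0" if "cell h (q + r) ** C = mk2 e 0 0 (- e)" for r e
    using that by (subst trace_mul_sym) simp
  then show ?thesis
    by (intro finite_subset[OF _ finite_cell_level_matrix[OF assms(1) False, of q 0]]) auto
next
  case True
  then obtain f where f: "C = mk2 f 0 0 (- f)" by blast
  with assms(2) have f0: "f \<noteq> 0" by (auto simp: zero_mk2)
  \<comment> \<open>For C = diag(f, -f) the upper right entry of the product is -f times
    \<open>hypS\<close>, and \<open>hypS\<close> is the trace of the cell against the elementary
    matrix \<open>mk2 0 0 1 0\<close>.\<close>
  have "trace (mk2 0 0 1 0 ** cell h (q + r)) = 0" if "cell h (q + r) ** C = mk2 e 0 0 (- e)" for r e
    using that f0 by (auto simp: f cell_def)
  moreover have "finite {r \<in> {0..1}. trace (mk2 0 0 1 0 ** cell h (q + r)) = 0}"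
    by (rule finite_cell_level_matrix[OF assms(1)]) simp
  ultimately show ?thesis
    by (elim finite_subset[rotated]) auto
qed

text \<open>By cyclicity of the trace the condition reads as a trace of
  \<open>cell h (q0 + r) ** (C ** R)\<close> against the other cell. First r is chosen off a finite
  set so that none of these matrices is traceless diagonal, then s off the resulting finite level
  sets. Invertibility of R keeps \<open>C ** R\<close> nonzero.\<close>

lemma generic_cells:
  assumes "h > 0" "\<delta> > 0" "det R = 1" "finite Cs" "\<And>C \<kappa>. (C, \<kappa>) \<in> Cs \<Longrightarrow> C \<noteq> 0"
  obtains r s where "0 < r" "r < \<delta>" "0 < s" "s < \<delta>"
    "\<And>C \<kappa>. (C, \<kappa>) \<in> Cs \<Longrightarrow> trace (C ** (R ** cell h (q1 + s) ** cell h (q0 + r))) \<noteq> \<kappa>"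
proof -
  define I where "I = {0<..<min \<delta> 1}"
  have infI: "infinite I"
    unfolding I_def using assms(2) by (intro infinite_Ioo) auto
  define R' where "R' = trace R *\<^sub>R mat 1 - R"
  have RR: "R ** R' = mat 1"
    unfolding R'_def by (rule mult_adjugate2[OF assms(3)])
  have CR: "C ** R \<noteq> 0" if "(C, \<kappa>) \<in> Cs" for C \<kappa>
  proof
    assume "C ** R = 0"
    then have "C ** (R ** R') = 0" by (simp add: matrix_mul_assoc)
    then show False using assms(5)[OF that] by (simp add: RR)
  qed
  define D where "D C = {r \<in> {0..1}. \<exists>e. cell h (q0 + r) ** (C ** R) = mk2 e 0 0 (- e)}" for C
  have "finite (\<Union>p\<in>Cs. D (fst p))"
  proof (rule finite_UN_I[OF assms(4)])
    fix p assume "p \<in> Cs"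
    then have "fst p ** R \<noteq> 0" using CR[of "fst p" "snd p"] by simp
    then show "finite (D (fst p))"
      unfolding D_def by (rule finite_cell_degenerate[OF assms(1)])
  qed
  then have "I - (\<Union>p\<in>Cs. D (fst p)) \<noteq> {}"
    using Diff_infinite_finite[OF _ infI] infinite_imp_nonempty by blast
  then obtain r where r: "r \<in> I" "\<And>C \<kappa>. (C, \<kappa>) \<in> Cs \<Longrightarrow> r \<notin> D C"
    by fastforce
  define L where "L C \<kappa> = {s \<in> {0..1}. trace (cell h (q0 + r) ** (C ** R) ** cell h (q1 + s)) = \<kappa>}" for C \<kappa>
  have "r \<in> {0..1}" using r(1) unfolding I_def by auto
  then have "finite (L C \<kappa>)" if "(C, \<kappa>) \<in> Cs" for C \<kappa>
    unfolding L_def using r(2)[OF that] by (intro finite_cell_level_matrix[OF assms(1)]) (auto simp: D_def)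
  then have "finite (\<Union>p\<in>Cs. L (fst p) (snd p))"
    using assms(4) by auto
  then have "I - (\<Union>p\<in>Cs. L (fst p) (snd p)) \<noteq> {}"
    using Diff_infinite_finite[OF _ infI] infinite_imp_nonempty by blast
  then obtain s where s: "s \<in> I" "\<And>C \<kappa>. (C, \<kappa>) \<in> Cs \<Longrightarrow> s \<notin> L C \<kappa>"
    by fastforce
  have "trace (C ** (R ** cell h (q1 + s) ** cell h (q0 + r))) \<noteq> \<kappa>" if "(C, \<kappa>) \<in> Cs" for C \<kappa>
  proof -
    have "trace (C ** (R ** cell h (q1 + s) ** cell h (q0 + r)))
        = trace ((C ** R ** cell h (q1 + s)) ** cell h (q0 + r))"
      by (simp add: matrix_mul_assoc)
    also have "\<dots> = trace (cell h (q0 + r) ** (C ** R ** cell h (q1 + s)))"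
      by (rule trace_mul_sym)
    finally show ?thesis
      using s(2)[OF that] s(1) by (auto simp: L_def I_def matrix_mul_assoc)
  qed
  with r(1) s(1) show thesis
    by (intro that[of r s]) (auto simp: I_def)
qed

text \<open>Let Q be the inverse of P. The first power W avoids the line through Q, so that
  \<open>P ** W\<close> is not scalar. If P times the second power commuted with it, it would lie in
  the span of \<open>P ** W\<close> and the identity, that is, the second power would lie in the
  span of W and Q, which its choice prevents.\<close>

lemma noncommuting_perturbation:
  fixes q0 q1 :: real and qs :: "real list"
  assumes "h > 0" "\<delta> > 0" "det P = 1" "n \<ge> 1"
  defines "A \<equiv> \<lambda>r s. mprod (map (cell h) ((q0 + r) # (q1 + s) # qs))"
  obtains r s r' s' where "{r, s, r', s'} \<subseteq> {0<..<\<delta>}"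
    "(P ** mprod (replicate n (A r s))) ** (P ** mprod (replicate n (A r' s')))
     \<noteq> (P ** mprod (replicate n (A r' s'))) ** (P ** mprod (replicate n (A r s)))"
proof -
  define R where "R = mprod (map (cell h) qs)"
  have detR: "det R = 1"
    unfolding R_def by (rule det_mprod) auto
  have A: "A r s = R ** cell h (q1 + s) ** cell h (q0 + r)" for r s
    unfolding A_def R_def by (simp add: matrix_mul_assoc)
  have detA: "det (A r s) = 1" for r s
    unfolding A by (simp add: det_mul detR)
  obtain m where n: "n = Suc m" using assms(4) by (cases n) auto
  define Q where "Q = trace P *\<^sub>R mat 1 - P"
  have QP: "Q ** P = mat 1"
    unfolding Q_def by (rule mult_adjugate2[OF assms(3)])
  \<comment> \<open>These pairs forbid the traces of A at which its n-th power is scalar and retains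
    no information on A.\<close>
  define roots where "roots = (\<lambda>\<rho>. (mat 1 :: real^2^2, \<rho>)) ` {\<rho>. poly (cheb n) \<rho> = 0}"
  have roots: "finite roots" "\<And>C \<kappa>. (C, \<kappa>) \<in> roots \<Longrightarrow> C \<noteq> 0"
    unfolding roots_def using finite_cheb_roots[OF assms(4)] by (auto simp: mat_1_mk2 zero_mk2)
  have gen: "\<exists>r s. {r, s} \<subseteq> {0<..<\<delta>} \<and> (\<forall>u v. mprod (replicate n (A r s)) \<noteq> u *\<^sub>R W + v *\<^sub>R Q)" for W
  proof -
    \<comment> \<open>C also annihilates the identity, so that the scalar part of the n-th power
      drops out of its trace against C.\<close>
    obtain C where C: "C \<noteq> 0" "trace (C ** W) = 0" "trace (C ** Q) = 0" "trace (C ** mat 1) = 0"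
      using exists_annihilator by metis
    obtain r s where rs: "0 < r" "r < \<delta>" "0 < s" "s < \<delta>"
      and ne: "\<And>D \<kappa>. (D, \<kappa>) \<in> insert (C, 0) roots \<Longrightarrow> trace (D ** A r s) \<noteq> \<kappa>"
    proof -
      have "D \<noteq> 0" if "(D, \<kappa>) \<in> insert (C, 0) roots" for D \<kappa>
        using that C(1) roots(2) by auto
      with generic_cells[OF assms(1,2) detR, of "insert (C, 0) roots" q1 q0] roots(1) that
      show thesis unfolding A by blast
    qed
    have tr: "trace (C ** A r s) \<noteq> 0"
      by (rule ne) simp
    have p: "poly (cheb n) (trace (A r s)) \<noteq> 0"
    proof
      assume "poly (cheb n) (trace (A r s)) = 0"
      then have "(mat 1, trace (A r s)) \<in> insert (C, 0) roots"
        unfolding roots_def by auto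
      from ne[OF this] show False by simp
    qed
    have "mprod (replicate n (A r s)) \<noteq> u *\<^sub>R W + v *\<^sub>R Q" for u v
    proof
      assume eq: "mprod (replicate n (A r s)) = u *\<^sub>R W + v *\<^sub>R Q"
      have "trace (C ** mprod (replicate n (A r s))) = poly (cheb n) (trace (A r s)) * trace (C ** A r s)"
        unfolding n mprod_replicate[OF detA] trace_mult_linear C(4) by simp
      moreover have "trace (C ** mprod (replicate n (A r s))) = 0"
        unfolding eq trace_mult_linear C by simp
      ultimately show False using p tr by simp
    qed
    with rs show ?thesis by (intro exI[of _ r] exI[of _ s]) auto
  qed
  \<comment> \<open>Taking \<open>W = Q\<close> reduces the span to the line through Q.\<close>
  obtain r s where rs: "{r, s} \<subseteq> {0<..<\<delta>}"
    and 1: "\<And>u v. mprod (replicate n (A r s)) \<noteq> u *\<^sub>R Q + v *\<^sub>R Q"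
    using gen[of Q] by blast
  define W where "W = mprod (replicate n (A r s))"
  obtain r' s' where rs': "{r', s'} \<subseteq> {0<..<\<delta>}"
    and 2: "\<And>u v. mprod (replicate n (A r' s')) \<noteq> u *\<^sub>R W + v *\<^sub>R Q"
    using gen[of W] by blast
  have inverse: "Q ** (P ** X) = X" for X
    unfolding matrix_mul_assoc QP by (rule matrix_mul_lid)
  note lin = matrix_mult_affine[of Q]
  have "(P ** W) ** (P ** mprod (replicate n (A r' s'))) \<noteq> (P ** mprod (replicate n (A r' s'))) ** (P ** W)"
  proof
    assume comm: "(P ** W) ** (P ** mprod (replicate n (A r' s'))) = (P ** mprod (replicate n (A r' s'))) ** (P ** W)"
    have ns: "\<nexists>v. P ** W = v *\<^sub>R mat 1"
    proof
      assume "\<exists>v. P ** W = v *\<^sub>R mat 1"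
      then obtain v where "P ** W = 0 *\<^sub>R W + v *\<^sub>R mat 1" by auto
      then have "Q ** (P ** W) = 0 *\<^sub>R (Q ** W) + v *\<^sub>R Q" by (simp only: lin)
      then have "W = 0 *\<^sub>R Q + v *\<^sub>R Q" by (simp add: inverse)
      with 1 show False unfolding W_def by blast
    qed
    obtain u v where "P ** mprod (replicate n (A r' s')) = u *\<^sub>R (P ** W) + v *\<^sub>R mat 1"
      using commuting_nonscalar[OF comm ns] by blast
    then have "Q ** (P ** mprod (replicate n (A r' s'))) = u *\<^sub>R (Q ** (P ** W)) + v *\<^sub>R Q"
      by (simp only: lin)
    then have "mprod (replicate n (A r' s')) = u *\<^sub>R W + v *\<^sub>R Q"
      by (simp only: inverse)
    with 2 show False by blast
  qed
  then have nc: "(P ** mprod (replicate n (A r s))) ** (P ** mprod (replicate n (A r' s')))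
     \<noteq> (P ** mprod (replicate n (A r' s'))) ** (P ** mprod (replicate n (A r s)))"
    unfolding W_def .
  have "{r, s, r', s'} \<subseteq> {0<..<\<delta>}"
    using rs rs' by simp
  from this nc show thesis
    by (rule that)
qed


section \<open>Locally absolutely continuous functions\<close>

lemma ac_derivD:
  assumes "ac_deriv v w"
  shows "s \<le> t \<Longrightarrow> set_integrable lborel {s..t} w"
    "s \<le> t \<Longrightarrow> v t - v s = (LINT x:{s..t}|lborel. w x)"
  using assms by (auto simp: ac_deriv_def)

lemma ac_deriv_measurable:
  assumes "ac_deriv v w"
  shows "w \<in> borel_measurable borel"
proof (rule borel_measurable_LIMSEQ_real)
  fix n :: nat
  have "integrable lborel (\<lambda>x. indicator {- real n..real n} x *\<^sub>R w x)"
    using ac_derivD(1)[OF assms, of "- real n" "real n"] by (simp add: set_integrable_def)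
  then show "(\<lambda>x. indicator {- real n..real n} x *\<^sub>R w x) \<in> borel_measurable borel"
    using borel_measurable_integrable by fastforce
next
  fix x :: real
  obtain N :: nat where N: "\<bar>x\<bar> \<le> real N" using real_arch_simple by blast
  have "\<forall>\<^sub>F n in sequentially. indicator {- real n..real n} x *\<^sub>R w x = w x"
    using eventually_ge_at_top[of N]
  proof eventually_elim
    case (elim n)
    then have "\<bar>x\<bar> \<le> real n" using N of_nat_mono[OF elim, where ?'a = real] by linarith
    then show ?case by (simp add: indicator_def abs_le_iff)
  qed
  then show "(\<lambda>n. indicator {- real n..real n} x *\<^sub>R w x) \<longlonglongrightarrow> w x"
    by (rule tendsto_eventually)
qed

lemma ac_deriv_continuous:
  assumes "ac_deriv v w"
  shows "continuous_on UNIV v"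
proof -
  have cont: "continuous_on {- real n..real n} v" for n :: nat
  proof -
    have int: "w integrable_on {- real n..real n}"
      using ac_derivD(1)[OF assms, of "- real n" "real n"]
      by (intro set_borel_integral_eq_integral(1)) auto
    have eq: "v x = v (- real n) + integral {- real n..x} w" if "x \<in> {- real n..real n}" for x
      using ac_derivD[OF assms, of "- real n" x] that set_borel_integral_eq_integral(2)[of "{- real n..x}" w]
      by simp
    have "continuous_on {- real n..real n} (\<lambda>x. v (- real n) + integral {- real n..x} w)"
      by (intro continuous_intros indefinite_integral_continuous_1 int)
    then show ?thesis
      by (rule continuous_on_eq) (rule eq[symmetric])
  qed
  have "isCont v x" for x
  proof -
    obtain n :: nat where n: "\<bar>x\<bar> < real n" using reals_Archimedean2 by blast
    then have "x \<in> interior {- real n..real n}"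
      by (simp add: abs_less_iff) 
    then show ?thesis
      by (rule continuous_on_interior[OF cont])
  qed
  then show ?thesis
    by (simp add: continuous_at_imp_continuous_on)
qed

lemma ac_deriv_measurable_left:
  "ac_deriv v w \<Longrightarrow> v \<in> borel_measurable borel"
  by (rule borel_measurable_continuous_onI[OF ac_deriv_continuous])

lemma ac_deriv_cong_AE:
  assumes "ac_deriv v w" "AE x in lborel. w x = w' x" "w' \<in> borel_measurable borel"
  shows "ac_deriv v w'"
proof -
  have [measurable]: "w \<in> borel_measurable borel" by (rule ac_deriv_measurable[OF assms(1)])
  note [measurable] = assms(3)
  show ?thesis
    unfolding ac_deriv_def
  proof (intro allI impI)
    fix s t :: real assume st: "s \<le> t"
    have AE: "AE x in lborel. x \<in> {s..t} \<longrightarrow> w x = w' x"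
      using assms(2) by eventually_elim simp
    have "set_integrable lborel {s..t} w \<longleftrightarrow> set_integrable lborel {s..t} w'"
      using AE by (intro set_integrable_cong_AE) auto
    moreover have "(LINT x:{s..t}|lborel. w x) = (LINT x:{s..t}|lborel. w' x)"
      using AE by (intro set_lebesgue_integral_cong_AE) auto
    ultimately show "set_integrable lborel {s..t} w' \<and> v t - v s = (LINT x:{s..t}|lborel. w' x)"
      using ac_derivD[OF assms(1) st] by simp
  qed
qed

lemma ac_deriv_add:
  assumes "ac_deriv f f1" "ac_deriv g g1"
  shows "ac_deriv (\<lambda>x. f x + g x) (\<lambda>x. f1 x + g1 x)"
  unfolding ac_deriv_def
proof (intro allI impI)
  fix s t :: real assume st: "s \<le> t"
  note f = ac_derivD[OF assms(1) st] and g = ac_derivD[OF assms(2) st]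
  show "set_integrable lborel {s..t} (\<lambda>x. f1 x + g1 x) \<and>
    f t + g t - (f s + g s) = (LINT x:{s..t}|lborel. f1 x + g1 x)"
    using f g set_integral_add[OF f(1) g(1)] by simp
qed

lemma ac_deriv_minus:
  assumes "ac_deriv f f1"
  shows "ac_deriv (\<lambda>x. - f x) (\<lambda>x. - f1 x)"
  unfolding ac_deriv_def
proof (intro allI impI)
  fix s t :: real assume st: "s \<le> t"
  note f = ac_derivD[OF assms(1) st]
  have "set_integrable lborel {s..t} (\<lambda>x. - f1 x)"
    using f(1) by (simp add: set_integrable_def)
  moreover have "(LINT x:{s..t}|lborel. - f1 x) = - (LINT x:{s..t}|lborel. f1 x)"
    by (simp add: set_lebesgue_integral_def)
  ultimately show "set_integrable lborel {s..t} (\<lambda>x. - f1 x) \<and>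
    - f t - - f s = (LINT x:{s..t}|lborel. - f1 x)"
    using f by simp
qed

lemma ac_deriv_diff:
  assumes "ac_deriv f f1" "ac_deriv g g1"
  shows "ac_deriv (\<lambda>x. f x - g x) (\<lambda>x. f1 x - g1 x)"
  using ac_deriv_add[OF assms(1) ac_deriv_minus[OF assms(2)]] by simp

lemma ac_deriv_set_integrable_mult:
  assumes "ac_deriv f f1" "ac_deriv g g1" "s \<le> t"
  shows "set_integrable lborel {s..t} (\<lambda>x. f1 x * g x)"
proof -
  have "compact (g ` {s..t})"
    using ac_deriv_continuous[OF assms(2)] by (intro compact_continuous_image) (auto intro: continuous_on_subset)
  from compact_imp_bounded[OF this] obtain B where "\<forall>y \<in> g ` {s..t}. norm y \<le> B"
    unfolding bounded_iff by (elim exE)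
  then have B: "\<bar>g x\<bar> \<le> B" if "x \<in> {s..t}" for x
    using that by simp
  note [measurable] = ac_deriv_measurable[OF assms(1)] ac_deriv_measurable_left[OF assms(2)]
  have int: "integrable lborel (\<lambda>x. B * norm (indicator {s..t} x *\<^sub>R f1 x))"
    using ac_derivD(1)[OF assms(1,3)] by (auto simp: set_integrable_def)
  show ?thesis
    unfolding set_integrable_def
  proof (rule Bochner_Integration.integrable_bound[OF int])
    show "AE x in lborel. norm (indicator {s..t} x *\<^sub>R (f1 x * g x))
        \<le> norm (B * norm (indicator {s..t} x *\<^sub>R f1 x))"
    proof (rule AE_I2)
      fix x
      show "norm (indicator {s..t} x *\<^sub>R (f1 x * g x)) \<le> norm (B * norm (indicator {s..t} x *\<^sub>R f1 x))"
      proof (cases "x \<in> {s..t}")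
        case True
        then have "\<bar>g x\<bar> \<le> \<bar>B\<bar>" using B[OF True] by linarith
        then have "\<bar>f1 x\<bar> * \<bar>g x\<bar> \<le> \<bar>f1 x\<bar> * \<bar>B\<bar>" by (intro mult_left_mono) auto
        with True show ?thesis by (simp add: abs_mult mult.commute)
      qed simp
    qed
  qed measurable
qed

text \<open>
  Integration by parts is Fubini for \<open>f'(x) g'(y)\<close> on the triangle \<open>s \<le> y \<le> x \<le> t\<close>.
\<close>

lemma ac_deriv_mult:
  assumes "ac_deriv f f1" "ac_deriv g g1"
  shows "ac_deriv (\<lambda>x. f x * g x) (\<lambda>x. f1 x * g x + f x * g1 x)"
  unfolding ac_deriv_def
proof (intro allI impI)
  fix s t :: real assume st: "s \<le> t"
  note f = ac_derivD[OF assms(1)] and g = ac_derivD[OF assms(2)]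
  note [measurable] = ac_deriv_measurable[OF assms(1)] ac_deriv_measurable_left[OF assms(1)]
    ac_deriv_measurable[OF assms(2)] ac_deriv_measurable_left[OF assms(2)]
  define F where "F x = indicator {s..t} x * f1 x" for x
  define G where "G x = indicator {s..t} x * g1 x" for x
  have [measurable]: "F \<in> borel_measurable borel" "G \<in> borel_measurable borel"
    unfolding F_def G_def by measurable
  have F: "integrable lborel F" and G: "integrable lborel G"
    using f(1)[OF st] g(1)[OF st] by (simp_all add: F_def[abs_def] G_def[abs_def] set_integrable_def)
  have i1: "set_integrable lborel {s..t} (\<lambda>x. f1 x * g x)"
    by (rule ac_deriv_set_integrable_mult[OF assms st])
  have i2: "set_integrable lborel {s..t} (\<lambda>x. f x * g1 x)"
    using ac_deriv_set_integrable_mult[OF assms(2,1) st] by (simp add: mult.commute)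
  define H where "H x y = F x * G y * (if y \<le> x then 1 else 0)" for x y :: real
  have Hint: "integrable (lborel \<Otimes>\<^sub>M lborel) (\<lambda>(x, y). H x y)"
  proof (rule Bochner_Integration.integrable_bound)
    show "integrable (lborel \<Otimes>\<^sub>M lborel) (\<lambda>(x, y). F x * G y)"
    proof (rule lborel_pair.Fubini_integrable)
      show "integrable lborel (\<lambda>x. LINT y|lborel. norm (case (x, y) of (x, y) \<Rightarrow> F x * G y))"
        using F by (simp add: abs_mult)
      show "AE x in lborel. integrable lborel (\<lambda>y. case (x, y) of (x, y) \<Rightarrow> F x * G y)"
        using G by simp
    qed measurable
    show "(\<lambda>(x, y). H x y) \<in> borel_measurable (lborel \<Otimes>\<^sub>M lborel)"
      unfolding H_def by measurable
    show "AE p in lborel \<Otimes>\<^sub>M lborel. norm (case p of (x, y) \<Rightarrow> H x y) \<le> norm (case p of (x, y) \<Rightarrow> F x * G y)"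
      by (rule AE_I2) (auto simp: H_def split: prod.split)
  qed
  have I1: "(LINT y|lborel. H x y) = F x * (g x - g s)" for x
  proof (cases "x \<in> {s..t}")
    case True
    have "(LINT y|lborel. H x y) = (LINT y|lborel. F x * (indicator {s..x} y *\<^sub>R g1 y))"
      by (rule Bochner_Integration.integral_cong) (use True in \<open>auto simp: H_def G_def indicator_def\<close>)
    also have "\<dots> = F x * (g x - g s)"
      using g(2)[of s x] True by (simp add: set_lebesgue_integral_def)
    finally show ?thesis .
  qed (simp add: H_def F_def)
  have I2: "(LINT x|lborel. H x y) = G y * (f t - f y)" for y
  proof (cases "y \<in> {s..t}")
    case True
    have "(LINT x|lborel. H x y) = (LINT x|lborel. G y * (indicator {y..t} x *\<^sub>R f1 x))"
      by (rule Bochner_Integration.integral_cong) (use True in \<open>auto simp: H_def F_def indicator_def\<close>)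
    also have "\<dots> = G y * (f t - f y)"
      using f(2)[of y t] True by (simp add: set_lebesgue_integral_def)
    finally show ?thesis .
  qed (simp add: H_def G_def)
  have eq: "(LINT y|lborel. G y * (f t - f y)) = (LINT x|lborel. F x * (g x - g s))"
    using lborel_pair.Fubini_integral[OF Hint] unfolding I1 I2 .
  have Fg: "integrable lborel (\<lambda>x. F x * g x)" and Gf: "integrable lborel (\<lambda>x. G x * f x)"
    using i1 i2 by (simp_all add: F_def G_def set_integrable_def mult_ac)
  have tF: "(LINT x|lborel. F x) = f t - f s" and tG: "(LINT x|lborel. G x) = g t - g s"
    using f(2)[OF st] g(2)[OF st] by (simp_all add: F_def G_def set_lebesgue_integral_def)
  have "(LINT x|lborel. F x * (g x - g s)) = (LINT x|lborel. F x * g x) - (f t - f s) * g s"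
    using Fg F by (simp add: right_diff_distrib tF)
  moreover have "(LINT x|lborel. G x * (f t - f x)) = (g t - g s) * f t - (LINT x|lborel. G x * f x)"
    using Gf G by (simp add: right_diff_distrib tG)
  ultimately have "(LINT x|lborel. F x * g x) + (LINT x|lborel. G x * f x)
      = (g t - g s) * f t + (f t - f s) * g s"
    using eq by linarith
  also have "\<dots> = f t * g t - f s * g s"
    by (simp add: algebra_simps)
  finally have fin: "(LINT x|lborel. F x * g x) + (LINT x|lborel. G x * f x) = f t * g t - f s * g s" .
  have "(LINT x:{s..t}|lborel. f1 x * g x + f x * g1 x)
      = (LINT x:{s..t}|lborel. f1 x * g x) + (LINT x:{s..t}|lborel. f x * g1 x)"
    by (rule set_integral_add(2)[OF i1 i2])
  also have "\<dots> = (LINT x|lborel. F x * g x) + (LINT x|lborel. G x * f x)"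
    by (simp add: set_lebesgue_integral_def F_def G_def mult_ac)
  finally show "set_integrable lborel {s..t} (\<lambda>x. f1 x * g x + f x * g1 x) \<and>
      f t * g t - f s * g s = (LINT x:{s..t}|lborel. f1 x * g x + f x * g1 x)"
    using set_integral_add(1)[OF i1 i2] fin by simp
qed

lemma ac_deriv_AE_zero_const:
  assumes "ac_deriv f f1" "AE x in lborel. f1 x = 0"
  shows "f x = f 0"
proof -
  have "ac_deriv f (\<lambda>x. 0)"
    by (rule ac_deriv_cong_AE[OF assms]) simp
  then have d: "f t = f s" if "s \<le> t" for s t
    using ac_derivD(2)[of f "\<lambda>x. 0" s t] that by (simp add: set_lebesgue_integral_def)
  show ?thesis
    using d[of 0 x] d[of x 0] by linarith
qed

lemma set_integral_Ioc_eq_Icc: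
  fixes q :: "real \<Rightarrow> real"
  assumes "q \<in> borel_measurable borel"
  shows "set_integrable lborel {s<..t} q \<longleftrightarrow> set_integrable lborel {s..t} q"
    "(LINT x:{s<..t}|lborel. q x) = (LINT x:{s..t}|lborel. q x)"
proof -
  note [measurable] = assms
  have AE: "AE x in lborel. indicator {s<..t} x *\<^sub>R q x = indicator {s..t} x *\<^sub>R q x"
    using AE_lborel_singleton[of s] by eventually_elim (auto simp: indicator_def)
  show "set_integrable lborel {s<..t} q \<longleftrightarrow> set_integrable lborel {s..t} q"
    unfolding set_integrable_def by (rule integrable_cong_AE) (use AE in auto)
  show "(LINT x:{s<..t}|lborel. q x) = (LINT x:{s..t}|lborel. q x)"
    unfolding set_lebesgue_integral_def by (rule integral_cong_AE) (use AE in auto)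
qed

text \<open>This and the next lemma supply the coefficient functions in the variation of constants:
  an integral from -\<infinity> for the solution decaying there, and one to +\<infinity> for the
  other.\<close>

lemma ac_deriv_left_integral:
  fixes q :: "real \<Rightarrow> real"
  assumes "q \<in> borel_measurable borel" "\<And>t. set_integrable lborel {..t} q"
  shows "ac_deriv (\<lambda>x. LINT y:{..x}|lborel. q y) q"
  unfolding ac_deriv_def
proof (intro allI impI)
  fix s t :: real assume "s \<le> t"
  then have un: "{..t} = {..s} \<union> {s<..t}" by auto
  have sub: "set_integrable lborel {s<..t} q" "set_integrable lborel {s..t} q"
    by (rule set_integrable_subset[OF assms(2)[of t]]; auto)+
  have "(LINT y:{..t}|lborel. q y) = (LINT y:{..s}|lborel. q y) + (LINT y:{s<..t}|lborel. q y)"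
    unfolding un by (rule set_integral_Un[OF _ assms(2) sub(1)]) auto
  with sub show "set_integrable lborel {s..t} q \<and>
      (LINT y:{..t}|lborel. q y) - (LINT y:{..s}|lborel. q y) = (LINT x:{s..t}|lborel. q x)"
    by (simp add: set_integral_Ioc_eq_Icc[OF assms(1)])
qed

lemma ac_deriv_right_integral:
  fixes q :: "real \<Rightarrow> real"
  assumes "q \<in> borel_measurable borel" "\<And>t. set_integrable lborel {t<..} q"
  shows "ac_deriv (\<lambda>x. LINT y:{x<..}|lborel. q y) (\<lambda>y. - q y)"
  unfolding ac_deriv_def
proof (intro allI impI)
  fix s t :: real assume "s \<le> t"
  then have un: "{s<..} = {s<..t} \<union> {t<..}" by auto
  have sub: "set_integrable lborel {s<..t} q"
    by (rule set_integrable_subset[OF assms(2)[of s]]) auto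
  then have sub': "set_integrable lborel {s..t} q"
    by (simp add: set_integral_Ioc_eq_Icc[OF assms(1)])
  have "(LINT y:{s<..}|lborel. q y) = (LINT y:{s<..t}|lborel. q y) + (LINT y:{t<..}|lborel. q y)"
    unfolding un by (rule set_integral_Un[OF _ sub assms(2)]) auto
  moreover have "(LINT x:{s..t}|lborel. - q x) = - (LINT x:{s..t}|lborel. q x)"
    by (simp add: set_lebesgue_integral_def)
  moreover have "set_integrable lborel {s..t} (\<lambda>y. - q y)"
    using sub' by (simp add: set_integrable_def)
  ultimately show "set_integrable lborel {s..t} (\<lambda>y. - q y) \<and>
      (LINT y:{t<..}|lborel. q y) - (LINT y:{s<..}|lborel. q y) = (LINT x:{s..t}|lborel. - q x)"
    by (simp add: set_integral_Ioc_eq_Icc[OF assms(1)])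
qed

lemma integrable_exp_abs:
  assumes "c > (0::real)"
  shows "integrable lborel (\<lambda>x. exp (- c * \<bar>x\<bar>))"
proof -
  have "integrable lebesgue (\<lambda>x. indicator {0..} x *\<^sub>R exp (- c * x))"
    by (intro nonnegative_absolutely_integrable_1 [unfolded set_integrable_def]
        integrable_on_exp_minus_to_infinity assms) auto
  then have i: "integrable lborel (\<lambda>x. indicator {0..} x *\<^sub>R exp (- c * x))"
    by (subst (asm) integrable_completion) auto
  from lborel_integrable_real_affine[OF i, of "-1" 0]
  have i': "integrable lborel (\<lambda>x. indicator {0..} (- x) *\<^sub>R exp (c * x))" by simp
  show ?thesis
  proof (rule Bochner_Integration.integrable_bound[OF Bochner_Integration.integrable_add[OF i i']])
    show "AE x in lborel. norm (exp (- c * \<bar>x\<bar>)) \<le>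
        norm (indicator {0..} x *\<^sub>R exp (- c * x) + indicator {0..} (- x) *\<^sub>R exp (c * x))"
    proof (rule AE_I2)
      fix x :: real
      show "norm (exp (- c * \<bar>x\<bar>)) \<le>
        norm (indicator {0..} x *\<^sub>R exp (- c * x) + indicator {0..} (- x) *\<^sub>R exp (c * x))"
        by (cases "x = 0"; cases "0 \<le> x") simp_all
    qed
  qed measurable
qed


section \<open>Green kernels and the resolvent\<close>

lemma rep_l2_add: "AE x in lborel. rep_l2 (f + g) x = rep_l2 f x + rep_l2 g x"
proof -
  have "f + g = abs_l2 (\<lambda>x. rep_l2 f x + rep_l2 g x)"
    by (simp add: plus_l2_def)
  then show ?thesis
    using rep_abs_l2[OF sq_integrable_add[OF rep_l2_sq_integrable[of f] rep_l2_sq_integrable[of g]]] by simp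
qed

lemma rep_l2_scaleR: "AE x in lborel. rep_l2 (r *\<^sub>R f) x = r * rep_l2 f x"
proof -
  have "r *\<^sub>R f = abs_l2 (\<lambda>x. r * rep_l2 f x)"
    by (simp add: scaleR_l2_def)
  then show ?thesis
    using rep_abs_l2[OF sq_integrable_scale[OF rep_l2_sq_integrable[of f]]] by simp
qed

lemma rep_l2_diff: "AE x in lborel. rep_l2 (f - g) x = rep_l2 f x - rep_l2 g x"
proof -
  have eq: "f - g = f + (-1) *\<^sub>R g"
    by simp
  show ?thesis
    unfolding eq using rep_l2_add[of f "(-1) *\<^sub>R g"] rep_l2_scaleR[of "-1" g]
    by eventually_elim simp
qed

lemma abs_l2_eqI:
  assumes "sq_integrable u" "AE x in lborel. rep_l2 f x = u x"
  shows "f = abs_l2 u"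
  unfolding l2_eq_iff using assms(2) rep_abs_l2[OF assms(1)] by eventually_elim simp

lemma norm_abs_l2: "sq_integrable u \<Longrightarrow> norm (abs_l2 u) = sqrt (\<integral>x. (u x)\<^sup>2 \<partial>lborel)"
proof -
  assume u: "sq_integrable u"
  then have [measurable]: "u \<in> borel_measurable borel" by (simp add: sq_integrable_def)
  have [measurable]: "rep_l2 (abs_l2 u) \<in> borel_measurable borel"
    using rep_l2_sq_integrable[of "abs_l2 u"] by (simp add: sq_integrable_def)
  have "(\<integral>x. (rep_l2 (abs_l2 u) x)\<^sup>2 \<partial>lborel) = (\<integral>x. (u x)\<^sup>2 \<partial>lborel)"
    by (rule integral_cong_AE) (use rep_abs_l2[OF u] in auto)
  then show ?thesis by (simp add: norm_l2_eq)
qed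

lemma sq_integrable_diff:
  assumes "sq_integrable f" "sq_integrable g"
  shows "sq_integrable (\<lambda>x. f x - g x)"
  using sq_integrable_add[OF assms(1) sq_integrable_scale[OF assms(2), of "-1"]] by simp

lemma sq_integrable_cong_AE:
  assumes "sq_integrable f" "g \<in> borel_measurable borel" "AE x in lborel. f x = g x"
  shows "sq_integrable g"
proof -
  have [measurable]: "f \<in> borel_measurable borel" using assms(1) by (simp add: sq_integrable_def)
  note [measurable] = assms(2)
  have "integrable lborel (\<lambda>x. (f x)\<^sup>2) \<longleftrightarrow> integrable lborel (\<lambda>x. (g x)\<^sup>2)"
    by (rule integrable_cong_AE) (use assms(3) in auto)
  then show ?thesis using assms by (simp add: sq_integrable_def)
qed

section \<open>Exponential kernels and quasi-periodic functions\<close>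

lemma nn_integral_exp_abs_shift:
  fixes c :: real
  assumes "c > 0"
  obtains J where "0 \<le> J" "\<And>x. (\<integral>\<^sup>+y. ennreal (exp (- c * \<bar>x - y\<bar>)) \<partial>lborel) = ennreal J"
    "\<And>y. (\<integral>\<^sup>+x. ennreal (exp (- c * \<bar>x - y\<bar>)) \<partial>lborel) = ennreal J"
proof -
  define J where "J = (LINT x|lborel. exp (- c * \<bar>x\<bar>))"
  have J: "(\<integral>\<^sup>+x. ennreal (exp (- c * \<bar>x\<bar>)) \<partial>lborel) = ennreal J"
    unfolding J_def by (rule nn_integral_eq_integral[OF integrable_exp_abs[OF assms]]) auto
  have "(\<integral>\<^sup>+y. ennreal (exp (- c * \<bar>x - y\<bar>)) \<partial>lborel) = ennreal J" for x
    using nn_integral_real_affine[of "\<lambda>y. ennreal (exp (- c * \<bar>y\<bar>))" "-1" x] J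
    by simp
  moreover have "(\<integral>\<^sup>+x. ennreal (exp (- c * \<bar>x - y\<bar>)) \<partial>lborel) = ennreal J" for y
    using nn_integral_real_affine[of "\<lambda>y. ennreal (exp (- c * \<bar>y\<bar>))" "1" "- y"] J
    by simp
  moreover have "0 \<le> J" unfolding J_def by simp
  ultimately show thesis using that by blast
qed

lemma exp_abs_sq_integrable:
  assumes "c > 0"
  shows "sq_integrable (\<lambda>y. exp (- c * \<bar>x - y\<bar>))"
proof -
  have "integrable lborel (\<lambda>y. exp (- (2 * c) * \<bar>y\<bar>))"
    using assms by (intro integrable_exp_abs) simp
  from lborel_integrable_real_affine[OF this, of "-1" x]
  have "integrable lborel (\<lambda>y. exp (- (2 * c) * \<bar>x - y\<bar>))"
    by simp
  moreover have "(\<lambda>y. (exp (- c * \<bar>x - y\<bar>))\<^sup>2) = (\<lambda>y. exp (- (2 * c) * \<bar>x - y\<bar>))"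
    by (auto simp: power2_eq_square mult_exp_exp)
  ultimately show ?thesis
    unfolding sq_integrable_def by simp
qed

lemma sq_integrable_bound:
  assumes "sq_integrable f" "g \<in> borel_measurable borel" "\<And>x. \<bar>g x\<bar> \<le> C * \<bar>f x\<bar>"
  shows "sq_integrable g"
proof -
  note [measurable] = assms(2)
  have "integrable lborel (\<lambda>x. C\<^sup>2 * (f x)\<^sup>2)"
    using assms(1) by (simp add: sq_integrable_def)
  then have "integrable lborel (\<lambda>x. (g x)\<^sup>2)"
  proof (rule Bochner_Integration.integrable_bound)
    show "AE x in lborel. norm ((g x)\<^sup>2) \<le> norm (C\<^sup>2 * (f x)\<^sup>2)"
    proof (rule AE_I2)
      fix x
      have "\<bar>g x\<bar>\<^sup>2 \<le> (C * \<bar>f x\<bar>)\<^sup>2"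
        using assms(3)[of x] by (intro power_mono) auto
      then show "norm ((g x)\<^sup>2) \<le> norm (C\<^sup>2 * (f x)\<^sup>2)"
        by (simp add: power_mult_distrib abs_mult)
    qed
  qed measurable
  then show ?thesis using assms(2) by (simp add: sq_integrable_def)
qed

text \<open>Translation by L preserves the integral of the square but multiplies it by the square of
  \<mu>. Hence no nonzero multiple of a Floquet solution with such a multiplier lies in the Hilbert
  space.\<close>

lemma sq_integrable_quasi_periodic_AE_zero:
  assumes "sq_integrable q" "\<And>x. q (x + L) = \<mu> * q x" "\<mu>\<^sup>2 \<noteq> 1"
  shows "AE x in lborel. q x = 0"
proof -
  have int: "integrable lborel (\<lambda>x. (q x)\<^sup>2)"
    using assms(1) by (simp add: sq_integrable_def)
  have "(\<integral>x. (q x)\<^sup>2 \<partial>lborel) = (\<integral>x. (q (L + 1 * x))\<^sup>2 \<partial>lborel)"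
    using lborel_integral_real_affine[of 1 "\<lambda>x. (q x)\<^sup>2" L] by simp
  also have "\<dots> = (\<integral>x. \<mu>\<^sup>2 * (q x)\<^sup>2 \<partial>lborel)"
    using assms(2) by (simp add: add.commute[of L] power_mult_distrib)
  also have "\<dots> = \<mu>\<^sup>2 * (\<integral>x. (q x)\<^sup>2 \<partial>lborel)"
    by simp
  finally have "(\<mu>\<^sup>2 - 1) * (\<integral>x. (q x)\<^sup>2 \<partial>lborel) = 0"
    by (simp add: left_diff_distrib)
  then have "(\<integral>x. (q x)\<^sup>2 \<partial>lborel) = 0"
    using assms(3) by simp
  then have "AE x in lborel. (q x)\<^sup>2 = 0"
    using integral_nonneg_eq_0_iff_AE[OF int] by auto
  then show ?thesis by simp
qed

text \<open>The interface between Floquet theory and the resolvent: p and m solve -u'' + V u = E u,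
  decay at +\<infinity> and -\<infinity> respectively, and are normalised by their Wronskian. The
  bounds serve existence of the resolvent, the shift rules serve uniqueness.\<close>

locale dichotomy =
  fixes V :: "real \<Rightarrow> real" and E :: real and p p1 m m1 :: "real \<Rightarrow> real" and K \<kappa> L \<mu> :: real
  assumes kappa: "\<kappa> > 0"
    and p_ac: "ac_deriv p p1" "ac_deriv p1 (\<lambda>x. (V x - E) * p x)"
    and m_ac: "ac_deriv m m1" "ac_deriv m1 (\<lambda>x. (V x - E) * m x)"
    and wronskian: "p x * m1 x - p1 x * m x = 1"
    and p_bound: "\<bar>p x\<bar> \<le> K * exp (- \<kappa> * x)"
    and m_bound: "\<bar>m x\<bar> \<le> K * exp (\<kappa> * x)"
    and p_shift: "p (x + L) = \<mu> * p x"
    and m_shift: "m (x + L) = inverse \<mu> * m x"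
    and mu: "\<mu> \<noteq> 0" "\<mu>\<^sup>2 \<noteq> 1"
begin

lemma pm_measurable [measurable]: "p \<in> borel_measurable borel" "m \<in> borel_measurable borel"
  using p_ac(1) m_ac(1) by (auto intro: ac_deriv_measurable_left)

lemma K_nonneg: "K \<ge> 0"
  using p_bound[of 0] by (simp add: order_trans[OF abs_ge_zero])

definition green :: "real \<Rightarrow> real \<Rightarrow> real" where
  "green x y = (if y \<le> x then p x * m y else m x * p y)"

lemma green_measurable [measurable]: "green x \<in> borel_measurable borel"
  unfolding green_def by measurable

lemma green_bound: "\<bar>green x y\<bar> \<le> K\<^sup>2 * exp (- \<kappa> * \<bar>x - y\<bar>)"
proof (cases "y \<le> x")
  case True
  have "\<bar>p x\<bar> * \<bar>m y\<bar> \<le> (K * exp (- \<kappa> * x)) * (K * exp (\<kappa> * y))"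
    using p_bound m_bound K_nonneg by (intro mult_mono) auto
  also have "\<dots> = K\<^sup>2 * (exp (- \<kappa> * x) * exp (\<kappa> * y))"
    by (simp add: power2_eq_square)
  also have "\<dots> = K\<^sup>2 * exp (- \<kappa> * \<bar>x - y\<bar>)"
    using True by (simp add: mult_exp_exp right_diff_distrib)
  finally show ?thesis using True by (simp add: green_def abs_mult)
next
  case False
  have "\<bar>m x\<bar> * \<bar>p y\<bar> \<le> (K * exp (\<kappa> * x)) * (K * exp (- \<kappa> * y))"
    using p_bound m_bound K_nonneg by (intro mult_mono) auto
  also have "\<dots> = K\<^sup>2 * (exp (\<kappa> * x) * exp (- \<kappa> * y))"
    by (simp add: power2_eq_square)
  also have "\<dots> = K\<^sup>2 * exp (- \<kappa> * \<bar>x - y\<bar>)"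
    using False by (simp add: mult_exp_exp right_diff_distrib)
  finally show ?thesis using False by (simp add: green_def abs_mult)
qed

lemma green_integrable: "sq_integrable h \<Longrightarrow> integrable lborel (\<lambda>y. green x y * h y)"
  by (rule sq_integrable_prod[OF sq_integrable_bound[OF exp_abs_sq_integrable[OF kappa, of x], where C = "K\<^sup>2"]])
     (use green_bound in auto)

definition solve :: "(real \<Rightarrow> real) \<Rightarrow> real \<Rightarrow> real" where
  "solve h x = (LINT y|lborel. green x y * h y)"

lemma half_line_integrable:
  assumes "sq_integrable h"
  shows "set_integrable lborel {..x} (\<lambda>y. m y * h y)" "set_integrable lborel {x<..} (\<lambda>y. p y * h y)"
proof -
  have [measurable]: "h \<in> borel_measurable borel" using assms by (simp add: sq_integrable_def)
  have "sq_integrable (\<lambda>y. indicator {..x} y * m y)"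
  proof (rule sq_integrable_bound[OF exp_abs_sq_integrable[OF kappa, of x], where C = "K * exp (\<kappa> * x)"])
    fix y
    have "\<bar>m y\<bar> \<le> K * exp (\<kappa> * x) * exp (- \<kappa> * \<bar>x - y\<bar>)" if "y \<le> x"
      using m_bound[of y] that by (simp add: mult.assoc mult_exp_exp right_diff_distrib)
    then show "\<bar>indicator {..x} y * m y\<bar> \<le> K * exp (\<kappa> * x) * \<bar>exp (- \<kappa> * \<bar>x - y\<bar>)\<bar>"
      using K_nonneg by (auto simp: indicator_def)
  qed measurable
  from sq_integrable_prod[OF this assms] show "set_integrable lborel {..x} (\<lambda>y. m y * h y)"
    by (simp add: set_integrable_def mult.assoc)
  have "sq_integrable (\<lambda>y. indicator {x<..} y * p y)"
  proof (rule sq_integrable_bound[OF exp_abs_sq_integrable[OF kappa, of x], where C = "K * exp (- \<kappa> * x)"])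
    fix y
    have "\<bar>p y\<bar> \<le> K * exp (- \<kappa> * x) * exp (- \<kappa> * \<bar>x - y\<bar>)" if "x < y"
      using p_bound[of y] that by (simp add: mult.assoc mult_exp_exp right_diff_distrib)
    then show "\<bar>indicator {x<..} y * p y\<bar> \<le> K * exp (- \<kappa> * x) * \<bar>exp (- \<kappa> * \<bar>x - y\<bar>)\<bar>"
      using K_nonneg by (auto simp: indicator_def)
  qed measurable
  from sq_integrable_prod[OF this assms] show "set_integrable lborel {x<..} (\<lambda>y. p y * h y)"
    by (simp add: set_integrable_def mult.assoc)
qed

lemma solve_split:
  assumes "sq_integrable h"
  shows "solve h x = p x * (LINT y:{..x}|lborel. m y * h y) + m x * (LINT y:{x<..}|lborel. p y * h y)"
proof -
  note i = half_line_integrable[OF assms, of x, unfolded set_integrable_def]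
  have "solve h x = (LINT y|lborel. p x * (indicator {..x} y *\<^sub>R (m y * h y))
      + m x * (indicator {x<..} y *\<^sub>R (p y * h y)))"
    unfolding solve_def by (rule Bochner_Integration.integral_cong) (auto simp: green_def indicator_def)
  also have "\<dots> = (LINT y|lborel. p x * (indicator {..x} y *\<^sub>R (m y * h y)))
      + (LINT y|lborel. m x * (indicator {x<..} y *\<^sub>R (p y * h y)))"
    using i by (intro Bochner_Integration.integral_add) auto
  finally show ?thesis
    by (simp add: set_lebesgue_integral_def)
qed

text \<open>Variation of constants: in the first derivative the two terms with h cancel, in the
  second they combine to minus the Wronskian times h.\<close>

lemma solve_ac:
  assumes "sq_integrable h"
  obtains u1 where "ac_deriv (solve h) u1" "ac_deriv u1 (\<lambda>x. (V x - E) * solve h x - h x)"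
proof -
  have [measurable]: "h \<in> borel_measurable borel" using assms by (simp add: sq_integrable_def)
  define F where "F x = (LINT y:{..x}|lborel. m y * h y)" for x
  define G where "G x = (LINT y:{x<..}|lborel. p y * h y)" for x
  have F: "ac_deriv F (\<lambda>y. m y * h y)"
    unfolding F_def[abs_def] by (intro ac_deriv_left_integral half_line_integrable assms) measurable
  have G: "ac_deriv G (\<lambda>y. - (p y * h y))"
    unfolding G_def[abs_def] by (intro ac_deriv_right_integral half_line_integrable assms) measurable
  have u: "solve h = (\<lambda>x. p x * F x + m x * G x)"
    using solve_split[OF assms] by (simp add: fun_eq_iff F_def G_def)
  have "ac_deriv (solve h) (\<lambda>x. (p1 x * F x + p x * (m x * h x)) + (m1 x * G x + m x * - (p x * h x)))"
    unfolding u by (intro ac_deriv_add ac_deriv_mult p_ac m_ac F G)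
  moreover have "(p1 x * F x + p x * (m x * h x)) + (m1 x * G x + m x * - (p x * h x))
      = p1 x * F x + m1 x * G x" for x
    by (simp add: algebra_simps)
  ultimately have 1: "ac_deriv (solve h) (\<lambda>x. p1 x * F x + m1 x * G x)"
    by (simp only:)
  have "ac_deriv (\<lambda>x. p1 x * F x + m1 x * G x)
      (\<lambda>x. ((V x - E) * p x * F x + p1 x * (m x * h x)) + ((V x - E) * m x * G x + m1 x * - (p x * h x)))"
    by (intro ac_deriv_add ac_deriv_mult p_ac m_ac F G)
  moreover have "((V x - E) * p x * F x + p1 x * (m x * h x)) + ((V x - E) * m x * G x + m1 x * - (p x * h x))
      = (V x - E) * solve h x - h x" for x
  proof -
    have "((V x - E) * p x * F x + p1 x * (m x * h x)) + ((V x - E) * m x * G x + m1 x * - (p x * h x))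
      = (V x - E) * (p x * F x + m x * G x) - (p x * m1 x - p1 x * m x) * h x"
      by (simp add: algebra_simps)
    then show ?thesis unfolding wronskian u by simp
  qed
  ultimately have 2: "ac_deriv (\<lambda>x. p1 x * F x + m1 x * G x) (\<lambda>x. (V x - E) * solve h x - h x)"
    by (simp only:)
  from 1 2 show thesis by (rule that)
qed

text \<open>Schur's test for the exponentially decaying kernel.\<close>

lemma solve_bounded:
  obtains C where "C \<ge> 0" "\<And>h. sq_integrable h \<Longrightarrow> sq_integrable (solve h)"
    "\<And>h. sq_integrable h \<Longrightarrow> (\<integral>x. (solve h x)\<^sup>2 \<partial>lborel) \<le> C\<^sup>2 * (\<integral>x. (h x)\<^sup>2 \<partial>lborel)"
proof -
  obtain J where J: "0 \<le> J" "\<And>x. (\<integral>\<^sup>+y. ennreal (exp (- \<kappa> * \<bar>x - y\<bar>)) \<partial>lborel) = ennreal J"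
    "\<And>y. (\<integral>\<^sup>+x. ennreal (exp (- \<kappa> * \<bar>x - y\<bar>)) \<partial>lborel) = ennreal J"
    using nn_integral_exp_abs_shift[OF kappa] by blast
  define k where "k x y = exp (- \<kappa> * \<bar>x - y\<bar>)" for x y
  have k0: "k x y \<ge> 0" for x y by (simp add: k_def)
  have [measurable]: "case_prod k \<in> borel_measurable (borel \<Otimes>\<^sub>M borel)" "k x \<in> borel_measurable borel" for x
    unfolding k_def by measurable
  have main: "(\<integral>\<^sup>+x. ennreal ((solve h x)\<^sup>2) \<partial>lborel) \<le> ennreal ((K\<^sup>2 * J)\<^sup>2 * (\<integral>x. (h x)\<^sup>2 \<partial>lborel))"
    if h: "sq_integrable h" for h
  proof -
    have [measurable]: "h \<in> borel_measurable borel" using h by (simp add: sq_integrable_def)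
    \<comment> \<open>Cauchy-Schwarz is applied after splitting k into two square roots: one factor
      integrates to J, and the other keeps the square of h weighted by k, which Fubini can integrate
      over x.\<close>
    have pw: "ennreal ((solve h x)\<^sup>2) \<le> ennreal ((K\<^sup>2)\<^sup>2 * J) * (\<integral>\<^sup>+y. ennreal (k x y * (h y)\<^sup>2) \<partial>lborel)" for x
    proof -
      have "ennreal \<bar>solve h x\<bar> \<le> (\<integral>\<^sup>+y. ennreal (norm (green x y * h y)) \<partial>lborel)"
        unfolding solve_def real_norm_def[symmetric] by (rule integral_norm_bound_ennreal[OF green_integrable[OF h]])
      also have "\<dots> \<le> (\<integral>\<^sup>+y. ennreal (K\<^sup>2) * (ennreal (sqrt (k x y)) * ennreal (sqrt (k x y) * \<bar>h y\<bar>)) \<partial>lborel)"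
      proof (rule nn_integral_mono)
        fix y
        have "norm (green x y * h y) \<le> (K\<^sup>2 * k x y) * \<bar>h y\<bar>"
          unfolding real_norm_def abs_mult k_def by (intro mult_right_mono green_bound) simp
        also have "\<dots> = K\<^sup>2 * (sqrt (k x y) * (sqrt (k x y) * \<bar>h y\<bar>))"
          using k0[of x y] by (simp add: mult.assoc[symmetric])
        finally show "ennreal (norm (green x y * h y)) \<le> ennreal (K\<^sup>2) * (ennreal (sqrt (k x y)) * ennreal (sqrt (k x y) * \<bar>h y\<bar>))"
          using k0[of x y] by (simp add: ennreal_mult[symmetric] ennreal_leI)
      qed
      also have "\<dots> = ennreal (K\<^sup>2) * (\<integral>\<^sup>+y. ennreal (sqrt (k x y)) * ennreal (sqrt (k x y) * \<bar>h y\<bar>) \<partial>lborel)"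
        by (rule nn_integral_cmult) measurable
      finally have "(ennreal \<bar>solve h x\<bar>)\<^sup>2 \<le> (ennreal (K\<^sup>2))\<^sup>2 * (\<integral>\<^sup>+y. ennreal (sqrt (k x y)) * ennreal (sqrt (k x y) * \<bar>h y\<bar>) \<partial>lborel)\<^sup>2"
        unfolding power_mult_distrib[symmetric] by (rule power_mono) simp
      also have "\<dots> \<le> (ennreal (K\<^sup>2))\<^sup>2 * ((\<integral>\<^sup>+y. (ennreal (sqrt (k x y)))\<^sup>2 \<partial>lborel) * (\<integral>\<^sup>+y. (ennreal (sqrt (k x y) * \<bar>h y\<bar>))\<^sup>2 \<partial>lborel))"
        by (intro mult_left_mono Cauchy_Schwarz_nn_integral) simp_all
      also have "(\<integral>\<^sup>+y. (ennreal (sqrt (k x y)))\<^sup>2 \<partial>lborel) = ennreal J"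
        using J(2)[of x] k0 by (simp add: ennreal_power) (simp add: k_def)
      also have "(\<integral>\<^sup>+y. (ennreal (sqrt (k x y) * \<bar>h y\<bar>))\<^sup>2 \<partial>lborel) = (\<integral>\<^sup>+y. ennreal (k x y * (h y)\<^sup>2) \<partial>lborel)"
        using k0 by (simp add: ennreal_power power_mult_distrib)
      finally show ?thesis
        using J(1) by (simp add: ennreal_power ennreal_mult mult.assoc)
    qed
    have "(\<integral>\<^sup>+x. ennreal ((solve h x)\<^sup>2) \<partial>lborel)
        \<le> (\<integral>\<^sup>+x. ennreal ((K\<^sup>2)\<^sup>2 * J) * (\<integral>\<^sup>+y. ennreal (k x y * (h y)\<^sup>2) \<partial>lborel) \<partial>lborel)"
      by (rule nn_integral_mono) (rule pw)
    also have "\<dots> = ennreal ((K\<^sup>2)\<^sup>2 * J) * (\<integral>\<^sup>+x. (\<integral>\<^sup>+y. ennreal (k x y * (h y)\<^sup>2) \<partial>lborel) \<partial>lborel)"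
      by (rule nn_integral_cmult) measurable
    also have "(\<integral>\<^sup>+x. (\<integral>\<^sup>+y. ennreal (k x y * (h y)\<^sup>2) \<partial>lborel) \<partial>lborel)
        = (\<integral>\<^sup>+y. (\<integral>\<^sup>+x. ennreal (k x y * (h y)\<^sup>2) \<partial>lborel) \<partial>lborel)"
      by (rule lborel_pair.Fubini') measurable
    also have "\<dots> = (\<integral>\<^sup>+y. ennreal J * ennreal ((h y)\<^sup>2) \<partial>lborel)"
    proof (rule nn_integral_cong)
      fix y
      have "(\<integral>\<^sup>+x. ennreal (k x y * (h y)\<^sup>2) \<partial>lborel) = (\<integral>\<^sup>+x. ennreal (k x y) * ennreal ((h y)\<^sup>2) \<partial>lborel)"
        using k0 by (simp add: ennreal_mult)
      also have "\<dots> = (\<integral>\<^sup>+x. ennreal (k x y) \<partial>lborel) * ennreal ((h y)\<^sup>2)"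
        by (rule nn_integral_multc) measurable
      finally show "(\<integral>\<^sup>+x. ennreal (k x y * (h y)\<^sup>2) \<partial>lborel) = ennreal J * ennreal ((h y)\<^sup>2)"
        using J(3)[of y] by (simp add: k_def)
    qed
    also have "\<dots> = ennreal J * (\<integral>\<^sup>+y. ennreal ((h y)\<^sup>2) \<partial>lborel)"
      by (rule nn_integral_cmult) measurable
    also have "(\<integral>\<^sup>+y. ennreal ((h y)\<^sup>2) \<partial>lborel) = ennreal (\<integral>y. (h y)\<^sup>2 \<partial>lborel)"
      using h by (intro nn_integral_eq_integral) (auto simp: sq_integrable_def)
    finally have le: "(\<integral>\<^sup>+x. ennreal ((solve h x)\<^sup>2) \<partial>lborel)
      \<le> ennreal ((K\<^sup>2)\<^sup>2 * J) * (ennreal J * ennreal (\<integral>y. (h y)\<^sup>2 \<partial>lborel))" .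
    define I where "I = (\<integral>y. (h y)\<^sup>2 \<partial>lborel)"
    have I: "I \<ge> 0" unfolding I_def by simp
    have "ennreal ((K\<^sup>2)\<^sup>2 * J) * (ennreal J * ennreal I) = ennreal ((K\<^sup>2)\<^sup>2 * J * (J * I))"
      using J(1) I by (simp only: ennreal_mult mult_nonneg_nonneg zero_le_power2)
    also have "(K\<^sup>2)\<^sup>2 * J * (J * I) = (K\<^sup>2 * J)\<^sup>2 * I"
      by (simp add: power_mult_distrib power2_eq_square mult_ac)
    finally show ?thesis
      using le unfolding I_def by simp
  qed
  have sq: "sq_integrable (solve h)" if h: "sq_integrable h" for h
  proof -
    obtain u1 where "ac_deriv (solve h) u1" using solve_ac[OF h] by blast
    then have meas [measurable]: "solve h \<in> borel_measurable borel" by (rule ac_deriv_measurable_left)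
    have "(\<integral>\<^sup>+x. ennreal ((solve h x)\<^sup>2) \<partial>lborel) < \<infinity>"
      using main[OF h] by (rule order.strict_trans1) simp
    then have "integrable lborel (\<lambda>x. (solve h x)\<^sup>2)"
      by (intro integrableI_nonneg) auto
    with meas show ?thesis by (simp add: sq_integrable_def)
  qed
  show thesis
  proof (rule that[of "K\<^sup>2 * J"])
    show "0 \<le> K\<^sup>2 * J" using J(1) by simp
    show "sq_integrable (solve h)" if "sq_integrable h" for h by (rule sq[OF that])
    fix h :: "real \<Rightarrow> real" assume h: "sq_integrable h"
    have "ennreal (\<integral>x. (solve h x)\<^sup>2 \<partial>lborel) = (\<integral>\<^sup>+x. ennreal ((solve h x)\<^sup>2) \<partial>lborel)"
      using sq[OF h] by (intro nn_integral_eq_integral[symmetric]) (auto simp: sq_integrable_def)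
    also note main[OF h]
    finally show "(\<integral>x. (solve h x)\<^sup>2 \<partial>lborel) \<le> (K\<^sup>2 * J)\<^sup>2 * (\<integral>x. (h x)\<^sup>2 \<partial>lborel)"
      by (subst (asm) ennreal_le_iff) auto
  qed
qed

text \<open>The Wronskians of z with p and m are constant, so z is a combination of p and m.
  Subtracting a multiple of z from its translate by L eliminates one of the two terms, so each term
  is square-integrable by itself and vanishes by quasi-periodicity.\<close>

lemma homogeneous_AE_zero:
  assumes "ac_deriv z z1" "ac_deriv z1 w" "AE x in lborel. w x = (V x - E) * z x" "sq_integrable z"
  shows "AE x in lborel. z x = 0"
proof -
  define c where "c = (\<lambda>q q1 x. z x * q1 x - z1 x * q x)"
  have const: "c q q1 x = c q q1 0"
    if "ac_deriv q q1" "ac_deriv q1 (\<lambda>x. (V x - E) * q x)" for q q1 x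
  proof (rule ac_deriv_AE_zero_const[of "c q q1"])
    show "ac_deriv (c q q1) (\<lambda>x. (z1 x * q1 x + z x * ((V x - E) * q x)) - (w x * q x + z1 x * q1 x))"
      unfolding c_def by (intro ac_deriv_diff ac_deriv_mult assms that)
    show "AE x in lborel. (z1 x * q1 x + z x * ((V x - E) * q x)) - (w x * q x + z1 x * q1 x) = 0"
      using assms(3) by eventually_elim simp
  qed
  define A where "A = c m m1 0"
  define B where "B = c p p1 0"
  have z: "z x = A * p x - B * m x" for x
  proof -
    have "c m m1 x * p x - c p p1 x * m x = z x * (p x * m1 x - p1 x * m x)"
      unfolding c_def by (simp add: algebra_simps)
    then show ?thesis
      unfolding wronskian const[OF p_ac, of x] const[OF m_ac, of x] A_def B_def by simp
  qed
  have shift: "sq_integrable (\<lambda>x. z (x + L))"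
    using sq_integrable_shift[OF assms(4), of "- L"] by simp
  have ne: "\<mu> - inverse \<mu> \<noteq> 0"
    using mu by (auto simp: power2_eq_square field_simps)
  have "AE x in lborel. A * p x = 0"
  proof (rule sq_integrable_quasi_periodic_AE_zero[where L = L and \<mu> = \<mu>])
    have "sq_integrable (\<lambda>x. inverse (\<mu> - inverse \<mu>) * (z (x + L) - inverse \<mu> * z x))"
      by (intro sq_integrable_scale sq_integrable_diff shift assms)
    moreover have "inverse (\<mu> - inverse \<mu>) * (z (x + L) - inverse \<mu> * z x) = A * p x" for x
    proof -
      have "z (x + L) - inverse \<mu> * z x = (\<mu> - inverse \<mu>) * (A * p x)"
        unfolding z p_shift m_shift by (simp add: algebra_simps)
      then show ?thesis using ne by simp
    qed
    ultimately show "sq_integrable (\<lambda>x. A * p x)" by (simp only:)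
    show "A * p (x + L) = \<mu> * (A * p x)" for x by (simp add: p_shift)
  qed (rule mu)
  moreover have "AE x in lborel. B * m x = 0"
  proof (rule sq_integrable_quasi_periodic_AE_zero[where L = L and \<mu> = "inverse \<mu>"])
    have "sq_integrable (\<lambda>x. inverse (\<mu> - inverse \<mu>) * (z (x + L) - \<mu> * z x))"
      by (intro sq_integrable_scale sq_integrable_diff shift assms)
    moreover have "inverse (\<mu> - inverse \<mu>) * (z (x + L) - \<mu> * z x) = B * m x" for x
    proof -
      have "z (x + L) - \<mu> * z x = (\<mu> - inverse \<mu>) * (B * m x)"
        unfolding z p_shift m_shift by (simp add: algebra_simps)
      then show ?thesis using ne by simp
    qed
    ultimately show "sq_integrable (\<lambda>x. B * m x)" by (simp only:)
    show "B * m (x + L) = inverse \<mu> * (B * m x)" for x by (simp add: m_shift)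
    show "(inverse \<mu>)\<^sup>2 \<noteq> 1"
      using mu by (simp add: power_inverse)
  qed
  ultimately show ?thesis
    unfolding z by eventually_elim (simp only: diff_zero)
qed

text \<open>The resolvent is the Green operator. Its values solve the equation by
  \<open>solve_ac\<close>; conversely, any element of the graph differs from such a value by a
  square-integrable homogeneous solution, which is zero.\<close>

theorem not_in_spec: "E \<notin> spec (schroedinger V)"
proof -
  obtain C where C: "C \<ge> 0" "\<And>h. sq_integrable h \<Longrightarrow> sq_integrable (solve h)"
    "\<And>h. sq_integrable h \<Longrightarrow> (\<integral>x. (solve h x)\<^sup>2 \<partial>lborel) \<le> C\<^sup>2 * (\<integral>x. (h x)\<^sup>2 \<partial>lborel)"
    using solve_bounded by blast
  define R where "R h = abs_l2 (solve (rep_l2 h))" for h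
  note rep_sq = rep_l2_sq_integrable
  \<comment> \<open>Being an integral, \<open>solve\<close> is insensitive to the choice of
    representative at every point and not just almost everywhere.\<close>
  have solve_cong: "solve h x = solve h' x"
    if "AE x in lborel. h x = h' x" "sq_integrable h" "sq_integrable h'" for h h' x
  proof -
    have [measurable]: "h \<in> borel_measurable borel" "h' \<in> borel_measurable borel"
      using that by (auto simp: sq_integrable_def)
    show ?thesis
      unfolding solve_def
      by (rule integral_cong_AE) (use that(1) in auto)
  qed
  have rep_R: "AE x in lborel. rep_l2 (R h) x = solve (rep_l2 h) x" for h
    unfolding R_def by (rule rep_abs_l2[OF C(2)[OF rep_sq]])
  have "bounded_linear R"
  proof (rule bounded_linear_intro[where K = C])
    fix f g :: l2
    have "solve (rep_l2 (f + g)) x = solve (rep_l2 f) x + solve (rep_l2 g) x" for x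
    proof -
      have "solve (rep_l2 (f + g)) x = solve (\<lambda>x. rep_l2 f x + rep_l2 g x) x"
        by (rule solve_cong[OF rep_l2_add rep_sq sq_integrable_add[OF rep_sq rep_sq]])
      then show ?thesis
        unfolding solve_def distrib_left
        by (simp add: Bochner_Integration.integral_add[OF green_integrable[OF rep_sq] green_integrable[OF rep_sq]])
    qed
    note sum = this
    have "AE x in lborel. rep_l2 (R f + R g) x = solve (rep_l2 (f + g)) x"
      using rep_l2_add[of "R f" "R g"] rep_R[of f] rep_R[of g] by eventually_elim (simp add: sum)
    from abs_l2_eqI[OF C(2)[OF rep_sq] this] show "R (f + g) = R f + R g"
      by (simp add: R_def)
  next
    fix r :: real and f :: l2
    have "solve (rep_l2 (r *\<^sub>R f)) x = r * solve (rep_l2 f) x" for x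
    proof -
      have "solve (rep_l2 (r *\<^sub>R f)) x = solve (\<lambda>x. r * rep_l2 f x) x"
        by (rule solve_cong[OF rep_l2_scaleR rep_sq sq_integrable_scale[OF rep_sq]])
      also have "\<dots> = (LINT y|lborel. r * (green x y * rep_l2 f y))"
        unfolding solve_def by (simp add: mult.left_commute)
      finally show ?thesis by (simp add: solve_def)
    qed
    note scale = this
    have "AE x in lborel. rep_l2 (r *\<^sub>R R f) x = solve (rep_l2 (r *\<^sub>R f)) x"
      using rep_l2_scaleR[of r "R f"] rep_R[of f] by eventually_elim (simp add: scale)
    from abs_l2_eqI[OF C(2)[OF rep_sq] this] show "R (r *\<^sub>R f) = r *\<^sub>R R f"
      by (simp add: R_def)
  next
    fix f :: l2
    have "norm (R f) = sqrt (\<integral>x. (solve (rep_l2 f) x)\<^sup>2 \<partial>lborel)"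
      unfolding R_def by (rule norm_abs_l2[OF C(2)[OF rep_sq]])
    also have "\<dots> \<le> sqrt (C\<^sup>2 * (\<integral>x. (rep_l2 f x)\<^sup>2 \<partial>lborel))"
      by (intro real_sqrt_le_mono C(3) rep_sq)
    also have "\<dots> = norm f * C"
      using C(1) by (simp add: norm_l2_eq real_sqrt_mult mult.commute)
    finally show "norm (R f) \<le> norm f * C" .
  qed
  moreover have "(f, g) \<in> schroedinger V \<longleftrightarrow> R (g - E *\<^sub>R f) = f" for f g
  proof -
    define h where "h = rep_l2 (g - E *\<^sub>R f)"
    have h: "sq_integrable h" unfolding h_def by (rule rep_sq)
    have hAE: "AE x in lborel. h x = rep_l2 g x - E * rep_l2 f x"
      using rep_l2_diff[of g "E *\<^sub>R f"] rep_l2_scaleR[of E f] unfolding h_def by eventually_elim simp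
    obtain u1 where u1: "ac_deriv (solve h) u1" "ac_deriv u1 (\<lambda>x. (V x - E) * solve h x - h x)"
      using solve_ac[OF h] by blast
    show ?thesis
    proof
      assume "R (g - E *\<^sub>R f) = f"
      then have f: "AE x in lborel. rep_l2 f x = solve h x"
        using rep_R[of "g - E *\<^sub>R f"] unfolding h_def by simp
      moreover have "AE x in lborel. rep_l2 g x = - ((V x - E) * solve h x - h x) + V x * solve h x"
        using f hAE by eventually_elim (simp add: algebra_simps)
      ultimately show "(f, g) \<in> schroedinger V"
        unfolding schroedinger_def using u1 by blast
    next
      assume "(f, g) \<in> schroedinger V"
      then obtain u v w where uvw: "ac_deriv u v" "ac_deriv v w"
        and f: "AE x in lborel. rep_l2 f x = u x"
        and g: "AE x in lborel. rep_l2 g x = - w x + V x * u x"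
        unfolding schroedinger_def by blast
      have "AE x in lborel. u x - solve h x = 0"
      proof (rule homogeneous_AE_zero)
        show "ac_deriv (\<lambda>x. u x - solve h x) (\<lambda>x. v x - u1 x)"
          "ac_deriv (\<lambda>x. v x - u1 x) (\<lambda>x. w x - ((V x - E) * solve h x - h x))"
          by (intro ac_deriv_diff uvw u1)+
        show "AE x in lborel. w x - ((V x - E) * solve h x - h x) = (V x - E) * (u x - solve h x)"
          using f g hAE by eventually_elim (simp add: algebra_simps)
        have "u \<in> borel_measurable borel"
          by (rule ac_deriv_measurable_left[OF uvw(1)])
        then have "sq_integrable u"
          by (rule sq_integrable_cong_AE[OF rep_sq[of f] _ f])
        then show "sq_integrable (\<lambda>x. u x - solve h x)"
          by (rule sq_integrable_diff[OF _ C(2)[OF h]])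
      qed
      then have "AE x in lborel. rep_l2 f x = solve h x"
        using f by eventually_elim simp
      from abs_l2_eqI[OF C(2)[OF h] this] show "R (g - E *\<^sub>R f) = f"
        unfolding R_def h_def by simp
    qed
  qed
  ultimately show ?thesis
    unfolding spec_def resolvent_set_def by blast
qed

end


section \<open>Floquet solutions of periodic step potentials\<close>

text \<open>The fundamental theorem of calculus holds within a cell, passes to adjacent intervals by
  additivity, and reaches arbitrary intervals by induction on the number of cells. The matching
  condition makes the glued function continuous, while its derivative may jump on the grid.\<close>

lemma ac_deriv_piecewise:
  fixes f g :: "int \<Rightarrow> real \<Rightarrow> real"
  assumes h: "h > 0"
    and deriv: "\<And>i x. (f i has_real_derivative g i x) (at x)"
    and cont: "\<And>i x. isCont (g i) x"
    and match: "\<And>i. f i (of_int (i + 1) * h) = f (i + 1) (of_int (i + 1) * h)"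
  shows "ac_deriv (\<lambda>x. f \<lfloor>x / h\<rfloor> x) (\<lambda>x. g \<lfloor>x / h\<rfloor> x)"
proof -
  define F where "F = (\<lambda>x. f \<lfloor>x / h\<rfloor> x)"
  define G where "G = (\<lambda>x. g \<lfloor>x / h\<rfloor> x)"
  define Q where "Q s t \<longleftrightarrow> set_integrable lborel {s..t} G \<and> F t - F s = (LINT x:{s..t}|lborel. G x)" for s t
  have floor_eq: "\<lfloor>x / h\<rfloor> = i" if "of_int i * h \<le> x" "x < of_int (i + 1) * h" for i x
    using that h by (intro floor_unique) (simp_all add: field_simps)
  have floor_le: "of_int \<lfloor>x / h\<rfloor> * h \<le> x" and floor_gt: "x < of_int (\<lfloor>x / h\<rfloor> + 1) * h" for x
    using floor_divide_lower[OF h, of x] floor_divide_upper[OF h, of x] by simp_all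
  have F_cell: "F x = f i x" if "of_int i * h \<le> x" "x \<le> of_int (i + 1) * h" for i x
  proof (cases "x = of_int (i + 1) * h")
    case True
    then have "\<lfloor>x / h\<rfloor> = i + 1" using h by simp
    then show ?thesis unfolding F_def using match[of i] True by simp
  next
    case False
    then show ?thesis unfolding F_def using floor_eq[of i x] that by simp
  qed
  have Q_cell: "Q s t" if st: "s \<le> t" "of_int i * h \<le> s" "t \<le> of_int (i + 1) * h" for s t i
  proof -
    have hb: "has_bochner_integral lborel (\<lambda>x. g i x * indicator {s..t} x) (f i t - f i s)"
      by (rule has_bochner_integral_FTC_Icc_real[OF st(1)]) (use deriv cont in auto)
    then have int: "integrable lborel (\<lambda>x. indicator {s..t} x *\<^sub>R g i x)"
      and val: "(LINT x|lborel. indicator {s..t} x *\<^sub>R g i x) = f i t - f i s"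
      by (simp_all add: has_bochner_integral_iff mult.commute)
    \<comment> \<open>The right end of the cell already belongs to the next piece; it is discarded
      as a null set.\<close>
    have AE: "AE x in lborel. indicator {s..t} x *\<^sub>R G x = indicator {s..t} x *\<^sub>R g i x"
      using AE_lborel_singleton[of "of_int (i + 1) * h"]
    proof eventually_elim
      case (elim x)
      show ?case
      proof (cases "x \<in> {s..t}")
        case True
        then have "\<lfloor>x / h\<rfloor> = i" using elim st by (intro floor_eq) auto
        then show ?thesis by (simp add: G_def)
      qed simp
    qed
    have "continuous_on UNIV (g j)" for j
      using cont by (simp add: continuous_at_imp_continuous_on)
    then have gm [measurable]: "g j \<in> borel_measurable borel" for j
      by (rule borel_measurable_continuous_onI)
    have "(\<lambda>x. (\<lambda>j. g j x) \<lfloor>x / h\<rfloor>) \<in> borel_measurable borel"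
      by (rule measurable_compose_countable[where f = "\<lambda>j x. g j x" and g = "\<lambda>x. \<lfloor>x / h\<rfloor>"]) measurable
    then have Gm [measurable]: "G \<in> borel_measurable borel" by (simp add: G_def)
    have "integrable lborel (\<lambda>x. indicator {s..t} x *\<^sub>R G x)"
      by (subst integrable_cong_AE[OF _ _ AE]) (use int in measurable)
    moreover have "(LINT x|lborel. indicator {s..t} x *\<^sub>R G x) = (LINT x|lborel. indicator {s..t} x *\<^sub>R g i x)"
      by (rule integral_cong_AE[OF _ _ AE]) measurable
    moreover have "F t - F s = f i t - f i s"
      using F_cell[of i t] F_cell[of i s] st by simp
    ultimately show ?thesis
      unfolding Q_def set_integrable_def set_lebesgue_integral_def val by simp
  qed
  have Q_trans: "Q r t" if rst: "Q r s" "Q s t" "r \<le> s" "s \<le> t" for r s t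
  proof -
    have un: "{r..t} = {r..s} \<union> {s..t}" using rst by auto
    have i: "set_integrable lborel {r..s} G" "set_integrable lborel {s..t} G"
      using rst by (auto simp: Q_def)
    have "set_integrable lborel {r..t} G"
      unfolding un by (intro set_integrable_Un i) auto
    moreover have "(LINT x:{r..t}|lborel. G x) = (LINT x:{r..s}|lborel. G x) + (LINT x:{s..t}|lborel. G x)"
      unfolding un
    proof (rule set_integral_Un_AE[OF _ _ _ i])
      show "AE x in lborel. \<not> (x \<in> {r..s} \<and> x \<in> {s..t})"
        using AE_lborel_singleton[of s] by eventually_elim auto
    qed auto
    ultimately show ?thesis using rst unfolding Q_def by simp
  qed
  have Q_grid: "Q s t" if "of_int i * h \<le> s" "s \<le> t" "t \<le> of_int (i + int n) * h" for s t i n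
    using that
  proof (induction n arbitrary: t)
    case 0
    then have "s = t" by simp
    with 0 h show ?case
      by (intro Q_cell[of s t i]) (auto simp: algebra_simps)
  next
    case (Suc n)
    define r where "r = of_int (i + int n) * h"
    show ?case
    proof (cases "t \<le> r")
      case True
      then show ?thesis using Suc unfolding r_def by blast
    next
      case False
      have cell: "Q (max s r) t"
        by (rule Q_cell[of _ _ "i + int n"]) (use Suc.prems False in \<open>auto simp: r_def algebra_simps\<close>)
      show ?thesis
      proof (cases "s \<le> r")
        case True
        have "Q s r" by (rule Suc.IH) (use Suc.prems True in \<open>auto simp: r_def\<close>)
        then show ?thesis using cell True False by (intro Q_trans[of s r t]) auto
      next
        case False
        then show ?thesis using cell by simp
      qed
    qed
  qed
  have "Q s t" if "s \<le> t" for s t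
  proof -
    define i where "i = \<lfloor>s / h\<rfloor>"
    define n where "n = nat (\<lfloor>t / h\<rfloor> + 1 - i)"
    have "\<lfloor>s / h\<rfloor> \<le> \<lfloor>t / h\<rfloor>"
      using that h by (intro floor_mono divide_right_mono) auto
    then have "i + int n = \<lfloor>t / h\<rfloor> + 1"
      unfolding n_def i_def by simp
    then show ?thesis
      using floor_le[of s] floor_gt[of t] that
      by (intro Q_grid[of i s t n]) (simp_all add: i_def)
  qed
  then show ?thesis
    unfolding ac_deriv_def Q_def F_def G_def by blast
qed

lemma cell_mult_vec:
  "(cell x q *v v) $ 1 = hypC q x * v$1 + hypS q x * v$2"
  "(cell x q *v v) $ 2 = q * hypS q x * v$1 + hypC q x * v$2"
  by (simp_all add: cell_def matrix_vector_mult_def sum_2)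

text \<open>\<open>y i\<close> is the vector (u, u') at the left end of cell i; inside the cell it
  is propagated by the explicit solution for constant potential.\<close>

lemma step_solution:
  fixes y :: "int \<Rightarrow> real^2"
  assumes h: "h > 0" and y: "\<And>i. y (i + 1) = cell h (q i) *v y i"
  defines "u \<equiv> \<lambda>x. (cell (x - of_int \<lfloor>x / h\<rfloor> * h) (q \<lfloor>x / h\<rfloor>) *v y \<lfloor>x / h\<rfloor>) $ 1"
    and "u1 \<equiv> \<lambda>x. (cell (x - of_int \<lfloor>x / h\<rfloor> * h) (q \<lfloor>x / h\<rfloor>) *v y \<lfloor>x / h\<rfloor>) $ 2"
  shows "ac_deriv u u1" "ac_deriv u1 (\<lambda>x. q \<lfloor>x / h\<rfloor> * u x)"
proof -
  define f where "f i x = (cell (x - of_int i * h) (q i) *v y i) $ 1" for i x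
  define g where "g i x = (cell (x - of_int i * h) (q i) *v y i) $ 2" for i x
  have df: "(f i has_real_derivative g i x) (at x)"
    and dg: "(g i has_real_derivative q i * f i x) (at x)" for i x
  proof -
    have sh: "((\<lambda>x. x - of_int i * h) has_real_derivative 1) (at x)"
      by (auto intro!: derivative_eq_intros)
    have C: "((\<lambda>x. hypC (q i) (x - of_int i * h)) has_real_derivative q i * hypS (q i) (x - of_int i * h)) (at x)"
      using DERIV_chain2[OF hyp_derivs(1) sh] by simp
    have S: "((\<lambda>x. hypS (q i) (x - of_int i * h)) has_real_derivative hypC (q i) (x - of_int i * h)) (at x)"
      using DERIV_chain2[OF hyp_derivs(2) sh] by simp
    show "(f i has_real_derivative g i x) (at x)"
      unfolding f_def[abs_def] g_def cell_mult_vec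
      by (auto intro!: derivative_eq_intros C S)
    show "(g i has_real_derivative q i * f i x) (at x)"
      unfolding g_def[abs_def] f_def cell_mult_vec
      by (rule derivative_eq_intros C S refl)+ (simp add: algebra_simps)
  qed
  have "of_int (i + 1) * h - of_int i * h = h" for i
    by (simp add: algebra_simps)
  then have cell_h: "cell (of_int (i + 1) * h - of_int i * h) (q i) *v y i = y (i + 1)" for i
    unfolding y by (simp only:)
  have cell_0: "cell 0 r *v v = v" for r v
    by (simp add: vec_eq_iff forall_2 cell_mult_vec)
  have match: "f i (of_int (i + 1) * h) = f (i + 1) (of_int (i + 1) * h)"
    "g i (of_int (i + 1) * h) = g (i + 1) (of_int (i + 1) * h)" for i
    by (simp_all only: f_def g_def cell_h diff_self cell_0)
  have "ac_deriv (\<lambda>x. f \<lfloor>x / h\<rfloor> x) (\<lambda>x. g \<lfloor>x / h\<rfloor> x)"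
    by (rule ac_deriv_piecewise[OF h df DERIV_isCont[OF dg] match(1)])
  then show "ac_deriv u u1"
    unfolding u_def u1_def f_def g_def .
  have "isCont (\<lambda>x. q i * f i x) x" for i x
    by (intro continuous_intros DERIV_isCont[OF df])
  then have "ac_deriv (\<lambda>x. g \<lfloor>x / h\<rfloor> x) (\<lambda>x. q \<lfloor>x / h\<rfloor> * f \<lfloor>x / h\<rfloor> x)"
    by (rule ac_deriv_piecewise[OF h dg _ match(2)])
  then show "ac_deriv u1 (\<lambda>x. q \<lfloor>x / h\<rfloor> * u x)"
    unfolding u_def u1_def f_def g_def .
qed

text \<open>Dividing by the exponential leaves a continuous function whose absolute value is
  periodic, hence bounded. Only the absolute value is periodic, as the multiplier may be
  negative.\<close>

lemma quasi_periodic_bound: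
  fixes f :: "real \<Rightarrow> real"
  assumes "L > 0" "\<nu> \<noteq> 0" "\<And>x. f (x + L) = \<nu> * f x" "continuous_on UNIV f"
  obtains K where "\<And>x. \<bar>f x\<bar> \<le> K * exp (ln \<bar>\<nu>\<bar> / L * x)"
proof -
  define g where "g x = f x * exp (- (ln \<bar>\<nu>\<bar> / L * x))" for x
  have per: "\<bar>g (x + L)\<bar> = \<bar>g x\<bar>" for x
  proof -
    have "- (ln \<bar>\<nu>\<bar> / L * (x + L)) = - (ln \<bar>\<nu>\<bar> / L * x) - ln \<bar>\<nu>\<bar>"
      using assms(1) by (simp add: distrib_left)
    then have "exp (- (ln \<bar>\<nu>\<bar> / L * (x + L))) = exp (- (ln \<bar>\<nu>\<bar> / L * x)) / \<bar>\<nu>\<bar>"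
      using assms(2) by (simp only: exp_diff) simp
    then show ?thesis
      using assms(2,3) by (simp add: g_def abs_mult)
  qed
  have perN: "\<bar>g (x + real n * L)\<bar> = \<bar>g x\<bar>" for x n
  proof (induction n)
    case (Suc n)
    have "x + real (Suc n) * L = (x + real n * L) + L" by (simp add: algebra_simps)
    then show ?case using Suc by (simp only: per)
  qed simp
  have perZ: "\<bar>g (x + of_int j * L)\<bar> = \<bar>g x\<bar>" for x j
  proof (cases "j \<ge> 0")
    case True
    then show ?thesis using perN[of x "nat j"] by simp
  next
    case False
    then show ?thesis using perN[of "x + of_int j * L" "nat (- j)"] by simp
  qed
  have "continuous_on {0..L} g"
    unfolding g_def using assms(1,4) by (intro continuous_intros) (auto intro: continuous_on_subset)
  then have "compact (g ` {0..L})"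
    by (intro compact_continuous_image) auto
  from compact_imp_bounded[OF this] obtain B where B: "\<forall>y \<in> g ` {0..L}. norm y \<le> B"
    unfolding bounded_iff by (elim exE)
  have "\<bar>f x\<bar> \<le> B * exp (ln \<bar>\<nu>\<bar> / L * x)" for x
  proof -
    define r where "r = x + of_int (- \<lfloor>x / L\<rfloor>) * L"
    have "r \<in> {0..L}"
      using floor_divide_lower[OF assms(1), of x] floor_divide_upper[OF assms(1), of x]
      by (simp add: r_def distrib_right)
    then have "\<bar>g r\<bar> \<le> B" using B by auto
    then have "\<bar>g x\<bar> \<le> B" unfolding r_def perZ .
    then have "\<bar>f x\<bar> * exp (- (ln \<bar>\<nu>\<bar> / L * x)) \<le> B"
      by (simp add: g_def abs_mult)
    then have "\<bar>f x\<bar> * exp (- (ln \<bar>\<nu>\<bar> / L * x)) * exp (ln \<bar>\<nu>\<bar> / L * x) \<le> B * exp (ln \<bar>\<nu>\<bar> / L * x)"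
      by (intro mult_right_mono) auto
    then show ?thesis by (simp add: mult.assoc mult_exp_exp)
  qed
  then show thesis by (rule that)
qed

section \<open>Floquet multipliers, Floquet sequences and the gap of a hyperbolic step
  potential\<close>

lemma eigenvector2:
  fixes M :: "real^2^2"
  assumes "det M = 1" "\<mu>\<^sup>2 - trace M * \<mu> + 1 = 0"
  obtains v where "v \<noteq> 0" "M *v v = \<mu> *\<^sub>R v"
proof -
  have "det (M - \<mu> *\<^sub>R mat 1) = 0"
    using assms by (simp add: det_2 trace2 mat_def power2_eq_square algebra_simps)
  then have "\<not> invertible (M - \<mu> *\<^sub>R mat 1)"
    by (simp add: invertible_det_nz)
  then have "\<not> (\<forall>x. (M - \<mu> *\<^sub>R mat 1) *v x = 0 \<longrightarrow> x = 0)"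
    using matrix_left_invertible_ker invertible_left_inverse by metis
  then obtain v where v: "v \<noteq> 0" "(M - \<mu> *\<^sub>R mat 1) *v v = 0" by blast
  have "(M - \<mu> *\<^sub>R mat 1) *v v = M *v v - \<mu> *\<^sub>R v"
    by (simp add: vec_eq_iff forall_2 matrix_vector_mult_def sum_2 mat_def algebra_simps)
  with v show thesis by (intro that) auto
qed

lemma hyperbolic_eigenvalue:
  fixes \<tau> :: real
  assumes "\<bar>\<tau>\<bar> > 2"
  obtains \<mu> where "\<bar>\<mu>\<bar> < 1" "\<mu> \<noteq> 0" "\<mu>\<^sup>2 - \<tau> * \<mu> + 1 = 0" "(inverse \<mu>)\<^sup>2 - \<tau> * inverse \<mu> + 1 = 0"
proof -
  define s where "s = sqrt (\<tau>\<^sup>2 - 4)"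
  have "2\<^sup>2 < \<bar>\<tau>\<bar>\<^sup>2" using assms by (intro power_strict_mono) auto
  then have s2: "s\<^sup>2 = \<tau>\<^sup>2 - 4" unfolding s_def by simp
  have prod: "((\<tau> + s) / 2) * ((\<tau> - s) / 2) = 1"
    using s2 by (simp add: power2_eq_square algebra_simps)
  have root: "((\<tau> + s) / 2)\<^sup>2 - \<tau> * ((\<tau> + s) / 2) + 1 = 0" "((\<tau> - s) / 2)\<^sup>2 - \<tau> * ((\<tau> - s) / 2) + 1 = 0"
    using s2 by (simp_all add: power2_eq_square field_simps)
  define a where "a = (\<tau> + s) / 2"
  define b where "b = (\<tau> - s) / 2"
  have ab: "a * b = 1" "a\<^sup>2 - \<tau> * a + 1 = 0" "b\<^sup>2 - \<tau> * b + 1 = 0" "a + b = \<tau>"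
    using prod root by (simp_all add: a_def b_def field_simps)
  then have ne: "a \<noteq> 0" "b \<noteq> 0" by auto
  have inv: "inverse a = b" "inverse b = a"
    using ab(1) by (simp_all add: inverse_unique mult.commute)
  have "\<bar>a\<bar> * \<bar>b\<bar> = 1" using ab(1) by (simp flip: abs_mult)
  \<comment> \<open>The eigenvalues have product 1. If neither were inside the unit interval, both
    would have modulus 1 and their sum \<tau> modulus at most 2.\<close>
  have "\<bar>a\<bar> < 1 \<or> \<bar>b\<bar> < 1"
  proof (rule ccontr)
    assume "\<not> ?thesis"
    then have "1 \<le> \<bar>a\<bar>" "1 \<le> \<bar>b\<bar>" by auto
    then have "\<bar>a\<bar> * 1 \<le> \<bar>a\<bar> * \<bar>b\<bar>" "1 * \<bar>b\<bar> \<le> \<bar>a\<bar> * \<bar>b\<bar>"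
      by (intro mult_mono; simp)+
    then have "\<bar>a\<bar> \<le> 1" "\<bar>b\<bar> \<le> 1" using \<open>\<bar>a\<bar> * \<bar>b\<bar> = 1\<close> by auto
    then show False using ab(4) assms by linarith
  qed
  then show thesis
  proof
    assume "\<bar>a\<bar> < 1"
    then show thesis using ab ne inv by (intro that[of a]) auto
  next
    assume "\<bar>b\<bar> < 1"
    then show thesis using ab ne inv by (intro that[of b]) auto
  qed
qed

text \<open>Within a period v is propagated by partial products, and passing to another period
  multiplies by an integer power of \<mu>. Where the index wraps around, the eigenvector equation
  makes the two prescriptions agree. \<open>i0\<close> is the cell at which the period
  starts.\<close>

lemma floquet_sequence:
  fixes qs :: "real list" and i0 :: int
  assumes qs: "qs \<noteq> []" and ev: "mprod (map (cell h) qs) *v v = \<mu> *\<^sub>R v" "\<mu> \<noteq> 0"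
  defines "q \<equiv> \<lambda>i. qs ! nat ((i - i0) mod int (length qs))"
  obtains y where "\<And>i. y (i + 1) = cell h (q i) *v y i"
    "\<And>i. y (i + int (length qs)) = \<mu> *\<^sub>R y i" "y i0 = v"
proof -
  define N where "N = int (length qs)"
  have N: "N > 0" using qs by (simp add: N_def)
  define T where "T r = mprod (map (cell h) (take r qs))" for r
  define y where "y i = (\<mu> powi ((i - i0) div N)) *\<^sub>R (T (nat ((i - i0) mod N)) *v v)" for i
  have scale: "A *v (c *\<^sub>R w) = c *\<^sub>R (A *v w)" for A :: "real^2^2" and c w
    by (rule matrix_vector_mult_scaleR)
  have Suc_T: "T (Suc r) *v w = cell h (qs ! r) *v (T r *v w)" if "r < length qs" for r w
    unfolding T_def take_Suc_conv_app_nth[OF that] map_append mprod_append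
    by (simp add: matrix_vector_mul_assoc)
  show thesis
  proof (rule that[of y])
    fix i
    define j where "j = (i - i0) div N"
    define r where "r = (i - i0) mod N"
    have r: "0 \<le> r" "r < N" using N by (simp_all add: r_def)
    have i: "i - i0 = j * N + r" by (simp add: j_def r_def)
    have q: "q i = qs ! nat r" unfolding q_def r_def N_def ..
    have step: "cell h (q i) *v y i = (\<mu> powi j) *\<^sub>R (T (Suc (nat r)) *v v)"
      using r Suc_T[of "nat r"] unfolding y_def j_def[symmetric] r_def[symmetric] scale q
      by (simp add: N_def)
    show "y (i + 1) = cell h (q i) *v y i"
    proof (cases "r + 1 < N")
      case True
      have e: "i + 1 - i0 = N * j + (r + 1)" using i by (simp add: mult.commute)
      have "(i + 1 - i0) div N = j" "(i + 1 - i0) mod N = r + 1"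
        using r True by (auto intro: int_div_pos_eq[OF e] int_mod_pos_eq[OF e])
      moreover have "nat (r + 1) = Suc (nat r)" using r by simp
      ultimately show ?thesis unfolding step by (simp add: y_def)
    next
      case False
      then have rN: "r + 1 = N" using r by simp
      have "i + 1 - i0 = (j + 1) * N" using i rN by (simp add: algebra_simps)
      then have "(i + 1 - i0) div N = j + 1" "(i + 1 - i0) mod N = 0"
        using N by simp_all
      moreover have "Suc (nat r) = length qs" using rN r by (simp add: N_def)
      ultimately show ?thesis
        unfolding step using ev by (simp add: y_def T_def power_int_add)
    qed
  next
    fix i
    have "i + N - i0 = (i - i0) + N" by simp
    then have "(i + N - i0) div N = (i - i0) div N + 1" "(i + N - i0) mod N = (i - i0) mod N"
      using N by (simp_all only: div_add_self2 mod_add_self2)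
    then show "y (i + int (length qs)) = \<mu> *\<^sub>R y i"
      using ev(2) unfolding N_def[symmetric] y_def by (simp add: power_int_add mult.commute)
  next
    show "y i0 = v" by (simp add: y_def T_def)
  qed
qed

theorem hyperbolic_step_potential_gap:
  fixes qs :: "real list" and i0 :: int
  assumes h: "h > 0" and qs: "qs \<noteq> []" and hyp: "\<bar>trace (mprod (map (cell h) qs))\<bar> > 2"
    and V: "\<And>x. V x - E = qs ! nat ((\<lfloor>x / h\<rfloor> - i0) mod int (length qs))"
  shows "E \<notin> spec (schroedinger V)"
proof -
  define M where "M = mprod (map (cell h) qs)"
  have detM: "det M = 1" unfolding M_def by (rule det_mprod) auto
  define N where "N = int (length qs)"
  define L where "L = of_int N * h"
  have N: "N > 0" using qs by (simp add: N_def)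
  have L: "L > 0" using N h by (simp add: L_def)
  define q where "q i = qs ! nat ((i - i0) mod N)" for i
  have q_per: "q (i + N) = q i" for i
  proof -
    have "i + N - i0 = (i - i0) + N" by simp
    then show ?thesis unfolding q_def by (simp only: mod_add_self2)
  qed
  have Vq: "V x - E = q \<lfloor>x / h\<rfloor>" for x
    unfolding V q_def N_def ..
  obtain \<mu> where mu: "\<bar>\<mu>\<bar> < 1" "\<mu> \<noteq> 0" "\<mu>\<^sup>2 - trace M * \<mu> + 1 = 0" "(inverse \<mu>)\<^sup>2 - trace M * inverse \<mu> + 1 = 0"
    using hyperbolic_eigenvalue[OF hyp] unfolding M_def by blast
  obtain v where v: "v \<noteq> 0" "M *v v = \<mu> *\<^sub>R v"
    using eigenvector2[OF detM mu(3)] by blast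
  obtain w where w: "w \<noteq> 0" "M *v w = inverse \<mu> *\<^sub>R w"
    using eigenvector2[OF detM mu(4)] by blast
  have mu2: "\<mu>\<^sup>2 < 1"
    using mu(1) by (simp add: abs_square_less_1)
  \<comment> \<open>Eigenvectors for different eigenvalues are independent. Their determinant is the
    Wronskian of the two Floquet solutions at the start of the period, hence the Wronskian
    everywhere.\<close>
  have indep: "v$1 * w$2 - v$2 * w$1 \<noteq> 0"
  proof
    assume 0: "v$1 * w$2 - v$2 * w$1 = 0"
    have "\<exists>s. w = s *\<^sub>R v"
    proof (cases "v$1 = 0")
      case True
      then have "v$2 \<noteq> 0" using v(1) by (simp add: vec_eq_iff forall_2)
      then show ?thesis using 0 True
        by (intro exI[of _ "w$2 / v$2"]) (simp add: vec_eq_iff forall_2)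
    next
      case False
      then show ?thesis using 0
        by (intro exI[of _ "w$1 / v$1"]) (simp add: vec_eq_iff forall_2 field_simps)
    qed
    then obtain s where s: "w = s *\<^sub>R v" by blast
    have "inverse \<mu> *\<^sub>R w = M *v (s *\<^sub>R v)" using w(2) s by simp
    also have "\<dots> = s *\<^sub>R (\<mu> *\<^sub>R v)"
      unfolding matrix_vector_mult_scaleR v(2) ..
    also have "\<dots> = \<mu> *\<^sub>R w" by (simp add: s mult.commute)
    finally have "inverse \<mu> = \<mu>" using w(1) by simp
    then have "\<mu>\<^sup>2 = 1" using mu(2) by (metis power2_eq_square right_inverse)
    with mu2 show False by simp
  qed
  obtain y where y: "\<And>i. y (i + 1) = cell h (q i) *v y i" "\<And>i. y (i + N) = \<mu> *\<^sub>R y i" "y i0 = v"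
    using floquet_sequence[OF qs v(2)[unfolded M_def] mu(2), of i0] unfolding q_def N_def by blast
  have imu: "inverse \<mu> \<noteq> 0" using mu(2) by simp
  obtain z where z: "\<And>i. z (i + 1) = cell h (q i) *v z i" "\<And>i. z (i + N) = inverse \<mu> *\<^sub>R z i" "z i0 = w"
    using floquet_sequence[OF qs w(2)[unfolded M_def] imu, of i0] unfolding q_def N_def by blast
  define sol where "sol Y x = cell (x - of_int \<lfloor>x / h\<rfloor> * h) (q \<lfloor>x / h\<rfloor>) *v Y \<lfloor>x / h\<rfloor>"
    for Y :: "int \<Rightarrow> real^2" and x
  have shift: "sol Y (x + L) = \<nu> *\<^sub>R sol Y x" if "\<And>i. Y (i + N) = \<nu> *\<^sub>R Y i" for Y \<nu> x
  proof -
    have "(x + L) / h = x / h + of_int N" using h by (simp add: L_def add_divide_distrib)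
    then have fl: "\<lfloor>(x + L) / h\<rfloor> = \<lfloor>x / h\<rfloor> + N" by simp
    have arg: "x + L - of_int (\<lfloor>x / h\<rfloor> + N) * h = x - of_int \<lfloor>x / h\<rfloor> * h"
      by (simp add: L_def algebra_simps)
    show ?thesis
      unfolding sol_def fl q_per that arg by (rule matrix_vector_mult_scaleR)
  qed
  define p where "p x = sol y x $ 1" for x
  define p1 where "p1 x = sol y x $ 2" for x
  define m where "m x = sol z x $ 1" for x
  define m1 where "m1 x = sol z x $ 2" for x
  have p: "ac_deriv p p1" "ac_deriv p1 (\<lambda>x. (V x - E) * p x)"
    unfolding p_def p1_def sol_def Vq by (fact step_solution[where y = y and q = q, OF h y(1)])+
  have m: "ac_deriv m m1" "ac_deriv m1 (\<lambda>x. (V x - E) * m x)"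
    unfolding m_def m1_def sol_def Vq by (fact step_solution[where y = z and q = q, OF h z(1)])+
  define W where "W x = p x * m1 x - p1 x * m x" for x
  have W_const: "W x = W 0" for x
  proof (rule ac_deriv_AE_zero_const)
    show "ac_deriv W (\<lambda>x. (p1 x * m1 x + p x * ((V x - E) * m x)) - ((V x - E) * p x * m x + p1 x * m1 x))"
      unfolding W_def by (intro ac_deriv_diff ac_deriv_mult p m)
  qed simp
  have cell_0: "cell 0 r *v v = v" for r v
    by (simp add: vec_eq_iff forall_2 cell_mult_vec)
  have "sol y (of_int i0 * h) = v" "sol z (of_int i0 * h) = w"
    using h by (simp_all add: sol_def cell_0 y(3) z(3))
  then have "W (of_int i0 * h) = v$1 * w$2 - v$2 * w$1"
    by (simp add: W_def p_def p1_def m_def m1_def)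
  with indep W_const have W0: "W 0 \<noteq> 0" by metis
  \<comment> \<open>Rescaling m by c normalises the Wronskian to 1.\<close>
  define c where "c = inverse (W 0)"
  have c: "ac_deriv (\<lambda>x. c) (\<lambda>x. 0)"
    by (simp add: ac_deriv_def set_integrable_def set_lebesgue_integral_def)
  define \<kappa> where "\<kappa> = - ln \<bar>\<mu>\<bar> / L"
  have kappa: "\<kappa> > 0"
    unfolding \<kappa>_def using mu L by (simp add: divide_neg_pos)
  have p_shift: "p (x + L) = \<mu> * p x" and m_shift: "m (x + L) = inverse \<mu> * m x" for x
    unfolding p_def m_def using shift[of y \<mu> x] shift[of z "inverse \<mu>" x] y(2) z(2) by simp_all
  obtain K1 where "\<And>x. \<bar>p x\<bar> \<le> K1 * exp (ln \<bar>\<mu>\<bar> / L * x)"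
    using quasi_periodic_bound[OF L mu(2) p_shift ac_deriv_continuous[OF p(1)]] by blast
  then have K1: "\<bar>p x\<bar> \<le> K1 * exp (- \<kappa> * x)" for x
    by (simp add: \<kappa>_def)
  obtain K2 where "\<And>x. \<bar>m x\<bar> \<le> K2 * exp (ln \<bar>inverse \<mu>\<bar> / L * x)"
    using quasi_periodic_bound[OF L imu m_shift ac_deriv_continuous[OF m(1)]] by blast
  moreover have "ln \<bar>inverse \<mu>\<bar> / L = \<kappa>"
    using mu(2) by (simp add: \<kappa>_def abs_inverse ln_inverse)
  ultimately have K2: "\<bar>m x\<bar> \<le> K2 * exp (\<kappa> * x)" for x
    by (simp only:)
  define K where "K = max K1 (\<bar>c\<bar> * K2)"
  interpret dichotomy V E p p1 "\<lambda>x. c * m x" "\<lambda>x. c * m1 x" K \<kappa> L \<mu>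
  proof
    show "ac_deriv (\<lambda>x. c * m x) (\<lambda>x. c * m1 x)"
      using ac_deriv_mult[OF c m(1)] by simp
    show "ac_deriv (\<lambda>x. c * m1 x) (\<lambda>x. (V x - E) * (c * m x))"
      using ac_deriv_mult[OF c m(2)] by (simp add: mult.left_commute)
    show "p x * (c * m1 x) - p1 x * (c * m x) = 1" for x
    proof -
      have "p x * (c * m1 x) - p1 x * (c * m x) = c * W x"
        by (simp add: W_def algebra_simps)
      also have "\<dots> = 1" using W_const[of x] W0 by (simp add: c_def)
      finally show ?thesis .
    qed
    show "\<bar>p x\<bar> \<le> K * exp (- \<kappa> * x)" for x
      by (rule order_trans[OF K1]) (auto simp: K_def intro!: mult_right_mono)
    show "\<bar>c * m x\<bar> \<le> K * exp (\<kappa> * x)" for x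
    proof -
      have "\<bar>c * m x\<bar> \<le> \<bar>c\<bar> * (K2 * exp (\<kappa> * x))"
        unfolding abs_mult by (intro mult_left_mono K2) simp
      also have "\<dots> \<le> K * exp (\<kappa> * x)"
        unfolding mult.assoc[symmetric] by (intro mult_right_mono) (auto simp: K_def)
      finally show ?thesis .
    qed
    show "c * m (x + L) = inverse \<mu> * (c * m x)" for x
      by (simp add: m_shift)
  qed (use kappa p p_shift mu mu2 in auto)
  show ?thesis by (rule not_in_spec)
qed


section \<open>Density of step functions\<close>

lemma abs_l2_add: "sq_integrable f \<Longrightarrow> sq_integrable g \<Longrightarrow> abs_l2 (\<lambda>x. f x + g x) = abs_l2 f + abs_l2 g"
  by (rule plus_l2.abs_eq[symmetric]) (simp_all add: l2_eq_def)

lemma abs_l2_scaleR: "sq_integrable f \<Longrightarrow> abs_l2 (\<lambda>x. r * f x) = r *\<^sub>R abs_l2 f"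
  by (rule scaleR_l2.abs_eq[symmetric]) (simp add: l2_eq_def)

lemma abs_l2_diff:
  assumes "sq_integrable f" "sq_integrable g"
  shows "abs_l2 (\<lambda>x. f x - g x) = abs_l2 f - abs_l2 g"
  using abs_l2_add[OF assms(1) sq_integrable_scale[OF assms(2), of "-1"]] abs_l2_scaleR[OF assms(2), of "-1"]
  by simp

lemma norm_abs_l2_le:
  assumes "sq_integrable f" "integrable lborel w" "\<And>x. (f x)\<^sup>2 \<le> w x" "(\<integral>x. w x \<partial>lborel) \<le> B"
  shows "norm (abs_l2 f) \<le> sqrt B"
proof -
  have "(\<integral>x. (f x)\<^sup>2 \<partial>lborel) \<le> (\<integral>x. w x \<partial>lborel)"
    using assms(1-3) by (intro integral_mono) (auto simp: sq_integrable_def)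
  then show ?thesis
    unfolding norm_abs_l2[OF assms(1)] using assms(4) by simp
qed

definition step_fun :: "real \<Rightarrow> nat \<Rightarrow> (nat \<Rightarrow> real) \<Rightarrow> real \<Rightarrow> real" where
  "step_fun a N c x = indicator {0..<a} x * c (nat \<lfloor>x * real N / a\<rfloor>)"

lemma step_fun_measurable [measurable]: "step_fun a N c \<in> borel_measurable borel"
proof -
  have "(\<lambda>x. (\<lambda>j. c (nat j)) \<lfloor>x * real N / a\<rfloor>) \<in> borel_measurable borel"
    by (rule measurable_compose_countable[where f = "\<lambda>j x. c (nat j)" and g = "\<lambda>x. \<lfloor>x * real N / a\<rfloor>"]) measurable
  then show ?thesis unfolding step_fun_def by measurable
qed

lemma step_index:
  assumes "a > 0" "N \<ge> 1" "0 \<le> x" "x < a"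
  shows "nat \<lfloor>x * real N / a\<rfloor> < N"
proof -
  have "x * real N / a < real N" using assms by (simp add: field_simps)
  then show ?thesis using assms by (simp add: floor_less_iff nat_less_iff)
qed

lemma sq_integrable_bounded_support:
  assumes "g \<in> borel_measurable borel" "\<And>x. \<bar>g x\<bar> \<le> C * indicator {0..<a::real} x"
  shows "sq_integrable g"
proof (rule sq_integrable_bound[OF _ assms(1)])
  have "integrable lborel (\<lambda>x. indicator {0..<a} x :: real)"
    by (cases "0 \<le> a") (auto intro!: integrable_real_indicator)
  moreover have "(\<lambda>x. (indicator {0..<a} x :: real)\<^sup>2) = (\<lambda>x. indicator {0..<a} x)"
    by (auto simp: indicator_def)
  ultimately show "sq_integrable (indicator {0..<a} :: real \<Rightarrow> real)"
    unfolding sq_integrable_def by simp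
  show "\<bar>g x\<bar> \<le> C * \<bar>indicator {0..<a} x\<bar>" for x
    using assms(2)[of x] by simp
qed

lemma step_fun_sq_integrable:
  assumes "a > 0" "N \<ge> 1"
  shows "sq_integrable (step_fun a N c)"
proof (rule sq_integrable_bounded_support[OF step_fun_measurable, where a = a])
  fix x
  show "\<bar>step_fun a N c x\<bar> \<le> (\<Sum>k<N. \<bar>c k\<bar>) * indicator {0..<a} x"
  proof (cases "x \<in> {0..<a}")
    case True
    then have "nat \<lfloor>x * real N / a\<rfloor> < N" using step_index[OF assms] by simp
    then have "\<bar>c (nat \<lfloor>x * real N / a\<rfloor>)\<bar> \<le> (\<Sum>k<N. \<bar>c k\<bar>)"
      by (intro member_le_sum[of _ _ "\<lambda>k. \<bar>c k\<bar>"]) auto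
    then show ?thesis using True by (simp add: step_fun_def)
  qed (simp add: step_fun_def)
qed

lemma step_fun_close:
  assumes "a > 0" "N \<ge> 1" "\<And>k. \<bar>c k - c' k\<bar> \<le> \<delta>"
  shows "norm (abs_l2 (step_fun a N c) - abs_l2 (step_fun a N c')) \<le> \<delta> * sqrt a"
proof -
  note sq = step_fun_sq_integrable[OF assms(1,2)]
  have d: "0 \<le> \<delta>" using assms(3)[of 0] by linarith
  have "norm (abs_l2 (\<lambda>x. step_fun a N c x - step_fun a N c' x)) \<le> sqrt (\<delta>\<^sup>2 * a)"
  proof (rule norm_abs_l2_le[where w = "\<lambda>x. \<delta>\<^sup>2 * indicator {0..<a} x"])
    show "sq_integrable (\<lambda>x. step_fun a N c x - step_fun a N c' x)"
      by (intro sq_integrable_diff sq)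
    show "integrable lborel (\<lambda>x. \<delta>\<^sup>2 * indicator {0..<a} x)"
      by (intro integrable_mult_right integrable_real_indicator) (use assms(1) in auto)
    show "(step_fun a N c x - step_fun a N c' x)\<^sup>2 \<le> \<delta>\<^sup>2 * indicator {0..<a} x" for x
      using assms(3) d by (auto simp: step_fun_def indicator_def abs_le_square_iff[symmetric])
    show "(\<integral>x. \<delta>\<^sup>2 * indicator {0..<a} x \<partial>lborel) \<le> \<delta>\<^sup>2 * a"
      using assms(1) by simp
  qed
  then show ?thesis
    using d by (simp add: abs_l2_diff[OF sq sq] real_sqrt_mult)
qed

text \<open>Subdividing every cell into k equal ones repeats each value k times. This brings
  finitely many step functions to a common grid.\<close>

lemma step_fun_refine:
  assumes "a > 0" "k \<ge> 1"
  shows "step_fun a (N * k) (\<lambda>i. c (i div k)) = step_fun a N c"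
proof
  fix x
  show "step_fun a (N * k) (\<lambda>i. c (i div k)) x = step_fun a N c x"
  proof (cases "x \<in> {0..<a}")
    case True
    have "\<lfloor>x * real N / a\<rfloor> = \<lfloor>x * real (N * k) / a / real_of_int (int k)\<rfloor>"
      using assms by simp
    also have "\<dots> = \<lfloor>x * real (N * k) / a\<rfloor> div int k"
      by (rule floor_divide_real_eq_div) simp
    finally have "nat \<lfloor>x * real N / a\<rfloor> = nat \<lfloor>x * real (N * k) / a\<rfloor> div k"
      using True assms by (simp add: nat_div_distrib)
    then show ?thesis by (simp add: step_fun_def)
  qed (simp add: step_fun_def)
qed

locale step_approximation =
  fixes a :: real
  assumes a: "a > 0"
begin

definition steps :: "l2 set" where
  "steps = {abs_l2 (step_fun a N c) |N c. N \<ge> 1}"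

lemma steps_add:
  assumes "s \<in> steps" "t \<in> steps"
  shows "s + t \<in> steps"
proof -
  obtain M c N d where s: "s = abs_l2 (step_fun a M c)" "M \<ge> 1" and t: "t = abs_l2 (step_fun a N d)" "N \<ge> 1"
    using assms unfolding steps_def by blast
  have s': "s = abs_l2 (step_fun a (M * N) (\<lambda>i. c (i div N)))"
    using step_fun_refine[OF a t(2), of M c] s by simp
  have t': "t = abs_l2 (step_fun a (M * N) (\<lambda>i. d (i div M)))"
    using step_fun_refine[OF a s(2), of N d] t by (simp add: mult.commute)
  have MN: "M * N \<ge> 1" using s t by simp
  have "s + t = abs_l2 (\<lambda>x. step_fun a (M * N) (\<lambda>i. c (i div N)) x + step_fun a (M * N) (\<lambda>i. d (i div M)) x)"
    unfolding s' t' by (rule abs_l2_add[symmetric]; rule step_fun_sq_integrable[OF a MN])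
  also have "(\<lambda>x. step_fun a (M * N) (\<lambda>i. c (i div N)) x + step_fun a (M * N) (\<lambda>i. d (i div M)) x)
      = step_fun a (M * N) (\<lambda>i. c (i div N) + d (i div M))"
    by (simp add: step_fun_def fun_eq_iff distrib_left)
  finally show ?thesis using MN unfolding steps_def by blast
qed

lemma steps_scaleR:
  assumes "s \<in> steps"
  shows "r *\<^sub>R s \<in> steps"
proof -
  obtain M c where s: "s = abs_l2 (step_fun a M c)" "M \<ge> 1"
    using assms unfolding steps_def by blast
  have "r *\<^sub>R s = abs_l2 (\<lambda>x. r * step_fun a M c x)"
    unfolding s by (rule abs_l2_scaleR[symmetric, OF step_fun_sq_integrable[OF a s(2)]])
  also have "(\<lambda>x. r * step_fun a M c x) = step_fun a M (\<lambda>i. r * c i)"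
    by (simp add: step_fun_def fun_eq_iff mult.left_commute)
  finally show ?thesis using s(2) unfolding steps_def by blast
qed

text \<open>A property of functions and not of classes, so that pointwise limits and the inductions
  over Borel sets and Borel functions apply directly.\<close>

definition approximable :: "(real \<Rightarrow> real) \<Rightarrow> bool" where
  "approximable f \<longleftrightarrow> sq_integrable f \<and> (\<forall>\<epsilon>>0. \<exists>s\<in>steps. norm (abs_l2 f - s) < \<epsilon>)"

lemma approximable_sq: "approximable f \<Longrightarrow> sq_integrable f"
  by (simp add: approximable_def)

lemma approximable_add:
  assumes "approximable f" "approximable g"
  shows "approximable (\<lambda>x. f x + g x)"
  unfolding approximable_def
proof (intro conjI allI impI)
  note sq = assms[THEN approximable_sq]
  show "sq_integrable (\<lambda>x. f x + g x)" by (intro sq_integrable_add sq)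
  fix \<epsilon> :: real assume "\<epsilon> > 0"
  then have "\<epsilon> / 2 > 0" by simp
  obtain s where s: "s \<in> steps" "norm (abs_l2 f - s) < \<epsilon> / 2"
    using assms(1) \<open>\<epsilon> / 2 > 0\<close> unfolding approximable_def by blast
  obtain t where t: "t \<in> steps" "norm (abs_l2 g - t) < \<epsilon> / 2"
    using assms(2) \<open>\<epsilon> / 2 > 0\<close> unfolding approximable_def by blast
  have "norm ((abs_l2 f + abs_l2 g) - (s + t)) < \<epsilon>"
    using norm_diff_triangle_ineq[of "abs_l2 f" "abs_l2 g" s t] s(2) t(2) by linarith
  then show "\<exists>s\<in>steps. norm (abs_l2 (\<lambda>x. f x + g x) - s) < \<epsilon>"
    unfolding abs_l2_add[OF sq] using steps_add[OF s(1) t(1)] by blast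
qed

lemma approximable_scale:
  assumes "approximable f"
  shows "approximable (\<lambda>x. r * f x)"
  unfolding approximable_def
proof (intro conjI allI impI)
  note sq = assms[THEN approximable_sq]
  show "sq_integrable (\<lambda>x. r * f x)" by (intro sq_integrable_scale sq)
  fix \<epsilon> :: real assume e: "\<epsilon> > 0"
  then have "\<epsilon> / (\<bar>r\<bar> + 1) > 0" by simp
  then obtain s where s: "s \<in> steps" "norm (abs_l2 f - s) < \<epsilon> / (\<bar>r\<bar> + 1)"
    using assms unfolding approximable_def by blast
  have "norm (r *\<^sub>R abs_l2 f - r *\<^sub>R s) = \<bar>r\<bar> * norm (abs_l2 f - s)"
    unfolding scaleR_diff_right[symmetric] by simp
  also have "\<dots> \<le> \<bar>r\<bar> * (\<epsilon> / (\<bar>r\<bar> + 1))"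
    using s(2) by (intro mult_left_mono) auto
  also have "\<dots> < \<epsilon>" using e by (simp add: field_simps)
  finally show "\<exists>s\<in>steps. norm (abs_l2 (\<lambda>x. r * f x) - s) < \<epsilon>"
    unfolding abs_l2_scaleR[OF sq] using steps_scaleR[OF s(1)] by blast
qed

lemma approximable_diff:
  assumes "approximable f" "approximable g"
  shows "approximable (\<lambda>x. f x - g x)"
  using approximable_add[OF assms(1) approximable_scale[OF assms(2), of "-1"]] by simp

lemma approximable_limit:
  assumes "\<And>i::nat. approximable (F i)" "sq_integrable f"
    and "\<And>x. (\<lambda>i. F i x) \<longlonglongrightarrow> f x"
    and "\<And>i x. \<bar>f x - F i x\<bar> \<le> w x" "sq_integrable w"
  shows "approximable f"
  unfolding approximable_def
proof (intro conjI allI impI)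
  fix \<epsilon> :: real assume e: "\<epsilon> > 0"
  have [measurable]: "f \<in> borel_measurable borel" "F i \<in> borel_measurable borel" for i
    using assms(2) approximable_sq[OF assms(1)] by (auto simp: sq_integrable_def)
  have "(\<lambda>i. \<integral>x. (f x - F i x)\<^sup>2 \<partial>lborel) \<longlonglongrightarrow> (\<integral>x. 0 \<partial>(lborel :: real measure))"
  proof (rule integral_dominated_convergence[where w = "\<lambda>x. (w x)\<^sup>2"])
    show "integrable lborel (\<lambda>x. (w x)\<^sup>2)" using assms(5) by (simp add: sq_integrable_def)
    show "AE x in lborel. (\<lambda>i. (f x - F i x)\<^sup>2) \<longlonglongrightarrow> 0"
    proof (rule AE_I2)
      fix x
      have "(\<lambda>i. (f x - F i x)\<^sup>2) \<longlonglongrightarrow> (f x - f x)\<^sup>2"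
        by (intro tendsto_intros assms(3))
      then show "(\<lambda>i. (f x - F i x)\<^sup>2) \<longlonglongrightarrow> 0" by simp
    qed
    show "AE x in lborel. norm ((f x - F i x)\<^sup>2) \<le> (w x)\<^sup>2" for i
    proof (rule AE_I2)
      fix x
      have "\<bar>f x - F i x\<bar>\<^sup>2 \<le> (w x)\<^sup>2"
        using assms(4)[of x i] by (intro power_mono) auto
      then show "norm ((f x - F i x)\<^sup>2) \<le> (w x)\<^sup>2" by simp
    qed
  qed measurable
  then have "(\<lambda>i. sqrt (\<integral>x. (f x - F i x)\<^sup>2 \<partial>lborel)) \<longlonglongrightarrow> sqrt 0"
    by (intro tendsto_real_sqrt) simp
  moreover have "sqrt (\<integral>x. (f x - F i x)\<^sup>2 \<partial>lborel) = norm (abs_l2 f - abs_l2 (F i))" for i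
    using norm_abs_l2[OF sq_integrable_diff[OF assms(2) approximable_sq[OF assms(1)]], of i]
      abs_l2_diff[OF assms(2) approximable_sq[OF assms(1)], of i] by simp
  ultimately have "(\<lambda>i. norm (abs_l2 f - abs_l2 (F i))) \<longlonglongrightarrow> 0" by simp
  then have "\<forall>\<^sub>F i in sequentially. norm (abs_l2 f - abs_l2 (F i)) < \<epsilon> / 2"
    by (rule order_tendstoD) (use e in simp)
  then obtain i where i: "norm (abs_l2 f - abs_l2 (F i)) < \<epsilon> / 2"
    by (auto simp: eventually_sequentially)
  obtain s where s: "s \<in> steps" "norm (abs_l2 (F i) - s) < \<epsilon> / 2"
    using assms(1)[of i] e half_gt_zero[OF e] unfolding approximable_def by blast
  have "norm (abs_l2 f - s) < \<epsilon>"
    using norm_triangle_ineq[of "abs_l2 f - abs_l2 (F i)" "abs_l2 (F i) - s"] i s(2) by simp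
  with s(1) show "\<exists>s\<in>steps. norm (abs_l2 f - s) < \<epsilon>" by blast
qed (rule assms(2))

lemma indicator_sq: "B \<in> sets borel \<Longrightarrow> sq_integrable (indicator (B \<inter> {0..<a}) :: real \<Rightarrow> real)"
  by (rule sq_integrable_bounded_support[where C = 1 and a = a]) (auto simp: indicator_def)

lemma approximable_whole: "approximable (indicator {0..<a})"
proof -
  have "step_fun a 1 (\<lambda>_. 1) = indicator {0..<a}"
    by (simp add: step_fun_def fun_eq_iff)
  then have "abs_l2 (indicator {0..<a}) \<in> steps"
    unfolding steps_def by (intro CollectI exI[of _ 1] exI[of _ "\<lambda>_. 1"]) simp
  then have "\<forall>\<epsilon>>0. \<exists>s\<in>steps. norm (abs_l2 (indicator {0..<a}) - s) < \<epsilon>"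
    by (intro allI impI bexI[of _ "abs_l2 (indicator {0..<a})"]) simp_all
  then show ?thesis
    using indicator_sq[of UNIV] by (simp add: approximable_def)
qed

text \<open>Rounding b down to a grid point changes the indicator on a single cell of length h only,
  at distance at most \<open>sqrt h\<close>.\<close>

lemma approximable_interval: "approximable (indicator ({..<b} \<inter> {0..<a}))"
  unfolding approximable_def
proof (intro conjI allI impI)
  show sq: "sq_integrable (indicator ({..<b} \<inter> {0..<a}) :: real \<Rightarrow> real)"
    by (rule indicator_sq) simp
  fix \<epsilon> :: real assume e: "\<epsilon> > 0"
  \<comment> \<open>The choice makes the cell length smaller than the square of \<epsilon>.\<close>
  obtain N where N: "real N > a / \<epsilon>\<^sup>2" using reals_Archimedean2 by blast
  then have Npos: "N \<ge> 1"
    using a e by (cases N) (auto simp: field_simps)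
  define h where "h = a / real N"
  have h: "h > 0" using a Npos by (simp add: h_def)
  define k where "k = \<lfloor>b / h\<rfloor>"
  define c where "c i = (if int i < k then 1 else 0 :: real)" for i
  have sq': "sq_integrable (step_fun a N c)" by (rule step_fun_sq_integrable[OF a Npos])
  have "norm (abs_l2 (\<lambda>x. indicator ({..<b} \<inter> {0..<a}) x - step_fun a N c x)) \<le> sqrt h"
  proof (rule norm_abs_l2_le[where w = "indicator {of_int k * h..of_int k * h + h}"])
    show "sq_integrable (\<lambda>x. indicator ({..<b} \<inter> {0..<a}) x - step_fun a N c x)"
      by (intro sq_integrable_diff sq sq')
    show "integrable lborel (indicator {of_int k * h..of_int k * h + h} :: real \<Rightarrow> real)"
      by (intro integrable_real_indicator) (use h in auto)
    show "(\<integral>x. indicator {of_int k * h..of_int k * h + h} x \<partial>lborel) \<le> h"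
      using h by simp
    fix x
    have fl: "of_int k * h \<le> b" "b < of_int k * h + h"
      using floor_divide_lower[OF h, of b] floor_divide_upper[OF h, of b] by (simp_all add: k_def distrib_right)
    have idx: "int (nat \<lfloor>x * real N / a\<rfloor>) < k \<longleftrightarrow> x < of_int k * h" if "x \<in> {0..<a}"
    proof -
      have "x * real N / a = x / h" by (simp add: h_def)
      moreover have "0 \<le> \<lfloor>x / h\<rfloor>" using that h by simp
      moreover have "\<lfloor>x / h\<rfloor> < k \<longleftrightarrow> x < of_int k * h"
        using h by (simp add: floor_less_iff pos_divide_less_eq)
      ultimately show ?thesis by simp
    qed
    show "(indicator ({..<b} \<inter> {0..<a}) x - step_fun a N c x)\<^sup>2 \<le> indicator {of_int k * h..of_int k * h + h} x"
      using idx fl by (auto simp: step_fun_def c_def indicator_def)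
  qed
  also have "sqrt h < \<epsilon>"
  proof (rule real_less_lsqrt)
    have "a < real N * \<epsilon>\<^sup>2" using N e by (simp add: field_simps)
    then show "h < \<epsilon>\<^sup>2" unfolding h_def using Npos by (simp add: field_simps)
  qed (use e h in auto)
  finally have "norm (abs_l2 (indicator ({..<b} \<inter> {0..<a})) - abs_l2 (step_fun a N c)) < \<epsilon>"
    unfolding abs_l2_diff[OF sq sq'] .
  then show "\<exists>s\<in>steps. norm (abs_l2 (indicator ({..<b} \<inter> {0..<a})) - s) < \<epsilon>"
    using Npos unfolding steps_def by blast
qed

text \<open>Open half-lines generate the Borel sets and are stable under intersection, so it
  suffices that the approximable sets form a Dynkin system. Countable disjoint unions are limits of
  finite ones, dominated by the indicator of the whole interval.\<close>

lemma approximable_set: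
  assumes "B \<in> sets borel"
  shows "approximable (indicator (B \<inter> {0..<a}))"
proof -
  have sets: "sets borel = sigma_sets UNIV (range (lessThan :: real \<Rightarrow> _))"
    unfolding borel_Iio by (rule sets_measure_of) simp
  have "Int_stable (range (lessThan :: real \<Rightarrow> _))"
  proof (rule Int_stableI)
    fix A B :: "real set" assume "A \<in> range lessThan" "B \<in> range lessThan"
    then obtain x y where "A = {..<x}" "B = {..<y}" by blast
    then have "A \<inter> B = {..<min x y}" by auto
    then show "A \<inter> B \<in> range lessThan" by blast
  qed
  moreover have "range (lessThan :: real \<Rightarrow> _) \<subseteq> Pow UNIV" by simp
  moreover have "B \<in> sigma_sets UNIV (range lessThan)" using assms by (simp add: sets)
  ultimately show ?thesis
  proof (induction rule: sigma_sets_induct_disjoint)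
    case (basic A)
    then show ?case using approximable_interval by auto
  next
    case empty
    show ?case using approximable_scale[OF approximable_whole, of 0] by (simp add: indicator_def)
  next
    case (compl A)
    have "indicator ((UNIV - A) \<inter> {0..<a}) = (\<lambda>x. indicator {0..<a} x - indicator (A \<inter> {0..<a}) x :: real)"
      by (auto simp: indicator_def fun_eq_iff)
    then show ?case using approximable_diff[OF approximable_whole compl(2)] by simp
  next
    case (union A)
    have "A i \<in> sets borel" for i :: nat
      using union(2) by (auto simp: sets)
    then have meas: "(\<Union>i. A i) \<in> sets borel" by auto
    have fin: "approximable (indicator ((\<Union>i<n. A i) \<inter> {0..<a}))" for n
    proof (induction n)
      case 0
      show ?case using approximable_scale[OF approximable_whole, of 0] by (simp add: indicator_def)
    next
      case (Suc n)
      have "A i \<inter> A n = {}" if "i < n" for i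
        using union(1) that by (auto simp: disjoint_family_on_def)
      then have "indicator ((\<Union>i<Suc n. A i) \<inter> {0..<a})
          = (\<lambda>x. indicator ((\<Union>i<n. A i) \<inter> {0..<a}) x + indicator (A n \<inter> {0..<a}) x :: real)"
        by (auto simp: indicator_def fun_eq_iff lessThan_Suc)
      then show ?case using approximable_add[OF Suc union(3)[of n]] by simp
    qed
    show ?case
    proof (rule approximable_limit[OF fin indicator_sq[OF meas]])
      show "sq_integrable (indicator {0..<a} :: real \<Rightarrow> real)"
        using approximable_whole by (rule approximable_sq)
      show "\<bar>indicator ((\<Union>i. A i) \<inter> {0..<a}) x - indicator ((\<Union>i<n. A i) \<inter> {0..<a}) x\<bar> \<le> (indicator {0..<a} x :: real)" for n x
        by (auto simp: indicator_def)
      show "(\<lambda>n. indicator ((\<Union>i<n. A i) \<inter> {0..<a}) x) \<longlonglongrightarrow> (indicator ((\<Union>i. A i) \<inter> {0..<a}) x :: real)" for x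
      proof (cases "x \<in> (\<Union>i. A i)")
        case True
        then obtain m where m: "x \<in> A m" by blast
        have "\<forall>\<^sub>F n in sequentially. indicator ((\<Union>i<n. A i) \<inter> {0..<a}) x = (indicator ((\<Union>i. A i) \<inter> {0..<a}) x :: real)"
          using eventually_gt_at_top[of m] by eventually_elim (use m in \<open>auto simp: indicator_def\<close>)
        then show ?thesis by (rule tendsto_eventually)
      next
        case False
        then show ?thesis by (simp add: indicator_def)
      qed
    qed
  qed
qed

text \<open>Induction over nonnegative Borel functions. Square-integrability is a premise of the
  induction because it has to pass down to summands, factors and members of monotone sequences,
  where the given function dominates.\<close>

lemma approximable_nonneg:
  assumes "u \<in> borel_measurable borel" "\<And>x. 0 \<le> u x" "sq_integrable (\<lambda>x. indicator {0..<a} x * u x)"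
  shows "approximable (\<lambda>x. indicator {0..<a} x * u x)"
  using assms
proof (induction rule: borel_measurable_induct_real)
  case (set A)
  have "(\<lambda>x. indicator {0..<a} x * indicator A x) = (indicator (A \<inter> {0..<a}) :: real \<Rightarrow> real)"
    by (auto simp: indicator_def fun_eq_iff)
  then show ?case using approximable_set[OF set(1)] by simp
next
  case (mult u c)
  show ?case
  proof (cases "c = 0")
    case True
    then show ?thesis using approximable_scale[OF approximable_whole, of 0] by simp
  next
    case False
    have "sq_integrable (\<lambda>x. inverse c * (indicator {0..<a} x * (c * u x)))"
      by (intro sq_integrable_scale mult)
    moreover have "inverse c * (indicator {0..<a} x * (c * u x)) = indicator {0..<a} x * u x" for x
      using False by simp
    ultimately have "approximable (\<lambda>x. indicator {0..<a} x * u x)"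
      by (intro mult.IH) (simp only:)
    from approximable_scale[OF this, of c] show ?thesis
      by (simp only: mult.left_commute)
  qed
next
  case (add u v)
  note [measurable] = add(1,4)
  have "sq_integrable (\<lambda>x. indicator {0..<a} x * u x)" "sq_integrable (\<lambda>x. indicator {0..<a} x * v x)"
    by (rule sq_integrable_bound[OF add.prems, where C = 1]; use add in \<open>force simp: indicator_def\<close>)+
  then show ?case
    using approximable_add[OF add.IH(2) add.IH(1)] by (simp add: distrib_left)
next
  case (seq U)
  note [measurable] = seq.hyps(1)
  have le: "U i x \<le> u x" for i x
    using seq.hyps(3) by (intro LIMSEQ_le_const[OF seq.hyps(4)]) (auto simp: incseq_def le_fun_def intro!: exI[of _ i])
  show ?case
  proof (rule approximable_limit[where F = "\<lambda>i x. indicator {0..<a} x * U i x"])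
    show "approximable (\<lambda>x. indicator {0..<a} x * U i x)" for i
    proof (rule seq.IH)
      show "sq_integrable (\<lambda>x. indicator {0..<a} x * U i x)"
        by (rule sq_integrable_bound[OF seq.prems, where C = 1])
           (use seq.hyps(2) order_trans[OF le abs_ge_self] in \<open>auto simp: indicator_def\<close>)
    qed
    show "(\<lambda>i. indicator {0..<a} x * U i x) \<longlonglongrightarrow> indicator {0..<a} x * u x" for x
      by (intro tendsto_intros seq.hyps(4)) simp
    show "\<bar>indicator {0..<a} x * u x - indicator {0..<a} x * U i x\<bar> \<le> indicator {0..<a} x * u x" for i x
      using le[of i x] seq.hyps(2)[of i x] by (auto simp: indicator_def)
  qed (rule seq.prems)+
qed

theorem steps_dense:
  assumes "\<phi> \<in> L2_on {0..<a}" "\<epsilon> > 0"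
  obtains N c where "N \<ge> 1" "norm (\<phi> - abs_l2 (step_fun a N c)) < \<epsilon>"
proof -
  define f where "f = rep_l2 \<phi>"
  have sq: "sq_integrable f" unfolding f_def by (rule rep_l2_sq_integrable)
  then have [measurable]: "f \<in> borel_measurable borel" by (simp add: sq_integrable_def)
  have "approximable (\<lambda>x. indicator {0..<a} x * max (f x) 0)"
    by (rule approximable_nonneg; (rule sq_integrable_bound[OF sq, where C = 1])?) (auto simp: indicator_def)
  moreover have "approximable (\<lambda>x. indicator {0..<a} x * max (- f x) 0)"
    by (rule approximable_nonneg; (rule sq_integrable_bound[OF sq, where C = 1])?) (auto simp: indicator_def)
  ultimately have "approximable (\<lambda>x. indicator {0..<a} x * max (f x) 0 - indicator {0..<a} x * max (- f x) 0)"
    by (rule approximable_diff)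
  moreover have "indicator {0..<a} x * max (f x) 0 - indicator {0..<a} x * max (- f x) 0 = indicator {0..<a} x * f x" for x
    by (simp add: indicator_def max_def)
  ultimately have ap: "approximable (\<lambda>x. indicator {0..<a} x * f x)"
    by (simp only:)
  have "AE x in lborel. rep_l2 \<phi> x = indicator {0..<a} x * f x"
    using assms(1) unfolding L2_on_def mem_Collect_eq f_def by eventually_elim (auto simp: indicator_def)
  then have "\<phi> = abs_l2 (\<lambda>x. indicator {0..<a} x * f x)"
    by (rule abs_l2_eqI[OF approximable_sq[OF ap]])
  then show thesis
    using ap assms(2) that unfolding approximable_def steps_def by blast
qed

end


section \<open>Concatenated copies\<close>

definition copies :: "real \<Rightarrow> nat \<Rightarrow> (real \<Rightarrow> real) \<Rightarrow> real \<Rightarrow> real" where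
  "copies a n f x = (\<Sum>i<n. indicator {real i * a..<(real i + 1) * a} x * f (x - real i * a))"

lemma concat_copies_abs:
  assumes "sq_integrable f"
  shows "concat_copies a n (abs_l2 f) = abs_l2 (copies a n f)"
  unfolding copies_def[abs_def]
  by (rule concat_copies.abs_eq) (use assms in \<open>simp add: l2_eq_def\<close>)

lemma copies_sq_integrable: "sq_integrable f \<Longrightarrow> sq_integrable (copies a n f)"
  unfolding copies_def[abs_def]
  by (intro sq_integrable_sum sq_integrable_indicator sq_integrable_shift) auto

lemma l2_abs_rep: "abs_l2 (rep_l2 f) = f"
  by (rule Quotient3_abs_rep[OF Quotient3_l2])

lemma concat_copies_add: "concat_copies a n (f + g) = concat_copies a n f + concat_copies a n g"
proof -
  note sq = rep_l2_sq_integrable[of f] rep_l2_sq_integrable[of g]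
  have "concat_copies a n (abs_l2 (rep_l2 f) + abs_l2 (rep_l2 g))
      = concat_copies a n (abs_l2 (rep_l2 f)) + concat_copies a n (abs_l2 (rep_l2 g))"
    unfolding abs_l2_add[OF sq, symmetric] concat_copies_abs[OF sq_integrable_add[OF sq]]
      concat_copies_abs[OF sq(1)] concat_copies_abs[OF sq(2)]
      abs_l2_add[OF copies_sq_integrable[OF sq(1)] copies_sq_integrable[OF sq(2)], symmetric]
    by (simp only: copies_def[abs_def] distrib_left sum.distrib)
  then show ?thesis by (simp only: l2_abs_rep)
qed

lemma concat_copies_scaleR: "concat_copies a n (r *\<^sub>R f) = r *\<^sub>R concat_copies a n f"
proof -
  note sq = rep_l2_sq_integrable[of f]
  have "concat_copies a n (r *\<^sub>R abs_l2 (rep_l2 f)) = r *\<^sub>R concat_copies a n (abs_l2 (rep_l2 f))"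
    unfolding abs_l2_scaleR[OF sq, symmetric] concat_copies_abs[OF sq_integrable_scale[OF sq]]
      concat_copies_abs[OF sq] abs_l2_scaleR[OF copies_sq_integrable[OF sq], symmetric]
    by (simp only: copies_def[abs_def] mult.left_commute[of _ r] sum_distrib_left)
  then show ?thesis by (simp only: l2_abs_rep)
qed

lemma concat_copies_diff: "concat_copies a n (f - g) = concat_copies a n f - concat_copies a n g"
proof -
  have "f - g = f + (-1) *\<^sub>R g" by simp
  then have "concat_copies a n (f - g) = concat_copies a n f + (-1) *\<^sub>R concat_copies a n g"
    by (simp only: concat_copies_add concat_copies_scaleR)
  then show ?thesis by simp
qed

text \<open>The triangle inequality over the n copies. The linear factor is crude, but harmless: n
  is fixed, and the precision demanded of the letters is divided by it later.\<close>

lemma norm_concat_copies: "norm (concat_copies a n f) \<le> norm f * real n"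
proof -
  define u where "u i x = indicator {real i * a..<(real i + 1) * a} x * rep_l2 f (x - real i * a)" for i :: nat and x
  have sq: "sq_integrable (u i)" for i
    unfolding u_def by (intro sq_integrable_indicator sq_integrable_shift rep_l2_sq_integrable) simp
  have le: "norm (abs_l2 (u i)) \<le> norm f" for i
  proof -
    have int: "integrable lborel (\<lambda>x. (rep_l2 f (x - real i * a))\<^sup>2)"
      using sq_integrable_shift[OF rep_l2_sq_integrable[of f], of "real i * a"] by (simp add: sq_integrable_def)
    have "(\<integral>x. (rep_l2 f (x - real i * a))\<^sup>2 \<partial>lborel) = (\<integral>x. (rep_l2 f x)\<^sup>2 \<partial>lborel)"
      using lborel_integral_real_affine[of 1 "\<lambda>x. (rep_l2 f x)\<^sup>2" "- (real i * a)"] by simp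
    then have "norm (abs_l2 (u i)) \<le> sqrt (\<integral>x. (rep_l2 f x)\<^sup>2 \<partial>lborel)"
      by (intro norm_abs_l2_le[OF sq int]) (auto simp: u_def indicator_def)
    then show ?thesis by (simp only: norm_l2_eq[of f])
  qed
  have "abs_l2 (\<lambda>x. \<Sum>i<k. u i x) = (\<Sum>i<k. abs_l2 (u i))" for k
  proof (induction k)
    case 0
    show ?case by (simp add: zero_l2_def)
  next
    case (Suc k)
    then show ?case using abs_l2_add[OF sq_integrable_sum[of "{..<k}" u] sq] sq by simp
  qed
  then have "concat_copies a n f = (\<Sum>i<n. abs_l2 (u i))"
    using concat_copies_abs[OF rep_l2_sq_integrable[of f], of a n] unfolding l2_abs_rep u_def copies_def[abs_def] by simp
  also have "norm \<dots> \<le> (\<Sum>i<n. norm f)"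
    by (rule sum_norm_le) (rule le)
  finally show ?thesis by (simp add: mult.commute)
qed

lemma bounded_linear_concat_copies: "bounded_linear (concat_copies a n)"
  by (rule bounded_linear_intro[OF concat_copies_add concat_copies_scaleR norm_concat_copies])

lemma copies_eval:
  assumes "a > 0" "0 \<le> x" "x < real n * a"
  shows "copies a n f x = f (x - of_int \<lfloor>x / a\<rfloor> * a)"
proof -
  define j where "j = nat \<lfloor>x / a\<rfloor>"
  have fl: "\<lfloor>x / a\<rfloor> = int j" using assms by (simp add: j_def)
  have j: "real j * a \<le> x" "x < (real j + 1) * a"
    using floor_divide_lower[OF assms(1), of x] floor_divide_upper[OF assms(1), of x] by (simp_all add: fl)
  have "real j * a < real n * a" using j(1) assms(3) by linarith
  then have jn: "j < n" using assms(1) by simp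
  have "indicator {real i * a..<(real i + 1) * a} x = (if i = j then 1 else 0 :: real)" for i
  proof (cases "i = j")
    case True
    then show ?thesis using j by simp
  next
    case False
    have "\<lfloor>x / a\<rfloor> = int i" if "real i * a \<le> x" "x < (real i + 1) * a"
      using that assms(1) by (intro floor_unique) (simp_all add: field_simps)
    with False fl have "x \<notin> {real i * a..<(real i + 1) * a}" by auto
    then show ?thesis using False by simp
  qed
  then have "copies a n f x = (\<Sum>i<n. if i = j then f (x - real i * a) else 0)"
    unfolding copies_def by (intro sum.cong refl) (simp only: mult_1 mult_zero_left split: if_split, simp)
  also have "\<dots> = f (x - real j * a)" using jn by simp
  finally show ?thesis by (simp add: fl)
qed

lemma copies_outside:
  assumes "a > 0" "x \<notin> {0..<real n * a}"
  shows "copies a n f x = 0"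
  unfolding copies_def
proof (rule sum.neutral, rule ballI)
  fix i assume "i \<in> {..<n}"
  then have "(real i + 1) * a \<le> real n * a" "0 \<le> real i * a"
    using assms(1) by (auto intro!: mult_right_mono)
  then have "x \<notin> {real i * a..<(real i + 1) * a}" using assms(2) by auto
  then show "indicator {real i * a..<(real i + 1) * a} x * f (x - real i * a) = 0" by simp
qed

lemma rep_concat_copies: "AE x in lborel. rep_l2 (concat_copies a n f) x = copies a n (rep_l2 f) x"
  using rep_abs_l2[OF copies_sq_integrable[OF rep_l2_sq_integrable[of f]], of a n]
    concat_copies_abs[OF rep_l2_sq_integrable[of f], of a n]
  by (simp add: l2_abs_rep)

lemma concat_copies_L2_on:
  assumes "a > 0"
  shows "concat_copies a n f \<in> L2_on {0..<real n * a}"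
  unfolding L2_on_def mem_Collect_eq
  using rep_concat_copies[of a n f] by eventually_elim (simp add: copies_outside[OF assms])

text \<open>Copying uses only the values on the first block, and there f agrees with g. Hence
  \<open>concat_copies a n\<close> is a projection onto its range.\<close>

lemma concat_copies_idem:
  assumes "a > 0" "n \<ge> 1" "f = concat_copies a n g"
  shows "concat_copies a n f = f"
proof -
  have AE: "AE x in lborel. indicator {0..<a} x * rep_l2 f x = indicator {0..<a} x * rep_l2 g x"
    using rep_concat_copies[of a n g] unfolding assms(3)
  proof eventually_elim
    case (elim x)
    show ?case
    proof (cases "x \<in> {0..<a}")
      case True
      have "x < 1 * a" using True by simp
      also have "1 * a \<le> real n * a" using assms(1,2) by (intro mult_right_mono) auto
      finally have "x < real n * a" .
      moreover have "\<lfloor>x / a\<rfloor> = 0" using True assms(1) by (intro floor_unique) auto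
      ultimately show ?thesis
        using elim copies_eval[OF assms(1), of x n "rep_l2 g"] True by simp
    qed simp
  qed
  then have "AE x in lborel. \<forall>i\<in>{..<n}. indicator {0..<a} (x - real i * a) * rep_l2 f (x - real i * a)
      = indicator {0..<a} (x - real i * a) * rep_l2 g (x - real i * a)"
    by (intro AE_finite_allI AE_lborel_shift[where P = "\<lambda>x. indicator {0..<a} x * rep_l2 f x = indicator {0..<a} x * rep_l2 g x"]) auto
  moreover have ind: "indicator {real i * a..<(real i + 1) * a} x = (indicator {0..<a} (x - real i * a) :: real)" for i x
    by (auto simp: indicator_def algebra_simps)
  ultimately have "AE x in lborel. copies a n (rep_l2 f) x = copies a n (rep_l2 g) x"
    unfolding copies_def ind by (elim eventually_mono) (rule sum.cong[OF refl], blast)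
  then have "AE x in lborel. rep_l2 (concat_copies a n f) x = rep_l2 (concat_copies a n g) x"
    using rep_concat_copies[of a n f] rep_concat_copies[of a n g] by eventually_elim simp
  then show ?thesis
    unfolding assms(3)[symmetric] l2_eq_iff .
qed

lemma concat_copies_restrict:
  assumes "a > 0"
  obtains \<phi> where "\<phi> \<in> L2_on {0..<a}" "concat_copies a n f = concat_copies a n \<phi>"
proof -
  define g where "g x = indicator {0..<a} x * rep_l2 f x" for x
  have sq: "sq_integrable g"
    unfolding g_def by (intro sq_integrable_indicator rep_l2_sq_integrable) simp
  have "abs_l2 g \<in> L2_on {0..<a}"
    unfolding L2_on_def mem_Collect_eq using rep_abs_l2[OF sq] by eventually_elim (simp add: g_def)
  moreover have "concat_copies a n (abs_l2 (rep_l2 f)) = concat_copies a n (abs_l2 g)"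
  proof -
    have "indicator {real i * a..<(real i + 1) * a} x * rep_l2 f (x - real i * a)
        = indicator {real i * a..<(real i + 1) * a} x * g (x - real i * a)" for i :: nat and x
      by (auto simp: g_def indicator_def algebra_simps)
    then have "copies a n (rep_l2 f) = copies a n g"
      unfolding copies_def[abs_def] by (simp only:)
    then show ?thesis
      unfolding concat_copies_abs[OF sq] concat_copies_abs[OF rep_l2_sq_integrable] by simp
  qed
  ultimately show thesis by (intro that[of "abs_l2 g"]) (simp_all add: l2_abs_rep)
qed

text \<open>As the fixed points of a continuous linear map, the set is visibly a closed
  subspace.\<close>

lemma copies_set_eq:
  assumes "a > 0" "n \<ge> 1"
  shows "{concat_copies a n \<phi> |\<phi>. \<phi> \<in> L2_on {0..<a}} = {f. concat_copies a n f = f}"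
proof (intro equalityI subsetI)
  fix f assume "f \<in> {concat_copies a n \<phi> |\<phi>. \<phi> \<in> L2_on {0..<a}}"
  then show "f \<in> {f. concat_copies a n f = f}"
    using concat_copies_idem[OF assms] by blast
next
  fix f assume "f \<in> {f. concat_copies a n f = f}"
  moreover obtain \<phi> where "\<phi> \<in> L2_on {0..<a}" "concat_copies a n f = concat_copies a n \<phi>"
    using concat_copies_restrict[OF assms(1)] by blast
  ultimately show "f \<in> {concat_copies a n \<phi> |\<phi>. \<phi> \<in> L2_on {0..<a}}" by auto
qed

lemma perfect_copies:
  assumes "a > 0" "n \<ge> 1"
  shows "perfect_set {concat_copies a n \<phi> |\<phi>. \<phi> \<in> L2_on {0..<a}}"
  unfolding perfect_set_def copies_set_eq[OF assms]
proof (intro conjI ballI)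
  have cont: "continuous_on UNIV (concat_copies a n)"
    using bounded_linear_concat_copies by (rule linear_continuous_on)
  show "closed {f. concat_copies a n f = f}"
    by (intro closed_Collect_eq cont continuous_on_id)
  \<comment> \<open>The class of the indicator of the whole period interval: a nonzero vector of the
    subspace, along which any of its points can be approached.\<close>
  define v where "v = concat_copies a n (abs_l2 (step_fun a 1 (\<lambda>_. 1)))"
  have v: "concat_copies a n v = v"
    by (rule concat_copies_idem[OF assms v_def])
  have sq: "sq_integrable (step_fun a 1 (\<lambda>_. 1))"
    by (rule step_fun_sq_integrable[OF assms(1)]) simp
  have v0: "v \<noteq> 0"
  proof
    assume "v = 0"
    then have eq: "abs_l2 (copies a n (step_fun a 1 (\<lambda>_. 1))) = abs_l2 (\<lambda>x. 0)"
      unfolding v_def concat_copies_abs[OF sq] zero_l2_def .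
    have "AE x in lborel. copies a n (step_fun a 1 (\<lambda>_. 1)) x = 0"
      using rep_abs_l2[OF copies_sq_integrable[OF sq], of a n, unfolded eq] rep_abs_l2[OF sq_integrable_zero]
      by eventually_elim simp
    then have "AE x in lborel. x \<notin> {0..<a}"
    proof eventually_elim
      case (elim x)
      show ?case
      proof
        assume x: "x \<in> {0..<a}"
        have "x < 1 * a" using x by simp
        also have "1 * a \<le> real n * a" using assms(1,2) by (intro mult_right_mono) auto
        finally have "x < real n * a" .
        moreover have "\<lfloor>x / a\<rfloor> = 0" using x assms(1) by (intro floor_unique) auto
        ultimately show False
          using elim copies_eval[OF assms(1), of x n "step_fun a 1 (\<lambda>_. 1)"] x by (simp add: step_fun_def)
      qed
    qed
    then have "emeasure lborel {0..<a} = 0"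
      by (subst (asm) AE_iff_measurable[of "{0..<a}"]) auto
    with assms(1) show False by simp
  qed
  fix y assume y: "y \<in> {f. concat_copies a n f = f}"
  show "\<not> y isolated_in {f. concat_copies a n f = f}"
  proof
    assume "y isolated_in {f. concat_copies a n f = f}"
    then obtain T where T: "open T" "T \<inter> {f. concat_copies a n f = f} = {y}"
      unfolding isolated_in_def by blast
    then have "y \<in> T" by blast
    then obtain e where e: "e > 0" "\<And>z. dist z y < e \<Longrightarrow> z \<in> T"
      using T(1) unfolding open_dist by blast
    define z where "z = y + (e / (2 * norm v)) *\<^sub>R v"
    have "dist z y = e / 2"
      using v0 e(1) by (simp add: z_def dist_norm)
    then have "z \<in> T" using e by simp
    moreover have "concat_copies a n z = z"
      using y v by (simp add: z_def concat_copies_add concat_copies_scaleR)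
    ultimately have "z = y" using T(2) by blast
    then show False using v0 e(1) by (simp add: z_def)
  qed
qed

section \<open>From words of step letters to step potentials\<close>

lemma schroedinger_cong_AE:
  assumes "AE x in lborel. V x = V' x"
  shows "schroedinger V = schroedinger V'"
proof -
  have "(AE x in lborel. g x = - w x + V x * u x) \<longleftrightarrow> (AE x in lborel. g x = - w x + V' x * u x)" for g w u :: "real \<Rightarrow> real"
  proof
    assume "AE x in lborel. g x = - w x + V x * u x"
    then show "AE x in lborel. g x = - w x + V' x * u x" using assms by eventually_elim simp
  next
    assume "AE x in lborel. g x = - w x + V' x * u x"
    then show "AE x in lborel. g x = - w x + V x * u x" using assms by eventually_elim simp
  qed
  then show ?thesis unfolding schroedinger_def by simp
qed

lemma nth_concat_blocks:
  assumes "i < length xs * K"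
  shows "concat (map (\<lambda>x. map (g x) [0..<K]) xs) ! i = g (xs ! (i div K)) (i mod K)"
  using assms
proof (induction xs arbitrary: i)
  case (Cons x xs)
  show ?case
  proof (cases "i < K")
    case True
    then show ?thesis by (simp add: nth_append)
  next
    case False
    then have K: "K > 0" using Cons.prems by (cases K) auto
    have i: "i = (i - K) + K" using False by simp
    have "i div K = Suc ((i - K) div K)" "i mod K = (i - K) mod K"
      using K i by (metis Suc_eq_plus1 div_add_self2 neq0_conv, metis mod_add_self2)
    moreover have "i - K < length xs * K" using Cons.prems False by auto
    ultimately show ?thesis using Cons.IH[of "i - K"] False by (simp add: nth_append)
  qed
qed simp

lemma length_concat_blocks: "length (concat (map (\<lambda>x. map (g x) [0..<K]) xs)) = length xs * K"
  by (induction xs) auto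

lemma concat_replicate_blocks:
  "concat (replicate n (map f [0..<N])) = map (\<lambda>i. f (i mod N)) [0..<n * N]"
proof (rule nth_equalityI)
  have eq: "concat (replicate n (map f [0..<N])) = concat (map (\<lambda>_. map f [0..<N]) [0..<n])"
    by (simp add: map_replicate_const)
  show len: "length (concat (replicate n (map f [0..<N]))) = length (map (\<lambda>i. f (i mod N)) [0..<n * N])"
    unfolding eq using length_concat_blocks[of "\<lambda>_. f" N "[0..<n]"] by simp
  fix i assume "i < length (concat (replicate n (map f [0..<N])))"
  then have "i < n * N" unfolding len by simp
  then show "concat (replicate n (map f [0..<N])) ! i = map (\<lambda>i. f (i mod N)) [0..<n * N] ! i"
    unfolding eq using nth_concat_blocks[of i "[0..<n]" N "\<lambda>_. f"] by simp
qed

lemma mprod_concat: "mprod (concat Ls) = mprod (map mprod Ls)"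
  by (induction Ls) (auto simp: mprod_append)

definition letter :: "real \<Rightarrow> nat \<Rightarrow> nat \<Rightarrow> (nat \<Rightarrow> real) \<Rightarrow> l2" where
  "letter a n N c = concat_copies a n (abs_l2 (step_fun a N c))"

lemma copies_step_eval:
  assumes "a > 0" "N \<ge> 1" "0 \<le> x" "x < real n * a"
  shows "copies a n (step_fun a N c) x
    = c (nat \<lfloor>x / (a / real N)\<rfloor> mod N)"
proof -
  define h where "h = a / real N"
  have h: "h > 0" using assms by (simp add: h_def)
  have ah: "a = h * real_of_int (int N)" using assms by (simp add: h_def)
  have "\<lfloor>x / a\<rfloor> = \<lfloor>x / h / real_of_int (int N)\<rfloor>" unfolding ah by simp
  also have "\<dots> = \<lfloor>x / h\<rfloor> div int N" by (rule floor_divide_real_eq_div) simp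
  finally have fl: "\<lfloor>x / a\<rfloor> = \<lfloor>x / h\<rfloor> div int N" .
  define t where "t = x - of_int \<lfloor>x / a\<rfloor> * a"
  have t: "0 \<le> t" "t < a"
    using floor_divide_lower[OF assms(1), of x] floor_divide_upper[OF assms(1), of x]
    by (simp_all add: t_def distrib_right)
  have "t * real N / a = x / h - of_int (\<lfloor>x / a\<rfloor> * int N)"
    using h assms(2) by (simp add: t_def ah field_simps)
  then have "\<lfloor>t * real N / a\<rfloor> = \<lfloor>x / h\<rfloor> - \<lfloor>x / a\<rfloor> * int N"
    by (metis floor_diff_of_int)
  also have "\<dots> = \<lfloor>x / h\<rfloor> mod int N"
    unfolding fl by (simp add: minus_div_mult_eq_mod)
  finally have "nat \<lfloor>t * real N / a\<rfloor> = nat \<lfloor>x / h\<rfloor> mod N"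
    using h assms(3) by (simp add: nat_mod_distrib)
  then have "step_fun a N c t = c (nat \<lfloor>x / h\<rfloor> mod N)"
    using t by (simp add: step_fun_def)
  then show ?thesis
    unfolding copies_eval[OF assms(1,3,4)] t_def h_def .
qed

lemma floor_div_grid:
  assumes "h > 0" "D \<ge> 1"
  shows "\<lfloor>x / (real D * h)\<rfloor> = \<lfloor>x / h\<rfloor> div int D"
proof -
  have "x / (real D * h) = x / h / real_of_int (int D)" by simp
  then show ?thesis by (simp only: floor_divide_real_eq_div)
qed

text \<open>On the grid of width h = a / N each letter occupies D = n N cells, and the potential of
  the word is almost everywhere a step potential of period P D cells. The matrix in the hypothesis
  is its monodromy, with the n copies in a letter giving the n-th power.\<close>

lemma step_word_gap:
  fixes cs :: "(nat \<Rightarrow> real) list"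
  assumes a: "a > 0" and n: "n \<ge> 1" and N: "N \<ge> 1" and cs: "cs \<noteq> []"
    and hyp: "\<bar>trace (mprod (map (\<lambda>c. mprod (replicate n (mprod (map (cell (a / real N)) (map (\<lambda>k. c k - E) [0..<N]))))) cs))\<bar> > 2"
  shows "E \<notin> spec (schroedinger_word (real n * a) (map (letter a n N) cs))"
proof -
  define h where "h = a / real N"
  define D where "D = n * N"
  define P where "P = length cs"
  have h: "h > 0" using a N by (simp add: h_def)
  have D: "D \<ge> 1" using n N by (simp add: D_def)
  have P: "P \<ge> 1" using cs by (cases cs) (auto simp: P_def)
  have na: "real n * a = real D * h" using N by (simp add: D_def h_def)
  define qs where "qs = concat (map (\<lambda>c. map (\<lambda>i. c (i mod N) - E) [0..<D]) cs)"
  have len: "length qs = P * D"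
    unfolding qs_def P_def by (rule length_concat_blocks)
  have qs0: "qs \<noteq> []" using len P D by auto
  have nth: "qs ! i = (cs ! (i div D)) (i mod D mod N) - E" if "i < P * D" for i
    unfolding qs_def using nth_concat_blocks[of i cs D "\<lambda>c i. c (i mod N) - E"] that by (simp add: P_def)
  have "map (cell h) qs = concat (map (\<lambda>c. concat (replicate n (map (cell h) (map (\<lambda>k. c k - E) [0..<N])))) cs)"
  proof -
    have "map (cell h) (map (\<lambda>i. c (i mod N) - E) [0..<D]) = concat (replicate n (map (cell h) (map (\<lambda>k. c k - E) [0..<N])))" for c
      using concat_replicate_blocks[of n "\<lambda>k. cell h (c k - E)" N] by (simp add: D_def o_def)
    then show ?thesis by (simp add: qs_def map_concat o_def)
  qed
  then have "mprod (map (cell h) qs) = mprod (map (\<lambda>c. mprod (replicate n (mprod (map (cell h) (map (\<lambda>k. c k - E) [0..<N]))))) cs)"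
    by (simp add: mprod_concat o_def map_replicate)
  with hyp have hyp': "\<bar>trace (mprod (map (cell h) qs))\<bar> > 2" by (simp only: h_def)
  \<comment> \<open>The period starts at cell D, not at cell 0: letters are numbered from 1, so the
    first letter of the word sits on the interval from c to 2 c with c = n a.\<close>
  define V where "V x = qs ! nat ((\<lfloor>x / h\<rfloor> - int D) mod int (length qs)) + E" for x
  have "E \<notin> spec (schroedinger V)"
    by (rule hyperbolic_step_potential_gap[OF h qs0 hyp', where ?i0.0 = "int D"]) (simp add: V_def)
  moreover have "schroedinger (natural (real n * a) (periodize (map (letter a n N) cs))) = schroedinger V"
  proof (rule schroedinger_cong_AE)
    show "AE x in lborel. natural (real n * a) (periodize (map (letter a n N) cs)) x = V x"
    proof -
      define u where "u c = copies a n (step_fun a N c)" for c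
      have rep: "AE x in lborel. rep_l2 (letter a n N c) x = u c x" for c
      proof -
        have sq: "sq_integrable (step_fun a N c)" by (rule step_fun_sq_integrable[OF a N])
        show ?thesis
          unfolding letter_def concat_copies_abs[OF sq] u_def by (rule rep_abs_l2[OF copies_sq_integrable[OF sq]])
      qed
      define cj where "cj j = cs ! nat ((j - 1) mod int P)" for j
      have per: "periodize (map (letter a n N) cs) j = letter a n N (cj j)" for j
      proof -
        have "0 \<le> (j - 1) mod int P" "(j - 1) mod int P < int P" using P by simp_all
        then have "nat ((j - 1) mod int P) < length cs" by (simp add: P_def nat_less_iff)
        then show ?thesis by (simp add: periodize_def cj_def P_def)
      qed
      \<comment> \<open>The letter in use depends on x, so the exceptional null sets of all
        translates, countably many, are removed at once.\<close>
      have "AE x in lborel. \<forall>j. rep_l2 (letter a n N (cj j)) (x - of_int j * (real n * a)) = u (cj j) (x - of_int j * (real n * a))"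
        unfolding AE_all_countable
        by (intro allI AE_lborel_shift[where P = "\<lambda>x. rep_l2 (letter a n N _) x = u _ x"] rep)
      then show ?thesis
      proof eventually_elim
        case (elim x)
        define i where "i = \<lfloor>x / h\<rfloor>"
        define j where "j = \<lfloor>x / (real n * a)\<rfloor>"
        have j: "j = i div int D"
          unfolding j_def i_def na by (rule floor_div_grid[OF h D])
        define t where "t = x - of_int j * (real n * a)"
        have na0: "0 < real n * a" using a n by simp
        have t: "0 \<le> t" "t < real n * a"
          using floor_divide_lower[OF na0, of x] floor_divide_upper[OF na0, of x]
          by (simp_all add: t_def j_def distrib_right)
        have "t / h = x / h - of_int (j * int D)"
          unfolding t_def na using h by (simp add: diff_divide_distrib)
        then have "\<lfloor>t / h\<rfloor> = i - j * int D"
          unfolding i_def by (metis floor_diff_of_int)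
        also have "\<dots> = i mod int D" unfolding j by (simp add: minus_div_mult_eq_mod)
        finally have th: "\<lfloor>t / h\<rfloor> = i mod int D" .
        have "natural (real n * a) (periodize (map (letter a n N) cs)) x = rep_l2 (letter a n N (cj j)) t"
          by (simp only: natural_def per j_def t_def)
        also have "\<dots> = u (cj j) t" using elim unfolding t_def by blast
        also have "\<dots> = cj j (nat (i mod int D) mod N)"
          unfolding u_def copies_step_eval[OF a N t] h_def[symmetric] th ..
        finally have nat: "natural (real n * a) (periodize (map (letter a n N) cs)) x = cj j (nat (i mod int D) mod N)" .
        define I where "I = (i - int D) mod int (P * D)"
        \<comment> \<open>Division of the cell index by D separates the letter from the cell inside
          it; subtracting D lowers the letter number by one and leaves the inner position
          unchanged.\<close>
        have Ieq: "I = int D * ((j - 1) mod int P) + i mod int D"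
        proof -
          have "I = (i - int D) mod (int D * int P)" by (simp add: I_def mult.commute)
          also have "\<dots> = int D * ((i - int D) div int D mod int P) + (i - int D) mod int D"
            by (rule zmod_zmult2_eq) simp
          also have "(i - int D) div int D = j - 1"
          proof -
            have "(i + (-1) * int D) div int D = -1 + i div int D"
              using D by (intro div_mult_self1) auto
            then show ?thesis by (simp add: j)
          qed
          also have "(i - int D) mod int D = i mod int D" by simp
          finally show ?thesis .
        qed
        have rD: "0 \<le> i mod int D" "i mod int D < int D" using D by simp_all
        have I0: "0 \<le> I" "I < int (P * D)" using P D by (simp_all add: I_def)
        have Idiv: "I div int D = (j - 1) mod int P" "I mod int D = i mod int D"
          using rD D unfolding Ieq by simp_all
        have "V x = qs ! nat I + E" by (simp add: V_def len I_def i_def)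
        also have "\<dots> = (cs ! (nat I div D)) (nat I mod D mod N)"
          using nth[of "nat I"] I0 by (simp add: nat_less_iff)
        also have "nat I div D = nat ((j - 1) mod int P)"
          using I0(1) Idiv(1) by (metis nat_div_distrib nat_int of_nat_0_le_iff)
        also have "nat I mod D = nat (i mod int D)"
          using I0(1) Idiv(2) by (metis nat_mod_distrib nat_int of_nat_0_le_iff)
        finally show ?case unfolding nat cj_def by simp
      qed
    qed
  qed
  ultimately show ?thesis
    unfolding schroedinger_word_def by (simp only: not_False_eq_True)
qed


section \<open>Gap-richness\<close>

lemma letter_in_copies:
  assumes "a > 0" "N \<ge> 1"
  shows "letter a n N c \<in> {concat_copies a n \<phi> |\<phi>. \<phi> \<in> L2_on {0..<a}}"
proof -
  have sq: "sq_integrable (step_fun a N c)" by (rule step_fun_sq_integrable[OF assms])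
  have "abs_l2 (step_fun a N c) \<in> L2_on {0..<a}"
    unfolding L2_on_def mem_Collect_eq using rep_abs_l2[OF sq]
    by eventually_elim (simp add: step_fun_def)
  then show ?thesis unfolding letter_def by blast
qed

text \<open>The transfer matrices of all letters need one cell length, so the grids found for the
  single letters are refined to their common product.\<close>

lemma common_step_approximation:
  assumes a: "a > 0" and "\<And>\<phi>. \<phi> \<in> set \<phi>s \<Longrightarrow> \<phi> \<in> L2_on {0..<a}" and e: "\<epsilon> > 0"
  obtains N cs where "N \<ge> 2" "length cs = length \<phi>s"
    "\<And>k. k < length \<phi>s \<Longrightarrow> norm (\<phi>s ! k - abs_l2 (step_fun a N (cs ! k))) < \<epsilon>"
proof -
  interpret step_approximation a by unfold_locales (rule a)
  have "\<exists>N cs. N \<ge> 1 \<and> length cs = length \<phi>s \<and>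
      (\<forall>k<length \<phi>s. norm (\<phi>s ! k - abs_l2 (step_fun a N (cs ! k))) < \<epsilon>)"
    using assms(2)
  proof (induction \<phi>s)
    case Nil
    show ?case by (intro exI[of _ 1] exI[of _ "[]"]) simp
  next
    case (Cons \<phi> \<phi>s)
    obtain M c where c: "M \<ge> 1" "norm (\<phi> - abs_l2 (step_fun a M c)) < \<epsilon>"
      using steps_dense[of \<phi> \<epsilon>] Cons.prems e by auto
    obtain N cs where cs: "N \<ge> 1" "length cs = length \<phi>s"
      "\<And>k. k < length \<phi>s \<Longrightarrow> norm (\<phi>s ! k - abs_l2 (step_fun a N (cs ! k))) < \<epsilon>"
      using Cons by auto
    define c' where "c' i = c (i div N)" for i
    define cs' where "cs' = map (\<lambda>c i. c (i div M)) cs"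
    have "step_fun a (M * N) c' = step_fun a M c"
      unfolding c'_def by (rule step_fun_refine[OF a cs(1)])
    moreover have "step_fun a (M * N) (cs' ! k) = step_fun a N (cs ! k)" if "k < length \<phi>s" for k
      using step_fun_refine[OF a c(1), of N "cs ! k"] that cs(2) by (simp add: cs'_def mult.commute)
    ultimately have "norm ((\<phi> # \<phi>s) ! k - abs_l2 (step_fun a (M * N) ((c' # cs') ! k))) < \<epsilon>"
      if "k < length (\<phi> # \<phi>s)" for k
      using that c(2) cs(3) by (cases k) auto
    then show ?case
      using c(1) cs(1,2) by (intro exI[of _ "M * N"] exI[of _ "c' # cs'"]) (simp add: cs'_def)
  qed
  then obtain N cs where cs: "N \<ge> 1" "length cs = length \<phi>s"
    "\<And>k. k < length \<phi>s \<Longrightarrow> norm (\<phi>s ! k - abs_l2 (step_fun a N (cs ! k))) < \<epsilon>"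
    by blast
  show thesis
  \<comment> \<open>Halving the cells once more guarantees that the first two cells, which are to be
    perturbed, exist.\<close>
  proof (rule that[of "N * 2" "map (\<lambda>c i. c (i div 2)) cs"])
    fix k assume "k < length \<phi>s"
    then show "norm (\<phi>s ! k - abs_l2 (step_fun a (N * 2) (map (\<lambda>c i. c (i div 2)) cs ! k))) < \<epsilon>"
      using cs(3)[of k] cs(2) step_fun_refine[OF a, of 2 N "cs ! k"] by simp
  qed (use cs in auto)
qed

text \<open>The periodic extension of a word is that of its T-fold repetition, so a long word may be
  compared with the short one letter by letter.\<close>

lemma word_dist_le:
  assumes "length ys = T * length xs" "xs \<noteq> []" "T \<ge> 1"
    and "\<And>i. i < length ys \<Longrightarrow> dist (xs ! (i mod length xs)) (ys ! i) \<le> e"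
  shows "word_dist xs ys \<le> e"
  unfolding word_dist_def
proof (rule cSUP_least)
  fix j :: int
  define i where "i = nat ((j - 1) mod int (length ys))"
  have len: "length ys > 0" "length xs > 0" using assms(1-3) by auto
  have i: "i < length ys"
    using len(1) by (simp add: i_def nat_less_iff)
  have "(j - 1) mod int (length xs) = (j - 1) mod int (length ys) mod int (length xs)"
    using assms(1) by (simp add: mod_mod_cancel)
  then have "nat ((j - 1) mod int (length xs)) = i mod length xs"
    using len by (simp add: i_def nat_mod_distrib)
  then show "dist (periodize xs j) (periodize ys j) \<le> e"
    using assms(4)[OF i] by (simp add: periodize_def i_def)
qed simp

theorem copies_gap:
  assumes a: "a > 0" and n: "n \<ge> 1"
    and x: "x \<in> words {concat_copies a n \<phi> |\<phi>. \<phi> \<in> L2_on {0..<a}}" and e: "\<epsilon> > 0"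
  obtains y where "y \<in> words {concat_copies a n \<phi> |\<phi>. \<phi> \<in> L2_on {0..<a}}"
    "word_dist x y < \<epsilon>" "E \<notin> spec (schroedinger_word (real n * a) y)"
proof -
  have x0: "x \<noteq> []" and "\<forall>f\<in>set x. \<exists>\<phi>\<in>L2_on {0..<a}. f = concat_copies a n \<phi>"
    using x unfolding words_def by auto
  then obtain \<Phi> where \<Phi>: "\<And>f. f \<in> set x \<Longrightarrow> \<Phi> f \<in> L2_on {0..<a} \<and> f = concat_copies a n (\<Phi> f)"
    by metis
  define \<phi>s where "\<phi>s = map \<Phi> x"
  have len: "length \<phi>s = length x" by (simp add: \<phi>s_def)
  have \<phi>s: "\<phi>s ! k \<in> L2_on {0..<a}" "x ! k = concat_copies a n (\<phi>s ! k)" if "k < length x" for k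
    using \<Phi>[of "x ! k"] that by (auto simp: \<phi>s_def)
  \<comment> \<open>A letter is moved by at most \<eta> for the step approximation and \<eta> for
    the perturbation; forming n copies multiplies this by at most n, which leaves a total of
    \<epsilon> / 2.\<close>
  define \<eta> where "\<eta> = \<epsilon> / (4 * real n)"
  have \<eta>: "\<eta> > 0" using e n by (simp add: \<eta>_def)
  obtain N cs where N: "N \<ge> 2" and cs_len: "length cs = length \<phi>s"
    and cs: "\<And>k. k < length \<phi>s \<Longrightarrow> norm (\<phi>s ! k - abs_l2 (step_fun a N (cs ! k))) < \<eta>"
    using common_step_approximation[OF a _ \<eta>, of \<phi>s] \<Phi> unfolding \<phi>s_def by auto
  have N1: "N \<ge> 1" using N by simp
  obtain c rest where crest: "cs = c # rest"
    using cs_len len x0 by (cases cs) auto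
  define h where "h = a / real N"
  have h: "h > 0" using a N by (simp add: h_def)
  \<comment> \<open>A uniform change of at most \<delta> on an interval of length a costs at most
    \<delta> times the square root of a in norm, that is \<eta>.\<close>
  define \<delta> where "\<delta> = \<eta> / sqrt a"
  have \<delta>: "\<delta> > 0" using \<eta> a by (simp add: \<delta>_def)
  define block where "block c = mprod (replicate n (mprod (map (cell h) (map (\<lambda>k. c k - E) [0..<N]))))"
    for c :: "nat \<Rightarrow> real"
  define P where "P = mprod (map block rest)"
  have det_block: "det (block c) = 1" for c
    unfolding block_def by (intro det_mprod) (auto intro!: det_mprod)
  have detP: "det P = 1"
    unfolding P_def by (intro det_mprod) (auto simp: det_block)
  \<comment> \<open>The change is made in the function before it is copied, so the perturbed letter
    stays in the given set and its transfer matrix is again an n-th power.\<close>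
  define pert where "pert r s = c(0 := c 0 + r, 1 := c 1 + s)" for r s :: real
  define q0 where "q0 = c 0 - E"
  define q1 where "q1 = c 1 - E"
  define qs where "qs = map (\<lambda>k. c k - E) [2..<N]"
  have cells: "map (\<lambda>k. pert r s k - E) [0..<N] = (q0 + r) # (q1 + s) # qs" for r s
  proof -
    have "[0..<N] = 0 # 1 # [2..<N]"
      using N by (simp add: upt_conv_Cons numeral_2_eq_2)
    then show ?thesis
      by (simp add: pert_def q0_def q1_def qs_def)
  qed
  obtain r s r' s' where rs: "{r, s, r', s'} \<subseteq> {0<..<\<delta>}"
    and nc: "(P ** block (pert r s)) ** (P ** block (pert r' s')) \<noteq> (P ** block (pert r' s')) ** (P ** block (pert r s))"
    using noncommuting_perturbation[OF h \<delta> detP n, of q0 q1 qs] unfolding block_def cells by blast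
  obtain ws where ws: "ws \<noteq> []" "set ws \<subseteq> {P ** block (pert r s), P ** block (pert r' s')}"
    "\<bar>trace (mprod ws)\<bar> > 2"
  proof -
    have "det (P ** block d) = 1" for d by (simp add: det_mul detP det_block)
    from noncommuting_semigroup_hyperbolic[OF this this nc] that show thesis by blast
  qed
  \<comment> \<open>The product only knows matrices; to build a word, the perturbation behind each
    factor has to be recovered.\<close>
  have "\<exists>ts. set ts \<subseteq> {pert r s, pert r' s'} \<and> ws = map (\<lambda>c. P ** block c) ts"
    using ws(2)
  proof (induction ws)
    case Nil
    show ?case by (intro exI[of _ "[]"]) simp
  next
    case (Cons w ws)
    then obtain ts where ts: "set ts \<subseteq> {pert r s, pert r' s'}" "ws = map (\<lambda>c. P ** block c) ts" by auto
    obtain t where "t \<in> {pert r s, pert r' s'}" "w = P ** block t" using Cons.prems by auto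
    with ts show ?case by (intro exI[of _ "t # ts"]) simp
  qed
  then obtain ts where ts: "set ts \<subseteq> {pert r s, pert r' s'}" "ws = map (\<lambda>c. P ** block c) ts"
    by blast
  \<comment> \<open>Each generator is the monodromy of a full copy of the word with its first letter
    perturbed, so the hyperbolic product is that of a concatenation of such copies. Its length is a
    multiple of that of x.\<close>
  define ds where "ds = concat (map (\<lambda>t. t # rest) ts)"
  have "mprod (map block ds) = mprod ws"
    unfolding ds_def ts(2) map_concat mprod_concat by (simp add: o_def P_def)
  with ws(3) have hyp: "\<bar>trace (mprod (map block ds))\<bar> > 2" by simp
  have ts0: "ts \<noteq> []" using ws(1) ts(2) by auto
  then have ds0: "ds \<noteq> []" by (cases ts) (auto simp: ds_def)
  define y where "y = map (letter a n N) ds"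
  have gap: "E \<notin> spec (schroedinger_word (real n * a) y)"
    unfolding y_def by (rule step_word_gap[OF a n N1 ds0]) (use hyp in \<open>simp only: block_def[abs_def] h_def\<close>)
  have words: "y \<in> words {concat_copies a n \<phi> |\<phi>. \<phi> \<in> L2_on {0..<a}}"
    unfolding words_def y_def using ds0 letter_in_copies[OF a N1, of n] by auto
  define p where "p = length x"
  have p: "length (t # rest) = p" for t :: "nat \<Rightarrow> real"
    using crest cs_len len by (simp add: p_def)
  have "map ((!) (t # rest)) [0..<p] = t # rest" for t
    using map_nth[of "t # rest"] unfolding p .
  then have ds: "ds = concat (map (\<lambda>t. map ((!) (t # rest)) [0..<p]) ts)"
    unfolding ds_def by (simp only:)
  have ds_len: "length ds = length ts * p"
    unfolding ds by (rule length_concat_blocks)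
  have ds_nth: "ds ! i = (ts ! (i div p) # rest) ! (i mod p)" if "i < length ts * p" for i
    unfolding ds by (rule nth_concat_blocks[OF that])
  have p0: "p > 0" using x0 by (simp add: p_def)
  have close: "norm (\<phi>s ! k - abs_l2 (step_fun a N ((t # rest) ! k))) \<le> 2 * \<eta>"
    if "k < p" "t \<in> set ts" for k t
  proof (cases k)
    case 0
    have "\<bar>c i - t i\<bar> \<le> \<delta>" for i
      using that(2) ts(1) rs \<delta> by (auto simp: pert_def)
    then have "norm (abs_l2 (step_fun a N c) - abs_l2 (step_fun a N t)) \<le> \<delta> * sqrt a"
      by (rule step_fun_close[OF a N1])
    also have "\<dots> = \<eta>" using a by (simp add: \<delta>_def)
    finally have "norm (abs_l2 (step_fun a N c) - abs_l2 (step_fun a N t)) \<le> \<eta>" .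
    moreover have "norm (\<phi>s ! 0 - abs_l2 (step_fun a N c)) < \<eta>"
      using cs[of 0] crest that(1) 0 len by (simp add: p_def)
    ultimately have "norm (\<phi>s ! 0 - abs_l2 (step_fun a N t)) \<le> 2 * \<eta>"
      using norm_triangle_ineq[of "\<phi>s ! 0 - abs_l2 (step_fun a N c)" "abs_l2 (step_fun a N c) - abs_l2 (step_fun a N t)"]
      by simp
    then show ?thesis using 0 by simp
  next
    case (Suc m)
    then show ?thesis
      using cs[of k] crest that(1) len \<eta> by (simp add: p_def)
  qed
  have "word_dist x y \<le> 2 * \<eta> * real n"
  proof (rule word_dist_le[where T = "length ts"])
    show "length y = length ts * length x" by (simp add: y_def ds_len p_def)
    show "length ts \<ge> 1" using ts0 by (cases ts) auto
    fix i assume i: "i < length y"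
    then have i': "i < length ts * p" by (simp add: y_def ds_len)
    define k where "k = i mod p"
    define t where "t = ts ! (i div p)"
    have k: "k < p" using p0 by (simp add: k_def)
    have "i div p < length ts" using i' p0 by (simp add: div_less_iff_less_mult)
    then have t: "t \<in> set ts" by (simp add: t_def)
    have "x ! (i mod length x) = concat_copies a n (\<phi>s ! k)"
      unfolding p_def[symmetric] k_def[symmetric] using k by (intro \<phi>s(2)) (simp only: p_def)
    moreover have "y ! i = concat_copies a n (abs_l2 (step_fun a N ((t # rest) ! k)))"
      using i unfolding y_def length_map nth_map[OF i[unfolded y_def length_map]] ds_nth[OF i'] letter_def k_def t_def
      by (simp only:)
    ultimately have "dist (x ! (i mod length x)) (y ! i)
        = norm (concat_copies a n (\<phi>s ! k - abs_l2 (step_fun a N ((t # rest) ! k))))"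
      by (simp only: dist_norm concat_copies_diff)
    also have "\<dots> \<le> norm (\<phi>s ! k - abs_l2 (step_fun a N ((t # rest) ! k))) * real n"
      by (rule norm_concat_copies)
    also have "\<dots> \<le> 2 * \<eta> * real n"
      by (intro mult_right_mono close k t) simp
    finally show "dist (x ! (i mod length x)) (y ! i) \<le> 2 * \<eta> * real n" .
  qed (rule x0)
  also have "\<dots> < \<epsilon>" using e n by (simp add: \<eta>_def)
  finally have "word_dist x y < \<epsilon>" .
  with words show thesis using gap by (rule that)
qed

theorem theorem2p18:
  fixes a :: real and n :: nat
  assumes "a > 0" and "n \<ge> 1"
  shows "gap_rich (real n * a) {concat_copies a n \<phi> |\<phi>. \<phi> \<in> L2_on {0..<a}}"
proof -
  have "gap_rich_except (real n * a) {concat_copies a n \<phi> |\<phi>. \<phi> \<in> L2_on {0..<a}} {}"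
    unfolding gap_rich_except_def
  proof (intro conjI allI impI ballI)
    show "0 < real n * a" using assms by simp
    show "{concat_copies a n \<phi> |\<phi>. \<phi> \<in> L2_on {0..<a}} \<subseteq> L2_on {0..<real n * a}"
      using concat_copies_L2_on[OF assms(1)] by blast
    show "perfect_set {concat_copies a n \<phi> |\<phi>. \<phi> \<in> L2_on {0..<a}}"
      by (rule perfect_copies[OF assms])
    show "discrete ({} :: real set)"
      by (simp add: discrete_def)
  next
    fix E \<epsilon> :: real and x
    assume "x \<in> words {concat_copies a n \<phi> |\<phi>. \<phi> \<in> L2_on {0..<a}}" "0 < \<epsilon>"
    then obtain y where "y \<in> words {concat_copies a n \<phi> |\<phi>. \<phi> \<in> L2_on {0..<a}}"
      "word_dist x y < \<epsilon>" "E \<notin> spec (schroedinger_word (real n * a) y)"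
      by (rule copies_gap[OF assms])
    then show "\<exists>y\<in>words {concat_copies a n \<phi> |\<phi>. \<phi> \<in> L2_on {0..<a}}.
        word_dist x y < \<epsilon> \<and> E \<notin> spec (schroedinger_word (real n * a) y)"
      by (intro bexI[of _ y] conjI)
  qed
  then show ?thesis unfolding gap_rich_def by blast
qed

end
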